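(* Let $0<d<n$ and let $X\subset\mathbb{C}^n$ be a closed pure $d$-dimensional complex analytic set. If $X$ is nonalgebraic, then $$\mathbb{P}(L)\cap\Sigma_\infty(X)\neq\varnothing$$ for every $L\in\operatorname{Gr}_{\mathbb{C}}(n-d,n)$.
   Context: A closed pure $d$-dimensional complex analytic set $X\subset\mathbb{C}^n$ is a nonempty closed complex analytic subset having dimension $d$ at each of its points. $X$ is algebraic if it is the common zero set of a family of polynomials in $\mathbb{C}[z_1,\dots,z_n]$, and nonalgebraic otherwise. For $A\subset\mathbb{C}^n$, the total tangent cone at infinity is $$C_\infty(A)=\{v\in\mathbb{C}^n:\exists\, x_j\in A,\ t_j>0,\ \|x_j\|\to\infty,\ t_j\to\infty,\ x_j/t_j\to v\}.$$ The projective asymptotic direction set is $\Sigma_\infty(A)=\{\mathbb{C}v: v\in C_\infty(A)\setminus\{0\}\}\subset\mathbb{P}^{n-1}(\mathbb{C})$, where $\mathbb{P}^{n-1}(\mathbb{C})$ is the space of complex lines through the origin in $\mathbb{C}^n$. $\operatorname{Gr}_{\mathbb{C}}(k,n)$ is the Grassmannian of $k$-dimensional complex linear subspaces of $\mathbb{C}^n$, and for a nonzero complex linear subspace $L\subset\mathbb{C}^n$, $\mathbb{P}(L)=\{\ell\in\mathbb{P}^{n-1}(\mathbb{C}):\ell\subset L\}$. *)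

theory Defs
  imports "HOL-Analysis.Analysis" "HOL-Library.Poly_Mapping"
begin

definition holomorphic_fun_on :: "(complex^'n \<Rightarrow> complex) \<Rightarrow> (complex^'n) set \<Rightarrow> bool" where
  "holomorphic_fun_on f U \<longleftrightarrow> open U \<and>
     (\<forall>z\<in>U. \<exists>D. (f has_derivative D) (at z) \<and> (\<forall>c v. D (c *s v) = c * D v))"

definition holomorphic_map_on :: "(complex^'n \<Rightarrow> complex^'m) \<Rightarrow> (complex^'n) set \<Rightarrow> bool" where
  "holomorphic_map_on \<phi> U \<longleftrightarrow> (\<forall>i. holomorphic_fun_on (\<lambda>z. \<phi> z $ i) U)"

definition biholomorphic_between ::
  "(complex^'n \<Rightarrow> complex^'n) \<Rightarrow> (complex^'n) set \<Rightarrow> (complex^'n) set \<Rightarrow> bool" where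
  "biholomorphic_between \<phi> U V \<longleftrightarrow> holomorphic_map_on \<phi> U \<and> \<phi> ` U = V \<and>
     (\<exists>\<psi>. holomorphic_map_on \<psi> V \<and> (\<forall>z\<in>U. \<psi> (\<phi> z) = z))"

definition complex_analytic_set :: "(complex^'n) set \<Rightarrow> bool" where
  "complex_analytic_set X \<longleftrightarrow>
     (\<forall>a. \<exists>U F. open U \<and> a \<in> U \<and> finite F \<and> (\<forall>f\<in>F. holomorphic_fun_on f U) \<and>
        X \<inter> U = {z\<in>U. \<forall>f\<in>F. f z = 0})"

text \<open>\<open>Gr\<^sub>\<complex>(k, n)\<close> with \<open>n = CARD('n)\<close>; the locale \<open>vec\<close> provides the linear algebra over the
  complex scalars, as opposed to the real structure of the type.\<close>

definition complex_Grassmannian :: "nat \<Rightarrow> (complex^'n) set set" where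
  "complex_Grassmannian k = {L. vec.subspace L \<and> vec.dim L = k}"

text \<open>The points near which \<open>X\<close> is a \<open>k\<close>-dimensional complex submanifold.\<close>

definition regular_points :: "nat \<Rightarrow> (complex^'n) set \<Rightarrow> (complex^'n) set" where
  "regular_points k X = {z\<in>X. \<exists>U V \<phi>. \<exists>L\<in>complex_Grassmannian k.
     z \<in> U \<and> biholomorphic_between \<phi> U V \<and> \<phi> ` (X \<inter> U) = L \<inter> V}"

text \<open>The dimension of an analytic set at \<open>a\<close> is the upper limit, as \<open>z \<rightarrow> a\<close>, of the dimensions at
  its regular points \<open>z\<close>, i.e. the greatest \<open>k\<close> such that every neighbourhood of \<open>a\<close> contains a
  \<open>k\<close>-dimensional regular point.\<close>

definition has_dimension_at :: "(complex^'n) set \<Rightarrow> complex^'n \<Rightarrow> nat \<Rightarrow> bool" where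
  "has_dimension_at X a d \<longleftrightarrow> a \<in> closure (regular_points d X) \<and>
     (\<forall>k. a \<in> closure (regular_points k X) \<longrightarrow> k \<le> d)"

definition closed_pure_analytic_set :: "nat \<Rightarrow> (complex^'n) set \<Rightarrow> bool" where
  "closed_pure_analytic_set d X \<longleftrightarrow> X \<noteq> {} \<and> closed X \<and> complex_analytic_set X \<and>
     (\<forall>a\<in>X. has_dimension_at X a d)"

text \<open>An element of \<open>('n \<Rightarrow>\<^sub>0 nat) \<Rightarrow>\<^sub>0 complex\<close> is a polynomial in the variables \<open>z\<^sub>i\<close>, \<open>i :: 'n\<close>: it
  maps each exponent vector to its coefficient.\<close>

definition eval_poly :: "(('n::finite \<Rightarrow>\<^sub>0 nat) \<Rightarrow>\<^sub>0 complex) \<Rightarrow> complex^'n \<Rightarrow> complex" where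
  "eval_poly p z = (\<Sum>m\<in>Poly_Mapping.keys p.
     Poly_Mapping.lookup p m * (\<Prod>i\<in>UNIV. (z $ i) ^ Poly_Mapping.lookup m i))"

definition algebraic_set :: "(complex^'n) set \<Rightarrow> bool" where
  "algebraic_set X \<longleftrightarrow>
     (\<exists>P :: (('n \<Rightarrow>\<^sub>0 nat) \<Rightarrow>\<^sub>0 complex) set. X = {z. \<forall>p\<in>P. eval_poly p z = 0})"

definition tangent_cone_at_infinity :: "(complex^'n) set \<Rightarrow> (complex^'n) set" where
  "tangent_cone_at_infinity A = {v. \<exists>(x :: nat \<Rightarrow> complex^'n) (t :: nat \<Rightarrow> real).
     (\<forall>j. x j \<in> A \<and> t j > 0) \<and>
     filterlim (\<lambda>j. norm (x j)) at_top sequentially \<and>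
     filterlim t at_top sequentially \<and>
     (\<lambda>j. x j /\<^sub>R t j) \<longlonglongrightarrow> v}"

definition complex_line :: "complex^'n \<Rightarrow> (complex^'n) set" where
  "complex_line v = {c *s v | c. True}"

definition asymptotic_directions :: "(complex^'n) set \<Rightarrow> (complex^'n) set set" where
  "asymptotic_directions A = complex_line ` (tangent_cone_at_infinity A - {0})"

definition projectivization :: "(complex^'n) set \<Rightarrow> (complex^'n) set set" where
  "projectivization L = {l \<in> complex_Grassmannian 1. l \<subseteq> L}"

end

theory Submission
  imports Defs "HOL-Complex_Analysis.Complex_Analysis"
begin

text \<open>Suppose that \<open>L\<close> contains no asymptotic direction of \<open>X\<close>. Choose linear coordinates in which
  \<open>L\<close> is given by \<open>x\<^sub>i = 0\<close> for \<open>i \<in> I\<close>, where \<open>I\<close> has \<open>d\<close> elements. Then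
  \<open>\<bar>x\<bar> \<le> C (1 + \<bar>x\<^sub>I\<bar>)\<close> on \<open>X\<close>, so the projection \<open>x \<mapsto> x\<^sub>I\<close> is proper on \<open>X\<close>. Eliminating the
  other coordinates one at a time with resultants shows that its fibres are finite and that, off the
  zero set of a discriminant, \<open>X\<close> is contained in finitely many disjoint holomorphic graphs. Since
  \<open>X\<close> has pure dimension \<open>d\<close>, it contains each of these graphs that it meets, so it is a branched
  cover of \<open>\<complex>\<^sup>d\<close> with a constant generic number of sheets. For a linear form \<open>l\<close>, the function
  \<open>\<Prod> (l y - l x)\<close>, with \<open>x\<close> ranging over the points of \<open>X\<close> over \<open>y\<^sub>I\<close>, extends across the
  branch locus to an entire function of polynomial growth in \<open>y\<close>, i.e. to a polynomial, and the common
  zeros of these polynomials are exactly \<open>X\<close>.\<close>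

section \<open>Functions holomorphic along complex lines\<close>

text \<open>The dimension of the base drops with every eliminated coordinate, while the type
  \<open>complex^'n\<close> is fixed. So nothing is moved to a smaller space: a projection is
  replaced by the cylinder \<open>sat S X\<close> over it, and a point of the base is a point of the
  whole space with dummy coordinates. The zeros of a holomorphic function cannot be numbered
  holomorphically, so only symmetric expressions in them are formed. The argument principle writes
  their power sums as circle integrals with a parameter, Newton's identities turn power sums into
  products, hence resultants, and the discriminant is arranged to be a polynomial in power sums too.
  Sheets become single functions only where the number of distinct zeros is maximal. Constancy of
  the number of sheets comes from extending that number itself, as a bounded holomorphic function,
  across the branch locus. Pure dimension enters through ranks: over a regular piece of
  \<open>X\<close> the projection has finite fibres, which forces an image with interior, and this
  rules out that \<open>X\<close> occupies only a thin part of a graph.\<close>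

lemma continuous_on_vector_scalar_mult [continuous_intros]:
  fixes f :: "'a::topological_space \<Rightarrow> complex" and g :: "'a \<Rightarrow> complex^'n"
  assumes "continuous_on S f" "continuous_on S g"
  shows "continuous_on S (\<lambda>x. f x *s g x)"
  unfolding vector_scalar_mult_def using assms by (intro continuous_intros)

lemma open_line_preimage:
  fixes U :: "(complex^'n) set"
  assumes "open U" shows "open {t. z + t *s v \<in> U}"
proof -
  have "continuous_on UNIV (\<lambda>t. z + t *s v)" by (intro continuous_intros)
  from open_vimage[OF assms this] show ?thesis by (simp add: vimage_def)
qed

text \<open>By Osgood's lemma this is ordinary holomorphy, but it is visibly stable under integration over a
  parameter.\<close>

definition line_holo_on :: "(complex^'n \<Rightarrow> complex) \<Rightarrow> (complex^'n) set \<Rightarrow> bool" where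
  "line_holo_on f U \<longleftrightarrow> open U \<and> continuous_on U f \<and>
     (\<forall>z v. (\<lambda>t. f (z + t *s v)) holomorphic_on {t. z + t *s v \<in> U})"

lemma line_holo_on_open: "line_holo_on f U \<Longrightarrow> open U"
  by (simp add: line_holo_on_def)

lemma line_holo_on_continuous: "line_holo_on f U \<Longrightarrow> continuous_on U f"
  by (simp add: line_holo_on_def)

lemma line_holo_on_line:
  "line_holo_on f U \<Longrightarrow> (\<lambda>t. f (z + t *s v)) holomorphic_on {t. z + t *s v \<in> U}"
  by (simp add: line_holo_on_def)

lemma line_holo_on_subset:
  assumes "line_holo_on f U" "open V" "V \<subseteq> U" shows "line_holo_on f V"
  using assms unfolding line_holo_on_def
  by (meson Collect_mono continuous_on_subset holomorphic_on_subset subsetD)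

lemma line_holo_on_cong:
  assumes "line_holo_on f U" "\<And>z. z \<in> U \<Longrightarrow> f z = g z" shows "line_holo_on g U"
proof -
  have "continuous_on U g"
    using assms continuous_on_eq line_holo_on_continuous by blast
  moreover have "(\<lambda>t. g (z + t *s v)) holomorphic_on {t. z + t *s v \<in> U}" for z v
    by (rule holomorphic_transform[OF line_holo_on_line[OF assms(1)]]) (use assms(2) in auto)
  ultimately show ?thesis
    using line_holo_on_open[OF assms(1)] by (simp add: line_holo_on_def)
qed

lemma line_holo_on_local:
  assumes "\<And>z. z \<in> U \<Longrightarrow> \<exists>r>0. line_holo_on f (ball z r)" "open U"
  shows "line_holo_on f U"
proof -
  have "continuous_on U f"
    by (metis assms(1) centre_in_ball continuous_at_imp_continuous_on
        continuous_on_eq_continuous_at line_holo_on_continuous open_ball)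
  moreover have "(\<lambda>t. f (z + t *s v)) holomorphic_on {t. z + t *s v \<in> U}" for z v
    unfolding holomorphic_on_def
  proof
    fix t assume t: "t \<in> {t. z + t *s v \<in> U}"
    then obtain r where r: "r > 0" "line_holo_on f (ball (z + t *s v) r)"
      using assms by auto
    have "(\<lambda>t. f (z + t *s v)) field_differentiable (at t)"
      using r(1) holomorphic_on_imp_differentiable_at[OF line_holo_on_line[OF r(2)]
          open_line_preimage[OF open_ball]] by simp
    then show "(\<lambda>t. f (z + t *s v)) field_differentiable at t within {t. z + t *s v \<in> U}"
      by (rule field_differentiable_at_within)
  qed
  ultimately show ?thesis
    using assms(2) by (simp add: line_holo_on_def)
qed

lemma line_holo_on_const: "open U \<Longrightarrow> line_holo_on (\<lambda>z. c) U"
  by (simp add: line_holo_on_def)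

lemma line_holo_on_nth: "open U \<Longrightarrow> line_holo_on (\<lambda>z. z $ i) U"
  by (auto simp: line_holo_on_def intro!: continuous_intros holomorphic_intros)

lemma line_holo_on_add:
  "line_holo_on f U \<Longrightarrow> line_holo_on g U \<Longrightarrow> line_holo_on (\<lambda>z. f z + g z) U"
  by (auto simp: line_holo_on_def intro!: continuous_intros holomorphic_intros)

lemma line_holo_on_diff:
  "line_holo_on f U \<Longrightarrow> line_holo_on g U \<Longrightarrow> line_holo_on (\<lambda>z. f z - g z) U"
  by (auto simp: line_holo_on_def intro!: continuous_intros holomorphic_intros)

lemma line_holo_on_mult:
  "line_holo_on f U \<Longrightarrow> line_holo_on g U \<Longrightarrow> line_holo_on (\<lambda>z. f z * g z) U"
  by (auto simp: line_holo_on_def intro!: continuous_intros holomorphic_intros)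

lemma line_holo_on_power: "line_holo_on f U \<Longrightarrow> line_holo_on (\<lambda>z. f z ^ k) U"
  by (auto simp: line_holo_on_def intro!: continuous_intros holomorphic_intros)

lemma line_holo_on_divide:
  assumes "line_holo_on f U" "line_holo_on g U" "\<And>z. z \<in> U \<Longrightarrow> g z \<noteq> 0"
  shows "line_holo_on (\<lambda>z. f z / g z) U"
  using assms by (auto simp: line_holo_on_def intro!: continuous_intros holomorphic_intros)

lemma line_holo_on_sum:
  assumes "open U" "\<And>i. i \<in> S \<Longrightarrow> line_holo_on (f i) U"
  shows "line_holo_on (\<lambda>z. \<Sum>i\<in>S. f i z) U"
  using assms by (auto simp: line_holo_on_def intro!: continuous_intros holomorphic_intros)

lemma line_holo_on_prod:
  assumes "open U" "\<And>i. i \<in> S \<Longrightarrow> line_holo_on (f i) U"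
  shows "line_holo_on (\<lambda>z. \<Prod>i\<in>S. f i z) U"
  using assms by (auto simp: line_holo_on_def intro!: continuous_intros holomorphic_intros)

text \<open>Affine maps send complex lines to complex lines; \<open>B\<close> is the linear part of
  \<open>A\<close>.\<close>

lemma line_holo_on_affine:
  assumes f: "line_holo_on f U" and "open G" and AU: "\<And>z. z \<in> G \<Longrightarrow> A z \<in> U"
    and "continuous_on G A" and A: "\<And>z t v. A (z + t *s v) = A z + t *s B v"
  shows "line_holo_on (\<lambda>z. f (A z)) G"
  unfolding line_holo_on_def
proof (intro conjI allI)
  show "continuous_on G (\<lambda>z. f (A z))"
    using continuous_on_compose2[OF line_holo_on_continuous[OF f] assms(4)] AU by blast
  show "(\<lambda>t. f (A (z + t *s v))) holomorphic_on {t. z + t *s v \<in> G}" for z v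
    unfolding A
    by (rule holomorphic_on_subset[OF line_holo_on_line[OF f]]) (use AU A in force)
qed fact

text \<open>Complex linearity of \<open>D\<close> is what turns the real derivative into a complex
  one. The curve is arbitrary, so that the rule serves both straight lines and, later, sections
  restricted to lines.\<close>

lemma has_field_derivative_along_curve:
  fixes f :: "complex^'n \<Rightarrow> complex" and \<gamma> :: "complex \<Rightarrow> complex^'n"
  assumes D: "(f has_derivative D) (at (\<gamma> t))" "\<And>c v. D (c *s v) = c * D v"
    and \<gamma>: "\<And>k. ((\<lambda>s. \<gamma> s $ k) has_field_derivative \<gamma>' $ k) (at t)"
  shows "((\<lambda>s. f (\<gamma> s)) has_field_derivative D \<gamma>') (at t)"
proof -
  have "(\<gamma> has_derivative (\<lambda>h. h *s \<gamma>')) (at t)"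
  proof (subst has_derivative_componentwise_within, intro ballI)
    fix b :: "complex^'n" assume "b \<in> Basis"
    then obtain k u where b: "b = axis k u" "u \<in> Basis" by (auto simp: Basis_vec_def)
    have "((\<lambda>s. \<gamma> s $ k) has_derivative (\<lambda>h. \<gamma>' $ k * h)) (at t)"
      using \<gamma>[of k] by (simp add: has_field_derivative_def)
    from has_derivative_inner_left[OF this, of u]
    show "((\<lambda>x. \<gamma> x \<bullet> b) has_derivative (\<lambda>x. (x *s \<gamma>') \<bullet> b)) (at t)"
      by (simp add: b inner_axis mult.commute)
  qed
  from has_derivative_compose[OF this D(1)]
  have "((\<lambda>s. f (\<gamma> s)) has_derivative (\<lambda>h. h * D \<gamma>')) (at t)"
    by (simp add: D(2))
  moreover have "(\<lambda>h. h * D \<gamma>') = (*) (D \<gamma>')"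
    by (simp add: fun_eq_iff mult.commute)
  ultimately show ?thesis
    by (simp add: has_field_derivative_def)
qed

lemma holomorphic_fun_on_derivative_along_line:
  fixes f :: "complex^'n \<Rightarrow> complex"
  assumes "(f has_derivative D) (at z)" "\<And>c v. D (c *s v) = c * D v"
  shows "((\<lambda>s. f (z + s *s v)) has_field_derivative D v) (at 0)"
  by (rule has_field_derivative_along_curve[where \<gamma>="\<lambda>s. z + s *s v"])
    (use assms in \<open>auto intro!: derivative_eq_intros\<close>)

lemma holomorphic_fun_on_imp_line_holo_on:
  assumes "holomorphic_fun_on f U" shows "line_holo_on f U"
  unfolding line_holo_on_def
proof (intro conjI allI)
  show "open U" using assms by (simp add: holomorphic_fun_on_def)
  show "continuous_on U f"
    using assms unfolding holomorphic_fun_on_def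
    by (meson continuous_at_imp_continuous_on has_derivative_continuous)
  show "(\<lambda>t. f (z + t *s v)) holomorphic_on {t. z + t *s v \<in> U}" for z v
    unfolding holomorphic_on_def
  proof
    fix t assume "t \<in> {t. z + t *s v \<in> U}"
    then obtain D where D: "(f has_derivative D) (at (z + t *s v))" "\<And>c v. D (c *s v) = c * D v"
      using assms unfolding holomorphic_fun_on_def by auto
    have "((\<lambda>s. f (z + s *s v)) has_field_derivative D v) (at t)"
      by (rule has_field_derivative_along_curve[where \<gamma>="\<lambda>s. z + s *s v", OF D])
        (auto intro!: derivative_eq_intros)
    then show "(\<lambda>t. f (z + t *s v)) field_differentiable at t within {t. z + t *s v \<in> U}"
      unfolding field_differentiable_def by (blast intro: has_field_derivative_at_within)
  qed
qed

text \<open>Holomorphy in the parameter is Morera's theorem after exchanging the two integrals.\<close>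

lemma line_holo_on_circle_integral:
  fixes g :: "complex^'n \<Rightarrow> complex \<Rightarrow> complex"
  assumes G: "open G" and \<rho>: "\<rho> > 0"
    and cont: "continuous_on (G \<times> sphere c \<rho>) (\<lambda>(z, t). g z t)"
    and holo: "\<And>t. t \<in> sphere c \<rho> \<Longrightarrow> line_holo_on (\<lambda>z. g z t) G"
  shows "line_holo_on (\<lambda>z. contour_integral (circlepath c \<rho>) (g z)) G"
  unfolding line_holo_on_def
proof (intro conjI allI G)
  let ?p = "circlepath c \<rho>"
  have vd: "vector_derivative ?p (at x) =
      2 * of_real pi * \<i> * of_real \<rho> * exp (2 * of_real pi * \<i> * of_real x)" for x :: real
    by (simp add: vector_derivative_circlepath)
  have pS: "?p x \<in> sphere c \<rho>" if "x \<in> {0..1}" for x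
    using that \<rho> path_image_circlepath[of c \<rho>] unfolding path_image_def by auto
  have pc: "continuous_on S ?p" for S
    unfolding circlepath_def part_circlepath_def
    by (intro continuous_intros)
  have "continuous_on (G \<times> cbox 0 1) (\<lambda>(z, x). g z (?p x) * vector_derivative ?p (at x))"
  proof -
    have "continuous_on (G \<times> cbox 0 1) (\<lambda>y. (fst y, ?p (snd y)))"
      by (intro continuous_intros continuous_on_compose2[OF pc[of UNIV]]) auto
    then have "continuous_on (G \<times> cbox 0 1) (\<lambda>y. (\<lambda>(z, t). g z t) (fst y, ?p (snd y)))"
      by (rule continuous_on_compose2[OF cont]) (use pS in auto)
    then show ?thesis
      unfolding vd case_prod_beta by (auto intro!: continuous_intros)
  qed
  from integral_continuous_on_param[OF this]
  show C: "continuous_on G (\<lambda>z. contour_integral ?p (g z))"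
    by (simp add: contour_integral_integral)
  fix z v
  define S where "S = {t. z + t *s v \<in> G}"
  have "(\<lambda>s. contour_integral ?p (g (z + s *s v))) analytic_on S"
  proof (rule Morera_triangle)
    show "continuous_on S (\<lambda>s. contour_integral ?p (g (z + s *s v)))"
      by (rule continuous_on_compose2[OF C]) (auto simp: S_def intro!: continuous_intros)
    show "open S" unfolding S_def by (rule open_line_preimage[OF G])
    show "convex hull {a, b, d} \<subseteq> S \<longrightarrow>
       contour_integral (linepath a b) (\<lambda>s. contour_integral ?p (g (z + s *s v))) +
       contour_integral (linepath b d) (\<lambda>s. contour_integral ?p (g (z + s *s v))) +
       contour_integral (linepath d a) (\<lambda>s. contour_integral ?p (g (z + s *s v))) = 0" for a b d
    proof
      assume hull: "convex hull {a, b, d} \<subseteq> S"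
      have sub: "closed_segment x y \<subseteq> S" if "x \<in> {a,b,d}" "y \<in> {a,b,d}" for x y
        using that hull
        by (meson closed_segment_subset convex_convex_hull hull_inc order_trans)
      define h where "h x y t = contour_integral (linepath x y) (\<lambda>s. g (z + s *s v) t)" for x y t
      have cont2: "continuous_on (S \<times> sphere c \<rho>) (\<lambda>(s, t). g (z + s *s v) t)"
      proof -
        have "continuous_on (S \<times> sphere c \<rho>) (\<lambda>y. (\<lambda>(z, t). g z t) (z + fst y *s v, snd y))"
          by (rule continuous_on_compose2[OF cont])
            (auto simp: S_def intro!: continuous_intros)
        then show ?thesis by (simp add: case_prod_beta)
      qed
      have swap: "contour_integral (linepath x y) (\<lambda>s. contour_integral ?p (g (z + s *s v)))
          = contour_integral ?p (h x y)" if "x \<in> {a,b,d}" "y \<in> {a,b,d}" for x y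
        unfolding h_def
      proof (rule contour_integral_swap)
        show "continuous_on (path_image (linepath x y) \<times> path_image ?p) (\<lambda>(s, t). g (z + s *s v) t)"
          by (rule continuous_on_subset[OF cont2]) (use sub[OF that] \<rho> in auto)
        show "continuous_on {0..1} (\<lambda>t. vector_derivative ?p (at t))"
          unfolding vd by (intro continuous_intros)
      qed auto
      have hcont: "continuous_on (sphere c \<rho>) (h x y)" if "x \<in> {a,b,d}" "y \<in> {a,b,d}" for x y
      proof -
        have "continuous_on (sphere c \<rho> \<times> cbox 0 1) (\<lambda>(t, x'). g (z + linepath x y x' *s v) t * (y - x))"
        proof -
          have lc: "continuous_on T (\<lambda>u. linepath x y (snd u))" for T :: "(complex \<times> real) set"
            unfolding linepath_def by (intro continuous_intros)
          have "continuous_on (sphere c \<rho> \<times> cbox 0 1) (\<lambda>u. (\<lambda>(s, t). g (z + s *s v) t) (linepath x y (snd u), fst u))"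
            by (rule continuous_on_compose2[OF cont2])
              (use sub[OF that] lc in \<open>auto intro!: continuous_intros simp: image_subset_iff path_image_linepath[symmetric] path_image_def\<close>)
          then show ?thesis
            unfolding case_prod_beta by (auto intro!: continuous_intros)
        qed
        from integral_continuous_on_param[OF this] show ?thesis
          unfolding h_def by (simp add: contour_integral_integral)
      qed
      have int: "h x y contour_integrable_on ?p" if "x \<in> {a,b,d}" "y \<in> {a,b,d}" for x y
        by (rule contour_integrable_continuous_circlepath) (use hcont[OF that] \<rho> in simp)
      have "contour_integral ?p (h a b) + contour_integral ?p (h b d) + contour_integral ?p (h d a)
          = contour_integral ?p (\<lambda>t. h a b t + h b d t + h d a t)"
        by (simp add: int contour_integral_add contour_integrable_add)
      also have "\<dots> = contour_integral ?p (\<lambda>t. 0)"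
      proof (rule contour_integral_eq)
        fix t assume "t \<in> path_image ?p"
        then have t: "t \<in> sphere c \<rho>" using \<rho> by simp
        have H: "(\<lambda>s. g (z + s *s v) t) holomorphic_on S"
          unfolding S_def by (rule line_holo_on_line[OF holo[OF t]])
        have "((\<lambda>s. g (z + s *s v) t) has_contour_integral 0)
            (linepath a b +++ linepath b d +++ linepath d a)"
          by (rule Cauchy_theorem_triangle) (use H hull holomorphic_on_subset in blast)
        then show "h a b t + h b d t + h d a t = 0"
          unfolding h_def
          using has_chain_integral_chain_integral3 by force
      qed
      finally show "contour_integral (linepath a b) (\<lambda>s. contour_integral ?p (g (z + s *s v))) +
       contour_integral (linepath b d) (\<lambda>s. contour_integral ?p (g (z + s *s v))) +
       contour_integral (linepath d a) (\<lambda>s. contour_integral ?p (g (z + s *s v))) = 0"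
        by (simp add: swap)
    qed
  qed
  then show "(\<lambda>s. contour_integral ?p (g (z + s *s v))) holomorphic_on {s. z + s *s v \<in> G}"
    unfolding S_def by (rule analytic_imp_holomorphic)
qed

section \<open>Generic points and removable singularities\<close>

lemma norm_vector_scalar_mult_complex: "norm (c *s v) = norm c * norm (v :: complex^'n)"
  by (simp add: norm_vec_def L2_set_right_distrib norm_mult)

lemma convex_line_preimage:
  fixes U :: "(complex^'n) set"
  assumes "convex U" shows "convex {t. z + t *s v \<in> U}"
proof (rule convexI)
  fix a b and p q :: real
  assume ab: "a \<in> {t. z + t *s v \<in> U}" "b \<in> {t. z + t *s v \<in> U}" "0 \<le> p" "0 \<le> q" "p + q = 1"
  have "p *\<^sub>R (z $ k + a * v $ k) + q *\<^sub>R (z $ k + b * v $ k) =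
      (p + q) *\<^sub>R z $ k + (p *\<^sub>R a + q *\<^sub>R b) * v $ k" for k
    by (simp add: algebra_simps)
  then have "z + (p *\<^sub>R a + q *\<^sub>R b) *s v = p *\<^sub>R (z + a *s v) + q *\<^sub>R (z + b *s v)"
    by (simp only: vec_eq_iff vector_add_component vector_smult_component
        vector_scaleR_component ab(5) scaleR_one simp_thms)
  then show "p *\<^sub>R a + q *\<^sub>R b \<in> {t. z + t *s v \<in> U}"
    using ab convexD[OF assms] by auto
qed

text \<open>Zeros of a holomorphic function on a connected set are isolated; \<open>\<beta>\<close>
  certifies that \<open>f\<close> is not identically zero. The centre itself may or may not be a
  zero.\<close>

lemma nonzero_punctured_disc:
  fixes f :: "complex \<Rightarrow> complex"
  assumes "f holomorphic_on S" "open S" "connected S" "\<xi> \<in> S" "\<beta> \<in> S" "f \<beta> \<noteq> 0" "\<epsilon> > 0"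
  shows "\<exists>\<rho>. 0 < \<rho> \<and> \<rho> < \<epsilon> \<and> cball \<xi> \<rho> \<subseteq> S \<and> (\<forall>t\<in>cball \<xi> \<rho> - {\<xi>}. f t \<noteq> 0)"
proof -
  obtain r where r: "0 < r" "ball \<xi> r \<subseteq> S" "\<And>t. t \<in> ball \<xi> r - {\<xi>} \<Longrightarrow> f t \<noteq> 0"
  proof (cases "f \<xi> = 0")
    case True
    then show ?thesis
      using isolated_zeros[OF assms(1-4) True assms(5,6)] that by metis
  next
    case False
    have "open (S \<inter> f -` (-{0}))"
      by (rule continuous_open_preimage) (use assms in \<open>auto intro: holomorphic_on_imp_continuous_on\<close>)
    then obtain r where "r > 0" "ball \<xi> r \<subseteq> S \<inter> f -` (-{0})"
      using False assms(4) by (metis ComplI IntI open_contains_ball singletonD vimageI)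
    then show ?thesis by (intro that[of r]) auto
  qed
  \<comment> \<open>Halving makes the closed disc fit into the open one and the radius strictly
    smaller than \<open>\<epsilon>\<close>.\<close>
  show ?thesis
    by (rule exI[of _ "min r \<epsilon> / 2"]) (use r assms(7) in \<open>force simp: subset_iff\<close>)
qed

text \<open>Compactness gives the room. The residue calculus below needs an open neighbourhood of
  the closed disc on which the function is still defined.\<close>

lemma cball_enlarge:
  fixes c :: complex
  assumes "open S" "cball c \<rho> \<subseteq> S" "\<rho> > 0"
  shows "\<exists>\<rho>'>\<rho>. cball c \<rho>' \<subseteq> S"
proof -
  obtain \<epsilon> where \<epsilon>: "\<epsilon> > 0" "(\<Union>x\<in>cball c \<rho>. ball x \<epsilon>) \<subseteq> S"
    using compact_subset_open_imp_ball_epsilon_subset[OF compact_cball assms(1,2)] by metis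
  have "cball c (\<rho> + \<epsilon> / 2) \<subseteq> S"
  proof
    fix t assume t: "t \<in> cball c (\<rho> + \<epsilon> / 2)"
    define n where "n = norm (t - c)"
    \<comment> \<open>The point of the smaller disc nearest to \<open>t\<close>, found by radial
      projection.\<close>
    define t' where "t' = (if n \<le> \<rho> then t else c + (\<rho> / n) *\<^sub>R (t - c))"
    have "t' \<in> cball c \<rho> \<and> dist t' t < \<epsilon>"
    proof (cases "n \<le> \<rho>")
      case False
      have "t' - t = (\<rho> / n - 1) *\<^sub>R (t - c)"
        using False by (simp add: t'_def algebra_simps)
      then have "dist t' t = \<bar>\<rho> / n - 1\<bar> * n"
        by (simp add: dist_norm n_def)
      also have "\<dots> = n - \<rho>"
        using False assms(3) by (simp add: abs_if field_simps)
      finally show ?thesis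
        using t False \<epsilon>(1) assms(3) by (simp add: t'_def dist_norm norm_minus_commute n_def)
    qed (use \<epsilon> in \<open>simp add: t'_def n_def dist_norm norm_minus_commute\<close>)
    then show "t \<in> S" using \<epsilon>(2) mem_ball by blast
  qed
  then show ?thesis using \<epsilon>(1) by (intro exI[of _ "\<rho> + \<epsilon> / 2"]) auto
qed

text \<open>The piece of the line over \<open>K\<close> is compact, hence has a uniform
  neighbourhood inside \<open>U\<close>; moving the base point by less than its width keeps the
  whole piece in \<open>U\<close>.\<close>

lemma line_tube:
  fixes a v :: "complex^'n"
  assumes "open U" "compact K" "\<And>t. t \<in> K \<Longrightarrow> a + t *s v \<in> U"
  shows "\<exists>\<delta>>0. \<forall>z\<in>ball a \<delta>. \<forall>t\<in>K. z + t *s v \<in> U"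
proof -
  have "compact ((\<lambda>t. a + t *s v) ` K)"
    by (rule compact_continuous_image) (use assms in \<open>auto intro!: continuous_intros\<close>)
  then obtain \<delta> where "\<delta> > 0" "(\<Union>x\<in>(\<lambda>t. a + t *s v) ` K. ball x \<delta>) \<subseteq> U"
    using compact_subset_open_imp_ball_epsilon_subset assms by (metis image_subsetI)
  then show ?thesis
    by (intro exI[of _ \<delta>]) (force simp: dist_norm subset_iff)
qed

text \<open>Cauchy's formula turns the derivative in a fixed direction \<open>v\<close> into a
  circle integral with parameter \<open>z\<close>, and such integrals preserve holomorphy along
  lines.\<close>

lemma line_holo_on_deriv:
  assumes f: "line_holo_on f U"
  shows "line_holo_on (\<lambda>z. deriv (\<lambda>s. f (z + s *s v)) 0) U"
proof (rule line_holo_on_local)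
  show "open U" using f by (rule line_holo_on_open)
  fix a assume a: "a \<in> U"
  have "open {t. a + t *s v \<in> U}" by (rule open_line_preimage) fact
  then obtain \<rho> where \<rho>: "\<rho> > 0" "cball 0 \<rho> \<subseteq> {t. a + t *s v \<in> U}"
    using a by (metis (mono_tags, lifting) add_0_right mem_Collect_eq open_contains_cball vector_smult_lzero)
  then obtain \<delta> where \<delta>: "\<delta> > 0" "\<And>z t. z \<in> ball a \<delta> \<Longrightarrow> t \<in> cball 0 \<rho> \<Longrightarrow> z + t *s v \<in> U"
    using line_tube[OF \<open>open U\<close>, of "cball 0 \<rho>" a v] by (metis (no_types, lifting) compact_cball mem_Collect_eq subsetD)
  have "line_holo_on (\<lambda>z. 1 / (2 * of_real pi * \<i>) * contour_integral (circlepath 0 \<rho>) (\<lambda>t. f (z + t *s v) / t^2)) (ball a \<delta>)"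
  proof (intro line_holo_on_mult line_holo_on_const line_holo_on_circle_integral)
    have "continuous_on (ball a \<delta> \<times> sphere 0 \<rho>) (\<lambda>y. f (fst y + snd y *s v))"
      by (rule continuous_on_compose2[OF line_holo_on_continuous[OF f]])
        (use \<delta> in \<open>auto intro!: continuous_intros\<close>)
    then show "continuous_on (ball a \<delta> \<times> sphere 0 \<rho>) (\<lambda>(z, t). f (z + t *s v) / t^2)"
      unfolding case_prod_beta using \<rho> by (auto intro!: continuous_intros)
    fix t :: complex assume t: "t \<in> sphere 0 \<rho>"
    have "line_holo_on (\<lambda>z. f (z + t *s v)) (ball a \<delta>)"
      by (rule line_holo_on_affine[OF f, where B="\<lambda>v. v"])
        (use \<delta> t in \<open>auto intro!: continuous_intros\<close>)
    then show "line_holo_on (\<lambda>z. f (z + t *s v) / t^2) (ball a \<delta>)"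
      using t \<rho> by (intro line_holo_on_divide line_holo_on_const) auto
  qed (use \<rho> in auto)
  then have "line_holo_on (\<lambda>z. deriv (\<lambda>s. f (z + s *s v)) 0) (ball a \<delta>)"
  proof (rule line_holo_on_cong)
    fix z assume z: "z \<in> ball a \<delta>"
    have H: "(\<lambda>s. f (z + s *s v)) holomorphic_on cball 0 \<rho>"
      by (rule holomorphic_on_subset[OF line_holo_on_line[OF f]]) (use \<delta> z in auto)
    have "((\<lambda>s. f (z + s *s v)) has_field_derivative
        1 / (2 * of_real pi * \<i>) * contour_integral (circlepath 0 \<rho>) (\<lambda>t. f (z + t *s v) / (t - 0)^2)) (at 0)"
      by (rule Cauchy_derivative_integral_circlepath)
        (use H \<rho> holomorphic_on_subset[OF H ball_subset_cball] in \<open>auto intro: holomorphic_on_imp_continuous_on\<close>)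
    then show "1 / (2 * of_real pi * \<i>) * contour_integral (circlepath 0 \<rho>) (\<lambda>t. f (z + t *s v) / t^2)
        = deriv (\<lambda>s. f (z + s *s v)) 0"
      using DERIV_imp_deriv by fastforce
  qed
  then show "\<exists>r>0. line_holo_on (\<lambda>z. deriv (\<lambda>s. f (z + s *s v)) 0) (ball a r)"
    using \<delta> by blast
qed

text \<open>Restrict to the complex line from a point of \<open>W\<close> to \<open>z\<close>: its
  trace on the convex set \<open>U\<close> is connected, and \<open>f\<close> vanishes there on a
  nonempty open set of parameters.\<close>

lemma line_holo_on_identity:
  assumes f: "line_holo_on f U" and "convex U" "open W" "W \<noteq> {}" "W \<subseteq> U"
    and "\<And>z. z \<in> W \<Longrightarrow> f z = 0" and "z \<in> U"
  shows "f z = 0"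
proof -
  obtain w where w: "w \<in> W" using assms by auto
  define v where "v = z - w"
  let ?l = "\<lambda>t. w + t *s v"
  have "f (?l 1) = 0"
  proof (rule analytic_continuation_open[where s="{t. ?l t \<in> W}" and s'="{t. ?l t \<in> U}" and f="\<lambda>t. f (?l t)"])
    show "{t. ?l t \<in> W} \<noteq> {}" using w by (auto intro!: exI[of _ 0])
    show "(\<lambda>t. f (?l t)) holomorphic_on {t. ?l t \<in> U}" by (rule line_holo_on_line[OF f])
  qed (use assms line_holo_on_open[OF f] in \<open>auto simp: v_def[symmetric] intro!: open_line_preimage convex_connected convex_line_preimage\<close>, simp add: v_def)
  then show ?thesis by (simp add: v_def)
qed

section \<open>Properties that hold off a thin set\<close>

lemma line_holo_on_open_nonzero:
  assumes "line_holo_on f U" shows "open {z \<in> U. f z \<noteq> 0}"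
proof -
  have "open (U \<inter> f -` (-{0}))"
    by (rule continuous_open_preimage[OF line_holo_on_continuous[OF assms] line_holo_on_open[OF assms]]) auto
  moreover have "U \<inter> f -` (-{0}) = {z \<in> U. f z \<noteq> 0}" by auto
  ultimately show ?thesis by simp
qed

text \<open>Encodes "off a thin analytic set near \<open>a\<close>": the bad points lie in the zero
  set of one function that is not identically zero on the ball. Only this containment is recorded,
  which makes the notion monotone in \<open>P\<close>.\<close>

definition generic_at :: "complex^'n \<Rightarrow> (complex^'n \<Rightarrow> bool) \<Rightarrow> bool" where
  "generic_at a P \<longleftrightarrow> (\<exists>r>0. \<exists>D. line_holo_on D (ball a r) \<and> (\<exists>z\<in>ball a r. D z \<noteq> 0) \<and>
     (\<forall>z\<in>ball a r. D z \<noteq> 0 \<longrightarrow> P z))"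

lemma generic_at_mono:
  assumes "generic_at a P" "\<And>z. P z \<Longrightarrow> Q z" shows "generic_at a Q"
  using assms unfolding generic_at_def by meson

lemma line_holo_on_nonzero_dense:
  assumes "line_holo_on D U" "convex U" "w \<in> U" "D w \<noteq> 0" "open W" "W \<noteq> {}" "W \<subseteq> U"
  shows "\<exists>z\<in>W. D z \<noteq> 0"
  using line_holo_on_identity[of D U W w] assms by blast

lemma generic_atE_within:
  assumes "generic_at a P" "e > 0"
  obtains r D where "0 < r" "r \<le> e" "line_holo_on D (ball a r)" "\<exists>z\<in>ball a r. D z \<noteq> 0"
    "\<And>z. z \<in> ball a r \<Longrightarrow> D z \<noteq> 0 \<Longrightarrow> P z"
proof -
  obtain r D where r: "r > 0" "line_holo_on D (ball a r)" "\<exists>z\<in>ball a r. D z \<noteq> 0"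
    "\<And>z. z \<in> ball a r \<Longrightarrow> D z \<noteq> 0 \<Longrightarrow> P z"
    using assms unfolding generic_at_def by blast
  have sub: "ball a (min r e) \<subseteq> ball a r" by auto
  show ?thesis
  proof (rule that[of "min r e" D])
    show "line_holo_on D (ball a (min r e))"
      by (rule line_holo_on_subset[OF r(2)]) auto
    have ne: "ball a (min r e) \<noteq> {}" using r assms by (simp add: ball_eq_empty)
    show "\<exists>z\<in>ball a (min r e). D z \<noteq> 0"
      using r(3) line_holo_on_nonzero_dense[OF r(2) convex_ball _ _ open_ball ne sub] by blast
  qed (use r assms in auto)
qed

lemma generic_atI_within:
  assumes "line_holo_on D U" "convex U" "a \<in> U" "\<exists>z\<in>U. D z \<noteq> 0" "\<And>z. z \<in> U \<Longrightarrow> D z \<noteq> 0 \<Longrightarrow> P z"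
  shows "generic_at a P"
proof -
  obtain r where r: "r > 0" "ball a r \<subseteq> U"
    using assms line_holo_on_open open_contains_ball by blast
  have "ball a r \<noteq> {}" using r by (simp add: ball_eq_empty)
  then have "\<exists>z\<in>ball a r. D z \<noteq> 0"
    using line_holo_on_nonzero_dense[OF assms(1,2) _ _ open_ball _ r(2)] assms(4) by blast
  then show ?thesis
    unfolding generic_at_def using assms(5) r line_holo_on_subset[OF assms(1) open_ball r(2)] by blast
qed

text \<open>The product of the two exceptional functions works: by the identity theorem the open set
  where one is nonzero contains points where the other is nonzero.\<close>

lemma generic_at_conj:
  assumes "generic_at a P" "generic_at a Q" shows "generic_at a (\<lambda>z. P z \<and> Q z)"
proof -
  obtain r D where r: "0 < r" "line_holo_on D (ball a r)" "\<exists>z\<in>ball a r. D z \<noteq> 0"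
    "\<And>z. z \<in> ball a r \<Longrightarrow> D z \<noteq> 0 \<Longrightarrow> P z"
    using generic_atE_within[OF assms(1) zero_less_one] by metis
  obtain s E where s: "0 < s" "s \<le> r" "line_holo_on E (ball a s)" "\<exists>z\<in>ball a s. E z \<noteq> 0"
    "\<And>z. z \<in> ball a s \<Longrightarrow> E z \<noteq> 0 \<Longrightarrow> Q z"
    using generic_atE_within[OF assms(2) r(1)] by metis
  have sub: "ball a s \<subseteq> ball a r" using s by auto
  have Ds: "line_holo_on D (ball a s)"
    by (rule line_holo_on_subset[OF r(2)]) (use sub in auto)
  obtain w where w: "w \<in> ball a s" "E w \<noteq> 0" using s by auto
  have "open {z \<in> ball a s. E z \<noteq> 0}"
    by (rule line_holo_on_open_nonzero[OF s(3)])
  then have "\<exists>z\<in>{z \<in> ball a s. E z \<noteq> 0}. D z \<noteq> 0"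
    using r(3) line_holo_on_nonzero_dense[OF r(2) convex_ball, of _ "{z \<in> ball a s. E z \<noteq> 0}"] w sub
    by blast
  then have "\<exists>z\<in>ball a s. D z * E z \<noteq> 0" by auto
  moreover have "line_holo_on (\<lambda>z. D z * E z) (ball a s)"
    by (rule line_holo_on_mult) fact+
  ultimately show ?thesis
    unfolding generic_at_def using s r(4) sub
    by (intro exI[of _ s] conjI exI[of _ "\<lambda>z. D z * E z"]) (auto dest: subsetD)
qed

lemma generic_at_True: "generic_at a (\<lambda>z. True)"
  unfolding generic_at_def
  by (intro exI[of _ 1] conjI exI[of _ "\<lambda>z. 1"] line_holo_on_const bexI[of _ a]) auto

lemma generic_at_finite_all:
  assumes "finite S" "\<And>s. s \<in> S \<Longrightarrow> generic_at a (P s)"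
  shows "generic_at a (\<lambda>z. \<forall>s\<in>S. P s z)"
  using assms
proof (induction S)
  case empty then show ?case by (simp add: generic_at_True)
next
  case (insert x F)
  then have "generic_at a (\<lambda>z. P x z \<and> (\<forall>s\<in>F. P s z))" by (intro generic_at_conj) auto
  then show ?case by simp
qed

lemma generic_at_dense:
  assumes "generic_at a P" "open W" "a \<in> W"
  shows "\<exists>z\<in>W. P z"
proof -
  obtain e where e: "e > 0" "ball a e \<subseteq> W" using assms open_contains_ball by blast
  then show ?thesis
    using generic_atE_within[OF assms(1) e(1)] by (metis ball_subset_cball mem_ball order_less_le_trans subsetD)
qed

text \<open>The value at \<open>z\<close> is recovered by Cauchy's formula in one fixed direction,
  along a circle that avoids the exceptional set for all \<open>z\<close> near \<open>a\<close>.
  Holomorphy in every direction is then that of a parameter integral, and the one-variable removable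
  singularity theorem identifies the value.\<close>

lemma Riemann_extension_local:
  fixes e :: "complex^'n \<Rightarrow> complex"
  assumes gen: "generic_at a (\<lambda>z. \<exists>s>0. line_holo_on e (ball z s))"
    and bdd: "q > 0" "\<And>z. z \<in> ball a q \<Longrightarrow> norm (e z) \<le> B"
  shows "\<exists>\<delta>>0. \<exists>h. line_holo_on h (ball a \<delta>) \<and>
    (\<forall>z\<in>ball a \<delta>. (\<exists>s>0. line_holo_on e (ball z s)) \<longrightarrow> h z = e z)"
proof -
  obtain r D where r: "0 < r" "r \<le> q" "line_holo_on D (ball a r)" "\<exists>z\<in>ball a r. D z \<noteq> 0"
    and good: "\<And>z. z \<in> ball a r \<Longrightarrow> D z \<noteq> 0 \<Longrightarrow> \<exists>s>0. line_holo_on e (ball z s)"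
    using generic_atE_within[OF gen bdd(1)] by metis
  define V where "V = {z \<in> ball a r. D z \<noteq> 0}"
  have oV: "open V"
    unfolding V_def by (rule line_holo_on_open_nonzero[OF r(3)])
  have eV: "line_holo_on e V"
    by (rule line_holo_on_local[OF _ oV]) (use good in \<open>auto simp: V_def\<close>)
  obtain w where w: "w \<in> ball a r" "D w \<noteq> 0" using r by auto
  \<comment> \<open>In the direction of a point where \<open>D\<close> is nonzero, \<open>D\<close>
    does not vanish identically on the line through \<open>a\<close>, so a small circle around
    \<open>a\<close> in that line avoids its zeros.\<close>
  define v where "v = w - a"
  let ?S0 = "{t. a + t *s v \<in> ball a r}"
  have "\<exists>\<rho>. 0 < \<rho> \<and> \<rho> < 1 \<and> cball 0 \<rho> \<subseteq> ?S0 \<and> (\<forall>t\<in>cball 0 \<rho> - {0}. D (a + t *s v) \<noteq> 0)"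
    by (rule nonzero_punctured_disc[where \<beta>=1, OF line_holo_on_line[OF r(3)]])
      (use w r open_line_preimage[OF open_ball, of a v a r]
          convex_connected[OF convex_line_preimage[OF convex_ball, of a v a r]] in \<open>simp_all, simp_all add: v_def\<close>)
  then obtain \<rho> where \<rho>: "0 < \<rho>" "cball 0 \<rho> \<subseteq> ?S0" "\<And>t. t \<in> sphere 0 \<rho> \<Longrightarrow> D (a + t *s v) \<noteq> 0"
    by (metis DiffI mem_sphere_0 norm_zero order_less_irrefl singletonD sphere_cball subsetD)
  obtain \<delta>1 where \<delta>1: "\<delta>1 > 0" "\<And>z t. z \<in> ball a \<delta>1 \<Longrightarrow> t \<in> cball 0 \<rho> \<Longrightarrow> z + t *s v \<in> ball a r"
    using line_tube[of "ball a r" "cball 0 \<rho>" a v] \<rho>(2) by (metis (no_types, lifting) compact_cball mem_Collect_eq open_ball subsetD)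
  have "\<And>t. t \<in> sphere 0 \<rho> \<Longrightarrow> a + t *s v \<in> V"
    using \<rho> sphere_cball unfolding V_def by blast
  then obtain \<delta>2 where \<delta>2: "\<delta>2 > 0" "\<And>z t. z \<in> ball a \<delta>2 \<Longrightarrow> t \<in> sphere 0 \<rho> \<Longrightarrow> z + t *s v \<in> V"
    using line_tube[OF oV compact_sphere, of 0 \<rho> a v] by metis
  define \<delta> where "\<delta> = min \<delta>1 \<delta>2"
  have \<delta>: "\<delta> > 0" "\<And>z t. z \<in> ball a \<delta> \<Longrightarrow> t \<in> cball 0 \<rho> \<Longrightarrow> z + t *s v \<in> ball a r"
      "\<And>z t. z \<in> ball a \<delta> \<Longrightarrow> t \<in> sphere 0 \<rho> \<Longrightarrow> z + t *s v \<in> V"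
    using \<delta>1 \<delta>2 by (auto simp: \<delta>_def)
  define h where "h z = 1 / (2 * of_real pi * \<i>) * contour_integral (circlepath 0 \<rho>) (\<lambda>t. e (z + t *s v) / t)" for z
  have hholo: "line_holo_on h (ball a \<delta>)"
    unfolding h_def
  proof (intro line_holo_on_mult line_holo_on_const line_holo_on_circle_integral)
    have "continuous_on (ball a \<delta> \<times> sphere 0 \<rho>) (\<lambda>y. e (fst y + snd y *s v))"
      by (rule continuous_on_compose2[OF line_holo_on_continuous[OF eV]])
        (use \<delta> in \<open>auto intro!: continuous_intros\<close>)
    then show "continuous_on (ball a \<delta> \<times> sphere 0 \<rho>) (\<lambda>(z, t). e (z + t *s v) / t)"
      unfolding case_prod_beta using \<rho> by (auto intro!: continuous_intros)
    fix t :: complex assume t: "t \<in> sphere 0 \<rho>"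
    have "line_holo_on (\<lambda>z. e (z + t *s v)) (ball a \<delta>)"
      by (rule line_holo_on_affine[OF eV, where B="\<lambda>v. v"])
        (use \<delta> t in \<open>auto intro!: continuous_intros\<close>)
    then show "line_holo_on (\<lambda>z. e (z + t *s v) / t) (ball a \<delta>)"
      using t \<rho> by (intro line_holo_on_divide line_holo_on_const) auto
  qed (use \<rho> in auto)
  have agree: "h z = e z" if z: "z \<in> ball a \<delta>" "D z \<noteq> 0" for z
  proof -
    let ?S1 = "{t. z + t *s v \<in> ball a r}"
    have oS: "open ?S1" and cS: "connected ?S1"
      by (rule open_line_preimage[OF open_ball], rule convex_connected[OF convex_line_preimage[OF convex_ball]])
    have "cball 0 \<rho> \<subseteq> ?S1" using \<delta> z by auto
    then obtain \<rho>' where \<rho>': "\<rho> < \<rho>'" and big: "cball 0 \<rho>' \<subseteq> ?S1"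
      using cball_enlarge[OF oS] \<rho>(1) by metis
    define Z where "Z = {t \<in> ball 0 \<rho>'. D (z + t *s v) = 0}"
    have H: "(\<lambda>t. D (z + t *s v)) holomorphic_on ?S1"
      by (rule line_holo_on_line[OF r(3)])
    have "finite {t \<in> cball 0 \<rho>'. D (z + t *s v) = 0}"
    proof (cases "(\<lambda>t. D (z + t *s v)) constant_on ?S1")
      \<comment> \<open>\<open>D\<close> is constant on the slice; the constant is nonzero because
        \<open>D z\<close> is, so there are no zeros at all.\<close>
      case True
      have "0 \<in> cball 0 \<rho>'" using \<rho>(1) \<rho>' by simp
      then have 0: "0 \<in> ?S1" using big by blast
      obtain d where d: "\<forall>t\<in>?S1. D (z + t *s v) = d"
        using True unfolding constant_on_def by blast
      have "d \<noteq> 0" using bspec[OF d 0] z(2) by simp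
      then have "D (z + t *s v) \<noteq> 0" if "t \<in> cball 0 \<rho>'" for t
        using bspec[OF d subsetD[OF big that]] by simp
      then have "{t \<in> cball 0 \<rho>'. D (z + t *s v) = 0} = {}" by blast
      then show ?thesis by (simp only: finite.emptyI)
    next
      case False
      then show ?thesis
        by (intro holomorphic_compact_finite_zeros[OF H oS cS compact_cball big])
    qed
    then have finZ: "finite Z" by (rule rev_finite_subset) (auto simp: Z_def)
    let ?k = "\<lambda>t. e (z + t *s v)"
    have "\<exists>g. g holomorphic_on ball 0 \<rho>' \<and> (\<forall>t\<in>ball 0 \<rho>' - Z. g t = ?k t)"
    proof (rule removable_singularities[OF finZ])
      show "Z \<subseteq> interior (ball 0 \<rho>')" by (auto simp: Z_def)
      show "?k holomorphic_on ball 0 \<rho>' - Z"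
        by (rule holomorphic_on_subset[OF line_holo_on_line[OF eV]])
          (use big in \<open>auto simp: Z_def V_def subset_iff\<close>)
      fix t assume "t \<in> Z"
      then have "t \<in> ?S1" using big by (auto simp: Z_def subset_iff)
      then have "\<forall>\<^sub>F s in at t. s \<in> ?S1" using oS eventually_at_topological by blast
      then have "\<forall>\<^sub>F s in at t. norm (?k s) \<le> B * norm (1::complex)"
        by eventually_elim (use bdd(2) r(2) in auto)
      then show "?k \<in> O[at t](\<lambda>_. 1)" by (rule bigoI)
    qed
    then obtain g where g: "g holomorphic_on ball 0 \<rho>'" "\<And>t. t \<in> ball 0 \<rho>' - Z \<Longrightarrow> g t = ?k t"
      by blast
    have sub: "cball 0 \<rho> \<subseteq> ball 0 \<rho>'" using \<rho>' by auto
    have gc: "g holomorphic_on cball 0 \<rho>" by (rule holomorphic_on_subset[OF g(1) sub])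
    have "((\<lambda>u. g u / (u - 0)) has_contour_integral 2 * of_real pi * \<i> * g 0) (circlepath 0 \<rho>)"
      by (rule Cauchy_integral_circlepath)
       (use gc \<rho> holomorphic_on_subset[OF gc ball_subset_cball] in \<open>auto intro: holomorphic_on_imp_continuous_on\<close>)
    then have "contour_integral (circlepath 0 \<rho>) (\<lambda>u. g u / u) = 2 * of_real pi * \<i> * g 0"
      using contour_integral_unique by fastforce
    moreover have "contour_integral (circlepath 0 \<rho>) (\<lambda>u. g u / u) = contour_integral (circlepath 0 \<rho>) (\<lambda>u. ?k u / u)"
    proof (rule contour_integral_eq)
      fix t assume "t \<in> path_image (circlepath 0 \<rho>)"
      then have t: "t \<in> sphere 0 \<rho>" using \<rho> by simp
      then have "t \<notin> Z" using \<delta>(3)[OF z(1) t] by (auto simp: Z_def V_def)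
      moreover have "t \<in> ball 0 \<rho>'" using t \<rho>' by simp
      ultimately show "g t / t = ?k t / t" using g(2) by simp
    qed
    moreover have "g 0 = e z"
      using g(2)[of 0] z(2) \<rho> \<rho>' by (simp add: Z_def)
    ultimately show ?thesis by (simp add: h_def)
  qed
  \<comment> \<open>Both sides are continuous near such a \<open>z\<close> and agree off the zeros
    of \<open>D\<close>, a dense set, so they agree at \<open>z\<close> even if
    \<open>D z = 0\<close>.\<close>
  have "h z = e z" if z: "z \<in> ball a \<delta>" and s: "s > 0" "line_holo_on e (ball z s)" for z s
  proof (rule ccontr)
    assume ne: "h z \<noteq> e z"
    let ?W = "ball a \<delta> \<inter> ball z s"
    have "continuous_on ?W (\<lambda>z. h z - e z)"
      using line_holo_on_continuous[OF hholo] line_holo_on_continuous[OF s(2)]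
      by (intro continuous_intros) (auto elim: continuous_on_subset)
    then have o: "open (?W \<inter> (\<lambda>z. h z - e z) -` (-{0}))" (is "open ?O")
      by (rule continuous_open_preimage) auto
    have "z \<in> ?O \<inter> ball a r" using ne z s(1) \<delta>(2)[OF z, of 0] \<rho>(1) by simp
    then have "\<exists>y\<in>?O \<inter> ball a r. D y \<noteq> 0"
      using line_holo_on_nonzero_dense[OF r(3) convex_ball w open_Int[OF o open_ball, of a r]] by blast
    then obtain y where "y \<in> ?O" "D y \<noteq> 0" by blast
    then show False using agree[of y] by simp
  qed
  then show ?thesis using \<delta>(1) hholo by blast
qed

text \<open>Local extensions coincide on overlaps because both are continuous and equal
  \<open>e\<close> at a dense set of points; so the diagonal \<open>h z z\<close> is locally one of
  them. At the exceptional points \<open>e\<close> has to be bounded, but may be arbitrary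
  otherwise.\<close>

theorem Riemann_extension:
  fixes e :: "complex^'n \<Rightarrow> complex"
  assumes gen: "\<And>a. generic_at a (\<lambda>z. \<exists>s>0. line_holo_on e (ball z s))"
    and bdd: "\<And>a. \<exists>q>0. \<exists>B. \<forall>z\<in>ball a q. norm (e z) \<le> B"
  shows "\<exists>h. line_holo_on h UNIV \<and> (\<forall>z. (\<exists>s>0. line_holo_on e (ball z s)) \<longrightarrow> h z = e z)"
proof -
  have "\<exists>\<delta> h. \<delta> > 0 \<and> line_holo_on h (ball a \<delta>) \<and>
    (\<forall>z\<in>ball a \<delta>. (\<exists>s>0. line_holo_on e (ball z s)) \<longrightarrow> h z = e z)" for a
    using Riemann_extension_local[OF gen] bdd by metis
  then obtain \<delta> h where \<delta>: "\<And>a. \<delta> a > 0" and h: "\<And>a. line_holo_on (h a) (ball a (\<delta> a))"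
    and eq: "\<And>a z. z \<in> ball a (\<delta> a) \<Longrightarrow> \<exists>s>0. line_holo_on e (ball z s) \<Longrightarrow> h a z = e z"
    by metis
  have same: "h a b = h b b" if "b \<in> ball a (\<delta> a)" for a b
  proof (rule ccontr)
    assume ne: "h a b \<noteq> h b b"
    let ?W = "ball a (\<delta> a) \<inter> ball b (\<delta> b)"
    have "continuous_on ?W (\<lambda>z. h a z - h b z)"
      using line_holo_on_continuous[OF h[of a]] line_holo_on_continuous[OF h[of b]]
      by (intro continuous_intros) (auto elim: continuous_on_subset)
    then have o: "open (?W \<inter> (\<lambda>z. h a z - h b z) -` (-{0}))" (is "open ?O")
      by (rule continuous_open_preimage) auto
    have "b \<in> ?O" using ne that \<delta> by auto
    from generic_at_dense[OF gen o this] obtain y where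
      "y \<in> ?O" "\<exists>s>0. line_holo_on e (ball y s)" by blast
    then show False using eq[of y a] eq[of y b] by simp
  qed
  have "line_holo_on (\<lambda>z. h z z) UNIV"
  proof (rule line_holo_on_local)
    fix a
    have "line_holo_on (\<lambda>z. h z z) (ball a (\<delta> a))"
      by (rule line_holo_on_cong[OF h]) (use same in auto)
    then show "\<exists>r>0. line_holo_on (\<lambda>z. h z z) (ball a r)" using \<delta> by blast
  qed auto
  moreover have "h z z = e z" if "\<exists>s>0. line_holo_on e (ball z s)" for z
    using eq[of z z] that \<delta> by simp
  ultimately show ?thesis by (intro exI[of _ "\<lambda>z. h z z"]) blast
qed

section \<open>Zeros in one variable depending on parameters\<close>

text \<open>Stands for the point (z', t) of a product of the base with one coordinate line. The base
  point keeps a dummy \<open>i\<close>-th coordinate, which avoids a second type for the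
  base.\<close>

definition cupd :: "complex^'n \<Rightarrow> 'n \<Rightarrow> complex \<Rightarrow> complex^'n" where
  "cupd z i t = (\<chi> k. if k = i then t else z $ k)"

lemma cupd_nth [simp]: "cupd z i t $ k = (if k = i then t else z $ k)"
  by (simp add: cupd_def)

lemma cupd_self [simp]: "cupd z i (z $ i) = z"
  by (simp add: vec_eq_iff)

lemma cupd_line: "cupd (z + s *s v) i t = cupd z i t + s *s cupd v i 0"
  by (simp add: vec_eq_iff)

lemma cupd_shift: "cupd z i (t + s) = cupd z i t + s *s axis i 1"
  by (simp add: vec_eq_iff axis_def)

lemma continuous_on_cupd [continuous_intros]:
  assumes "continuous_on S f" "continuous_on S g"
  shows "continuous_on S (\<lambda>x. cupd (f x) i (g x))"
  unfolding cupd_def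
proof (rule continuous_on_vec_lambda)
  fix k show "continuous_on S (\<lambda>x. if k = i then g x else f x $ k)"
    by (cases "k = i") (use assms in \<open>auto intro!: continuous_intros\<close>)
qed

lemma open_cupd_preimage:
  assumes "open U" shows "open {t. cupd z i t \<in> U}"
proof -
  have "continuous_on UNIV (\<lambda>t. cupd z i t)" by (intro continuous_intros)
  from open_vimage[OF assms this] show ?thesis by (simp add: vimage_def)
qed

lemma holomorphic_on_cupd:
  assumes "line_holo_on f U"
  shows "(\<lambda>t. f (cupd z i t)) holomorphic_on {t. cupd z i t \<in> U}"
proof -
  have eq: "cupd z i t = cupd z i 0 + t *s axis i 1" for t
    using cupd_shift[of z i 0 t] by simp
  show ?thesis
    using line_holo_on_line[OF assms, of "cupd z i 0" "axis i 1"] unfolding eq[symmetric] .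
qed

lemma line_holo_on_cupd:
  assumes "line_holo_on f U" "open G" "\<And>z. z \<in> G \<Longrightarrow> cupd z i t \<in> U"
  shows "line_holo_on (\<lambda>z. f (cupd z i t)) G"
  by (rule line_holo_on_affine[OF assms(1,2), where A="\<lambda>z. cupd z i t" and B="\<lambda>v. cupd v i 0"])
    (use assms(3) cupd_line in \<open>auto intro!: continuous_intros\<close>)

lemma norm_of_nat_diff_ge_1:
  assumes "m \<noteq> k" shows "1 \<le> norm (of_nat m - of_nat k :: complex)"
proof -
  have "norm (of_nat m - of_nat k :: complex) = \<bar>real m - real k\<bar>"
    by (metis norm_of_real of_real_diff of_real_of_nat_eq real_norm_def)
  also have "\<dots> \<ge> 1" using assms by linarith
  finally show ?thesis .
qed

text \<open>The polydisc setting of the Weierstrass preparation theorem.\<close>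

locale zero_window =
  fixes F :: "complex^'n \<Rightarrow> complex" and U :: "(complex^'n) set" and i :: 'n
    and c :: complex and \<rho> :: real and G :: "(complex^'n) set"
  assumes F: "line_holo_on F U" and \<rho>: "\<rho> > 0" and open_G: "open G" and convex_G: "convex G"
    and in_U: "\<And>z t. z \<in> G \<Longrightarrow> t \<in> cball c \<rho> \<Longrightarrow> cupd z i t \<in> U"
    and nonzero: "\<And>z t. z \<in> G \<Longrightarrow> t \<in> sphere c \<rho> \<Longrightarrow> F (cupd z i t) \<noteq> 0"
begin

definition zeros :: "complex^'n \<Rightarrow> complex set" where
  "zeros z = {t \<in> ball c \<rho>. F (cupd z i t) = 0}"

text \<open>At a zero in the window \<open>zorder\<close> is positive, see
  \<open>zorder_pos\<close>, so \<open>nat\<close> loses nothing there.\<close>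

definition mult :: "complex^'n \<Rightarrow> complex \<Rightarrow> nat" where
  "mult z t = nat (zorder (\<lambda>s. F (cupd z i s)) t)"

text \<open>\<open>F\<close> has no zero on the boundary circle, so it is not identically zero on a
  slightly larger disc, and compactness leaves finitely many zeros.\<close>

lemma larger_disc:
  assumes "z \<in> G"
  obtains R where "\<rho> < R" "cball c R \<subseteq> {t. cupd z i t \<in> U}"
    "(\<lambda>t. F (cupd z i t)) holomorphic_on cball c R"
    "finite {t \<in> cball c R. F (cupd z i t) = 0}"
proof -
  let ?f = "\<lambda>t. F (cupd z i t)"
  let ?S = "{t. cupd z i t \<in> U}"
  have oS: "open ?S" by (rule open_cupd_preimage[OF line_holo_on_open[OF F]])
  have "cball c \<rho> \<subseteq> ?S" using in_U[OF assms] by blast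
  then obtain R where R: "\<rho> < R" "cball c R \<subseteq> ?S"
    using cball_enlarge[OF oS] \<rho> by metis
  \<comment> \<open>Strictly between the two radii, so that the closed disc of radius
    \<open>R'\<close> is a compact subset of the open disc of radius \<open>R\<close>.\<close>
  define R' where "R' = (\<rho> + R) / 2"
  have R': "\<rho> < R'" "R' < R" using R by (auto simp: R'_def)
  have H: "?f holomorphic_on cball c R"
    by (rule holomorphic_on_subset[OF holomorphic_on_cupd[OF F] R(2)])
  have sub: "cball c R' \<subseteq> ball c R" using R' by auto
  have p: "c + of_real \<rho> \<in> sphere c \<rho>" using \<rho> by (simp add: dist_norm)
  have nz: "?f (c + of_real \<rho>) \<noteq> 0" using nonzero[OF assms p] .
  have pb: "c + of_real \<rho> \<in> ball c R" using \<rho> R by (simp add: dist_norm)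
  have "finite {t \<in> cball c R'. ?f t = 0}"
  proof (cases "?f constant_on ball c R")
    case True
    then obtain d where d: "\<And>t. t \<in> ball c R \<Longrightarrow> ?f t = d"
      unfolding constant_on_def by blast
    have "d \<noteq> 0" using d[OF pb] nz by simp
    then have "?f t \<noteq> 0" if "t \<in> cball c R'" for t
      using d[of t] subsetD[OF sub that] by simp
    then have "{t \<in> cball c R'. ?f t = 0} = {}" by blast
    then show ?thesis by (simp only: finite.emptyI)
  next
    case False
    show ?thesis
      by (rule holomorphic_compact_finite_zeros[OF holomorphic_on_subset[OF H ball_subset_cball]
            open_ball connected_ball compact_cball sub False])
  qed
  moreover have sub2: "cball c R' \<subseteq> cball c R" using R' by auto
  ultimately show ?thesis
    using that[of R'] R'(1) R(2) holomorphic_on_subset[OF H sub2] by (metis order_trans)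
qed

lemma finite_zeros: "z \<in> G \<Longrightarrow> finite (zeros z)"
proof -
  assume "z \<in> G"
  then obtain R where R: "\<rho> < R" "finite {t \<in> cball c R. F (cupd z i t) = 0}"
    using larger_disc by metis
  show ?thesis by (rule finite_subset[OF _ R(2)]) (use R in \<open>auto simp: zeros_def\<close>)
qed

lemma zorder_pos:
  assumes "z \<in> G" "t \<in> zeros z"
  shows "zorder (\<lambda>s. F (cupd z i s)) t > 0"
proof -
  let ?f = "\<lambda>t. F (cupd z i t)"
  obtain R where R: "\<rho> < R" "?f holomorphic_on cball c R" "finite {t \<in> cball c R. ?f t = 0}"
    using larger_disc[OF assms(1)] by metis
  let ?Z = "{t \<in> cball c R. ?f t = 0}"
  have t: "t \<in> ball c R" "?f t = 0" using assms(2) R by (auto simp: zeros_def)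
  have "open (ball c R - (?Z - {t}))" using R(3) by (simp add: finite_imp_closed open_Diff)
  then have "\<forall>\<^sub>F s in at t. s \<in> ball c R - (?Z - {t})"
    using t(1) eventually_at_topological by blast
  moreover have "\<forall>\<^sub>F s in at t. s \<noteq> t" by (simp add: eventually_at_filter)
  ultimately have "\<forall>\<^sub>F s in at t. ?f s \<noteq> 0"
    by eventually_elim auto
  then have "\<exists>\<^sub>F s in at t. ?f s \<noteq> 0"
    by (simp add: eventually_frequently)
  then show ?thesis
    using zorder_pos_iff[OF holomorphic_on_subset[OF R(2) ball_subset_cball] open_ball t(1)] t(2) by blast
qed

lemma mult_pos: "z \<in> G \<Longrightarrow> t \<in> zeros z \<Longrightarrow> mult z t > 0"
  using zorder_pos[of z t] by (simp add: mult_def)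

text \<open>The argument principle with weight \<open>g\<close>. Its point is that the contour does
  not move with \<open>z\<close>, whereas the zeros do.\<close>

lemma weighted_sum_eq_integral:
  assumes "z \<in> G" and g: "line_holo_on g U"
  shows "(\<Sum>t\<in>zeros z. of_nat (mult z t) * g (cupd z i t)) =
    1 / (2 * of_real pi * \<i>) * contour_integral (circlepath c \<rho>)
      (\<lambda>t. deriv (\<lambda>s. F (cupd z i s)) t * g (cupd z i t) / F (cupd z i t))"
proof -
  let ?f = "\<lambda>t. F (cupd z i t)"
  let ?p = "circlepath c \<rho>"
  obtain R where R: "\<rho> < R" "cball c R \<subseteq> {t. cupd z i t \<in> U}"
    "?f holomorphic_on cball c R" "finite {t \<in> cball c R. ?f t = 0}"
    by (rule larger_disc[OF assms(1)])
  define pz where "pz = {w \<in> ball c R. ?f w = 0 \<or> w \<in> {}}"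
  have fin: "finite pz" by (rule finite_subset[OF _ R(4)]) (auto simp: pz_def)
  have sph: "path_image ?p = sphere c \<rho>" using \<rho> by simp
  have out: "winding_number ?p w = 0" if "w \<notin> cball c \<rho>" for w
    by (rule winding_number_zero_outside[where s="cball c \<rho>"])
      (use that sph sphere_cball in \<open>auto simp del: mem_cball path_image_circlepath\<close>)
  have "contour_integral ?p (\<lambda>x. deriv ?f x * g (cupd z i x) / ?f x) =
      of_real (2 * pi) * \<i> * (\<Sum>p\<in>pz. winding_number ?p p * g (cupd z i p) * of_int (zorder ?f p))"
    unfolding pz_def
  proof (rule argument_principle[where f="?f" and h="\<lambda>t. g (cupd z i t)" and S="ball c R" and poles="{}"])
    show "?f holomorphic_on ball c R - {}"
      using holomorphic_on_subset[OF R(3) ball_subset_cball] by simp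
    show "(\<lambda>t. g (cupd z i t)) holomorphic_on ball c R"
      by (rule holomorphic_on_subset[OF holomorphic_on_cupd[OF g] order_trans[OF ball_subset_cball R(2)]])
    show "path_image ?p \<subseteq> ball c R - {w \<in> ball c R. ?f w = 0 \<or> w \<in> {}}"
    proof
      fix t assume "t \<in> path_image ?p"
      then have t: "t \<in> sphere c \<rho>" unfolding sph .
      then show "t \<in> ball c R - {w \<in> ball c R. ?f w = 0 \<or> w \<in> {}}"
        using nonzero[OF assms(1) t] R(1) by simp
    qed
    show "\<forall>w. w \<notin> ball c R \<longrightarrow> winding_number ?p w = 0"
    proof (intro allI impI)
      fix w assume "w \<notin> ball c R"
      then have "w \<notin> cball c \<rho>" using R(1) by simp
      then show "winding_number ?p w = 0" by (rule out)
    qed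
    show "finite {w \<in> ball c R. ?f w = 0 \<or> w \<in> {}}"
      using fin unfolding pz_def .
  qed auto
  \<comment> \<open>Zeros between the contour and the auxiliary circle have winding number 0 and
    drop out.\<close>
  also have "(\<Sum>p\<in>pz. winding_number ?p p * g (cupd z i p) * of_int (zorder ?f p)) =
      (\<Sum>t\<in>zeros z. winding_number ?p t * g (cupd z i t) * of_int (zorder ?f t))"
  proof (rule sum.mono_neutral_right[OF fin])
    show "zeros z \<subseteq> pz" using R(1) by (auto simp: zeros_def pz_def)
    show "\<forall>t\<in>pz - zeros z. winding_number ?p t * g (cupd z i t) * of_int (zorder ?f t) = 0"
    proof
      fix t assume t: "t \<in> pz - zeros z"
      then have "t \<notin> ball c \<rho>" "t \<notin> sphere c \<rho>"
        using nonzero[OF assms(1), of t] by (auto simp: pz_def zeros_def)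
      then have "t \<notin> cball c \<rho>" by simp
      then show "winding_number ?p t * g (cupd z i t) * of_int (zorder ?f t) = 0"
        using out by simp
    qed
  qed
  also have "\<dots> = (\<Sum>t\<in>zeros z. of_nat (mult z t) * g (cupd z i t))"
  proof (rule sum.cong[OF refl])
    fix t assume t: "t \<in> zeros z"
    then have "winding_number ?p t = 1"
      by (intro winding_number_circlepath) (simp add: zeros_def dist_norm norm_minus_commute)
    moreover have "(of_int (zorder ?f t) :: complex) = of_nat (mult z t)"
      using zorder_pos[OF assms(1) t] by (simp add: mult_def)
    ultimately show "winding_number ?p t * g (cupd z i t) * of_int (zorder ?f t) =
        of_nat (mult z t) * g (cupd z i t)" by simp
  qed
  finally show ?thesis by (simp add: field_simps)
qed

lemma line_holo_on_weighted_sum: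
  assumes g: "line_holo_on g U"
  shows "line_holo_on (\<lambda>z. \<Sum>t\<in>zeros z. of_nat (mult z t) * g (cupd z i t)) G"
proof -
  \<comment> \<open>The derivative in the \<open>i\<close>-th variable as a function of all
    variables, so that it is again holomorphic along every line.\<close>
  define F' where "F' x = deriv (\<lambda>s. F (x + s *s axis i 1)) 0" for x
  have F': "line_holo_on F' U" unfolding F'_def by (rule line_holo_on_deriv[OF F])
  have dF: "deriv (\<lambda>s. F (cupd z i s)) t = F' (cupd z i t)" for z t
    by (subst deriv_shift_0) (simp add: F'_def cupd_shift o_def)
  have c1: "continuous_on (G \<times> sphere c \<rho>) (\<lambda>y. f (cupd (fst y) i (snd y)))"
    if "line_holo_on f U" for f
    by (rule continuous_on_compose2[OF line_holo_on_continuous[OF that]])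
      (use in_U in \<open>auto intro!: continuous_intros\<close>)
  have "line_holo_on (\<lambda>z. 1 / (2 * of_real pi * \<i>) * contour_integral (circlepath c \<rho>)
      (\<lambda>t. F' (cupd z i t) * g (cupd z i t) / F (cupd z i t))) G"
  proof (intro line_holo_on_mult line_holo_on_const line_holo_on_circle_integral open_G \<rho>)
    show "continuous_on (G \<times> sphere c \<rho>) (\<lambda>(z, t). F' (cupd z i t) * g (cupd z i t) / F (cupd z i t))"
      unfolding case_prod_beta
      by (intro continuous_intros c1 F F' g) (use nonzero in auto)
    fix t assume t: "t \<in> sphere c \<rho>"
    then have t': "t \<in> cball c \<rho>" using sphere_cball by blast
    show "line_holo_on (\<lambda>z. F' (cupd z i t) * g (cupd z i t) / F (cupd z i t)) G"
      by (intro line_holo_on_divide line_holo_on_mult line_holo_on_cupd[of _ U] F F' g open_G)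
        (use in_U[OF _ t'] nonzero[OF _ t] in auto)
  qed
  then show ?thesis
    by (rule line_holo_on_cong) (simp add: weighted_sum_eq_integral[OF _ g] dF)
qed

text \<open>With weight 1 the weighted sum is a continuous integer-valued function on a connected
  set.\<close>

lemma number_of_zeros_constant:
  obtains n where "\<And>z. z \<in> G \<Longrightarrow> (\<Sum>t\<in>zeros z. mult z t) = n"
proof -
  have "line_holo_on (\<lambda>z. \<Sum>t\<in>zeros z. of_nat (mult z t) * 1) G"
    by (rule line_holo_on_weighted_sum[where g="\<lambda>_. 1"])
      (rule line_holo_on_const[OF line_holo_on_open[OF F]])
  then have cont: "continuous_on G (\<lambda>z. of_nat (\<Sum>t\<in>zeros z. mult z t) :: complex)"
    using line_holo_on_continuous by fastforce
  have "(\<lambda>z. of_nat (\<Sum>t\<in>zeros z. mult z t) :: complex) constant_on G"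
  proof (rule continuous_discrete_range_constant[OF convex_connected[OF convex_G] cont])
    fix x
    show "\<exists>e>0. \<forall>y. y \<in> G \<and> of_nat (\<Sum>t\<in>zeros y. mult y t) \<noteq> (of_nat (\<Sum>t\<in>zeros x. mult x t) :: complex) \<longrightarrow>
        e \<le> norm (of_nat (\<Sum>t\<in>zeros y. mult y t) - of_nat (\<Sum>t\<in>zeros x. mult x t) :: complex)"
      by (intro exI[of _ 1]) (metis norm_of_nat_diff_ge_1 zero_less_one)
  qed
  then obtain d where d: "\<And>z. z \<in> G \<Longrightarrow> (of_nat (\<Sum>t\<in>zeros z. mult z t) :: complex) = d"
    unfolding constant_on_def by blast
  show ?thesis
  proof (cases "G = {}")
    case True then show ?thesis using that[of 0] by simp
  next
    case False
    then obtain w where w: "w \<in> G" by blast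
    show ?thesis
    proof (rule that[of "\<Sum>t\<in>zeros w. mult w t"])
      fix z assume "z \<in> G"
      then have "(of_nat (\<Sum>t\<in>zeros z. mult z t) :: complex) = of_nat (\<Sum>t\<in>zeros w. mult w t)"
        using d w by metis
      then show "(\<Sum>t\<in>zeros z. mult z t) = (\<Sum>t\<in>zeros w. mult w t)" using of_nat_eq_iff by blast
    qed
  qed
qed

lemma card_zeros_le:
  assumes "z \<in> G" shows "card (zeros z) \<le> (\<Sum>t\<in>zeros z. mult z t)"
proof -
  have "(\<Sum>t\<in>zeros z. 1) \<le> (\<Sum>t\<in>zeros z. mult z t)"
    by (rule sum_mono) (use mult_pos[OF assms] in \<open>simp add: Suc_leI\<close>)
  then show ?thesis by simp
qed

end

section \<open>Polycylinders and the tube lemma for one coordinate\<close>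

definition cyl :: "complex^'n \<Rightarrow> 'n set \<Rightarrow> real \<Rightarrow> (complex^'n) set" where
  "cyl a S \<delta> = {z. \<forall>k\<in>S. norm (z $ k - a $ k) < \<delta>}"

lemma open_cyl: "open (cyl a S \<delta>)"
proof -
  have "cyl a S \<delta> = (\<Inter>k\<in>S. {z. norm (z $ k - a $ k) < \<delta>})" by (auto simp: cyl_def)
  moreover have "open {z. norm (z $ k - a $ k) < \<delta>}" for k
    by (intro open_Collect_less continuous_intros)
  ultimately show ?thesis by (simp add: open_INT)
qed

lemma convex_cyl: "convex (cyl a S \<delta>)"
proof -
  have "cyl a S \<delta> = (\<Inter>k\<in>S. (\<lambda>z. z $ k) -` ball (a $ k) \<delta>)"
    by (auto simp: cyl_def dist_norm norm_minus_commute)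
  moreover have "linear (\<lambda>z :: complex^'a. z $ k)" for k
    by (rule linearI) auto
  ultimately show ?thesis by (simp add: convex_INT convex_linear_vimage)
qed

lemma cyl_mono: "\<delta> \<le> \<delta>' \<Longrightarrow> cyl a S \<delta> \<subseteq> cyl a S \<delta>'"
  by (force simp: cyl_def)

lemma centre_in_cyl: "\<delta> > 0 \<Longrightarrow> a \<in> cyl a S \<delta>"
  by (simp add: cyl_def)

lemma ball_subset_cyl: "ball w \<delta> \<subseteq> cyl w S \<delta>"
proof
  fix z assume "z \<in> ball w \<delta>"
  then have "norm (z - w) < \<delta>" by (simp add: dist_norm norm_minus_commute)
  then show "z \<in> cyl w S \<delta>"
    unfolding cyl_def using Finite_Cartesian_Product.norm_nth_le[of "z - w"] by (auto intro: order.strict_trans1)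
qed

lemma norm_vec_le_sum: "norm (x :: complex^'n) \<le> (\<Sum>k\<in>UNIV. norm (x $ k))"
  unfolding norm_vec_def by (rule L2_set_le_sum) simp

text \<open>Compactness of the slice over \<open>K\<close>. The neighbourhood
  \<open>cyl a (-{i}) \<delta>\<close> leaves the dummy \<open>i\<close>-th coordinate of the base
  point free.\<close>

lemma cupd_tube:
  fixes a :: "complex^'n"
  assumes "open V" "compact K" "\<And>t. t \<in> K \<Longrightarrow> cupd a i t \<in> V"
  shows "\<exists>\<delta>>0. \<forall>z\<in>cyl a (-{i}) \<delta>. \<forall>t\<in>K. cupd z i t \<in> V"
proof -
  have "compact (cupd a i ` K)"
    by (rule compact_continuous_image) (use assms in \<open>auto intro!: continuous_intros\<close>)
  then obtain \<epsilon> where \<epsilon>: "\<epsilon> > 0" "(\<Union>x\<in>cupd a i ` K. ball x \<epsilon>) \<subseteq> V"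
    using compact_subset_open_imp_ball_epsilon_subset assms by (metis image_subsetI)
  \<comment> \<open>The norm is at most the sum of the \<open>CARD('n)\<close> coordinate norms,
    each below \<open>\<delta>\<close>.\<close>
  define \<delta> where "\<delta> = \<epsilon> / CARD('n)"
  have \<delta>: "\<delta> > 0" using \<epsilon> by (simp add: \<delta>_def)
  have "cupd z i t \<in> V" if z: "z \<in> cyl a (-{i}) \<delta>" and t: "t \<in> K" for z t
  proof -
    have lt: "norm ((cupd z i t - cupd a i t) $ k) < \<delta>" for k
      using z \<delta> by (auto simp: cyl_def)
    have "dist (cupd a i t) (cupd z i t) \<le> (\<Sum>k\<in>UNIV. norm ((cupd z i t - cupd a i t) $ k))"
      using norm_vec_le_sum[of "cupd z i t - cupd a i t"] by (simp add: dist_norm norm_minus_commute)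
    also have "\<dots> < (\<Sum>k\<in>(UNIV::'n set). \<delta>)"
      by (rule sum_strict_mono) (use lt in auto)
    also have "\<dots> = \<epsilon>" by (simp add: \<delta>_def)
    finally have "cupd z i t \<in> ball (cupd a i t) \<epsilon>" by simp
    then show ?thesis using \<epsilon>(2) t by blast
  qed
  then show ?thesis using \<delta> by blast
qed

section \<open>Elementary symmetric functions as coefficients of a product of factors 1 + a
  X\<close>

definition elem_sym_fps :: "complex multiset \<Rightarrow> complex fps" where
  "elem_sym_fps M = prod_mset (image_mset (\<lambda>a. 1 + fps_const a * fps_X) M)"

lemma elem_sym_fps_empty: "elem_sym_fps {#} = 1"
  by (simp add: elem_sym_fps_def)

lemma elem_sym_fps_add: "elem_sym_fps (add_mset a M) = (1 + fps_const a * fps_X) * elem_sym_fps M"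
  by (simp add: elem_sym_fps_def)

lemma elem_sym_fps_0: "elem_sym_fps M $ 0 = 1"
  by (induction M) (simp_all add: elem_sym_fps_empty elem_sym_fps_add algebra_simps)

lemma elem_sym_fps_add_Suc:
  "elem_sym_fps (add_mset a M) $ Suc k = elem_sym_fps M $ Suc k + a * elem_sym_fps M $ k"
  by (simp add: elem_sym_fps_add distrib_right mult.assoc)

text \<open>Identifies the product over a multiset with the coefficient whose index is its size.
  This is where the number of elements has to be the same for all parameters.\<close>

lemma elem_sym_fps_top:
  "(\<forall>k>size M. elem_sym_fps M $ k = 0) \<and> elem_sym_fps M $ size M = prod_mset M"
proof (induction M)
  case empty then show ?case by (simp add: elem_sym_fps_empty)
next
  case (add a M)
  have "elem_sym_fps (add_mset a M) $ k = 0" if "k > size (add_mset a M)" for k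
    using that add by (cases k) (auto simp: elem_sym_fps_add_Suc)
  moreover have "elem_sym_fps (add_mset a M) $ size (add_mset a M) = prod_mset (add_mset a M)"
    using add by (simp add: elem_sym_fps_add_Suc)
  ultimately show ?case by blast
qed

text \<open>Newton's identities, read off from the logarithmic derivative of the product.\<close>

lemma Newton_identity:
  "of_nat (Suc k) * elem_sym_fps M $ Suc k =
     (\<Sum>j=0..k. elem_sym_fps M $ j * ((-1) ^ (k - j) * (\<Sum>a\<in>#M. a ^ Suc (k - j))))"
proof -
  \<comment> \<open>\<open>q a\<close> is the geometric series for 1 / (1 + a X).\<close>
  define q where "q a = Abs_fps (\<lambda>j. (-a) ^ j)" for a :: complex
  have q: "(1 + fps_const a * fps_X) * q a = 1" for a
  proof (rule fps_ext)
    fix n show "((1 + fps_const a * fps_X) * q a) $ n = 1 $ n"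
      by (cases n) (simp_all add: q_def distrib_right mult.assoc)
  qed
  \<comment> \<open>\<open>Q M\<close> is the logarithmic derivative of
    \<open>elem_sym_fps M\<close>, with one summand for each linear factor.\<close>
  define Q where "Q M = (\<Sum>a\<in>#M. fps_const a * q a)" for M
  have Q_add: "Q (add_mset a M) = fps_const a * q a + Q M" for a M by (simp add: Q_def)
  have "fps_deriv (elem_sym_fps M) = elem_sym_fps M * Q M"
  proof (induction M)
    case empty then show ?case by (simp add: elem_sym_fps_empty Q_def)
  next
    case (add a M)
    have "fps_deriv (elem_sym_fps (add_mset a M)) =
        fps_const a * elem_sym_fps M + (1 + fps_const a * fps_X) * (elem_sym_fps M * Q M)"
      by (simp add: elem_sym_fps_add add)
    also have "fps_const a * elem_sym_fps M =
        (1 + fps_const a * fps_X) * q a * (fps_const a * elem_sym_fps M)"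
      by (simp add: q)
    finally show ?case by (simp add: elem_sym_fps_add Q_add algebra_simps)
  qed
  then have "fps_deriv (elem_sym_fps M) $ k = (\<Sum>j=0..k. elem_sym_fps M $ j * Q M $ (k - j))"
    by (simp add: fps_mult_nth)
  moreover have "Q M $ j = (-1) ^ j * (\<Sum>a\<in>#M. a ^ Suc j)" for j
  proof (induction M)
    case (add a M)
    then show ?case
      using power_minus[of a j] by (simp add: Q_add q_def algebra_simps)
  qed (simp add: Q_def)
  ultimately show ?thesis by simp
qed

section \<open>Symmetric functions of the zeros: resultants and discriminants\<close>

lemma sum_mset_weighted:
  assumes "finite Z"
  shows "(\<Sum>x\<in>#(\<Sum>t\<in>Z. replicate_mset (m t) (a t)). f x) = (\<Sum>t\<in>Z. of_nat (m t) * (f (a t) :: complex))"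
  using assms by (induction Z) (simp_all add: image_replicate_mset sum_mset_replicate_mset)

lemma prod_mset_weighted:
  assumes "finite Z"
  shows "prod_mset (\<Sum>t\<in>Z. replicate_mset (m t) (a t)) = (\<Prod>t\<in>Z. (a t :: complex) ^ m t)"
  using assms by (induction Z) simp_all

lemma size_weighted:
  assumes "finite Z"
  shows "size (\<Sum>t\<in>Z. replicate_mset (m t) (a t)) = (\<Sum>t\<in>Z. m t)"
  using assms by (induction Z) simp_all

context zero_window
begin

text \<open>This product is the resultant of \<open>F\<close> and \<open>g\<close> in the
  \<open>i\<close>-th variable. The values of \<open>g\<close> at the zeros form a multiset of
  constant size, so the product is an elementary symmetric function of fixed degree, and Newton's
  identities express it by power sums, which are weighted sums of powers of
  \<open>g\<close>.\<close>

lemma line_holo_on_weighted_prod: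
  assumes g: "line_holo_on g U"
  shows "line_holo_on (\<lambda>z. \<Prod>t\<in>zeros z. g (cupd z i t) ^ mult z t) G"
proof -
  obtain n where n: "\<And>z. z \<in> G \<Longrightarrow> (\<Sum>t\<in>zeros z. mult z t) = n"
    using number_of_zeros_constant by blast
  define M where "M z = (\<Sum>t\<in>zeros z. replicate_mset (mult z t) (g (cupd z i t)))" for z
  have psum: "line_holo_on (\<lambda>z. \<Sum>a\<in>#M z. a ^ k) G" for k
    by (rule line_holo_on_cong[OF line_holo_on_weighted_sum[OF line_holo_on_power[OF g]]])
      (simp add: M_def sum_mset_weighted[OF finite_zeros])
  have "line_holo_on (\<lambda>z. elem_sym_fps (M z) $ k) G" for k
  proof (induction k rule: less_induct)
    case (less k)
    show ?case
    proof (cases k)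
      case 0
      then show ?thesis by (simp add: elem_sym_fps_0 line_holo_on_const open_G)
    next
      case (Suc l)
      have "line_holo_on (\<lambda>z. 1 / of_nat (Suc l) * (\<Sum>j=0..l. elem_sym_fps (M z) $ j *
          ((-1) ^ (l - j) * (\<Sum>a\<in>#M z. a ^ Suc (l - j))))) G"
        by (intro line_holo_on_mult line_holo_on_const open_G line_holo_on_sum less psum) (simp add: Suc)
      then show ?thesis
        by (rule line_holo_on_cong) (simp only: Newton_identity[symmetric] Suc, simp del: of_nat_Suc)
    qed
  qed
  then show ?thesis
  proof (rule line_holo_on_cong)
    fix z assume "z \<in> G"
    then have "size (M z) = n" "prod_mset (M z) = (\<Prod>t\<in>zeros z. g (cupd z i t) ^ mult z t)"
      using n by (simp_all add: M_def size_weighted prod_mset_weighted finite_zeros)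
    then show "elem_sym_fps (M z) $ n = (\<Prod>t\<in>zeros z. g (cupd z i t) ^ mult z t)"
      using elem_sym_fps_top[of "M z"] by simp
  qed
qed

text \<open>With no factors in \<open>E\<close> the sum over tuples splits into a product of
  weighted power sums. Each factor \<open>f a - f b\<close> is multiplied out into two sums with one
  exponent raised, which is why the exponents \<open>k\<close> are general.\<close>

lemma line_holo_on_weighted_tuple_sum:
  fixes q :: nat
  assumes "finite E" "E \<subseteq> {..<q} \<times> {..<q}"
  shows "line_holo_on (\<lambda>z. \<Sum>f\<in>PiE {..<q} (\<lambda>_. zeros z).
    (\<Prod>a<q. of_nat (mult z (f a)) * f a ^ k a) * (\<Prod>p\<in>E. f (fst p) - f (snd p))) G"
  using assms
proof (induction E arbitrary: k)
  case empty
  have "line_holo_on (\<lambda>z. \<Prod>a<q. \<Sum>t\<in>zeros z. of_nat (mult z t) * (cupd z i t $ i) ^ k a) G"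
    by (intro line_holo_on_prod open_G line_holo_on_weighted_sum line_holo_on_power line_holo_on_nth
        line_holo_on_open[OF F])
  then show ?case
    by (rule line_holo_on_cong) (subst prod_sum_PiE, simp_all add: finite_zeros)
next
  case (insert p E)
  obtain a b where p: "p = (a, b)" by fastforce
  have ab: "a < q" "b < q" using insert p by auto
  have shift: "(\<Prod>j<q. w j * x j ^ (k(a := Suc (k a))) j) = (\<Prod>j<q. w j * x j ^ k j) * x a"
    if "a < q" for a and w x :: "nat \<Rightarrow> complex"
  proof -
    have "(\<Prod>j<q. w j * x j ^ (k(a := Suc (k a))) j) =
        (\<Prod>j<q. (w j * x j ^ k j) * (if j = a then x a else 1))"
      by (rule prod.cong) auto
    also have "\<dots> = (\<Prod>j<q. w j * x j ^ k j) * x a"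
      using that by (simp add: prod.distrib prod.delta)
    finally show ?thesis .
  qed
  have "line_holo_on (\<lambda>z.
      (\<Sum>f\<in>PiE {..<q} (\<lambda>_. zeros z). (\<Prod>j<q. of_nat (mult z (f j)) * f j ^ (k(a := Suc (k a))) j) * (\<Prod>p\<in>E. f (fst p) - f (snd p))) -
      (\<Sum>f\<in>PiE {..<q} (\<lambda>_. zeros z). (\<Prod>j<q. of_nat (mult z (f j)) * f j ^ (k(b := Suc (k b))) j) * (\<Prod>p\<in>E. f (fst p) - f (snd p)))) G"
    using insert.prems by (intro line_holo_on_diff insert.IH) auto
  moreover have "(\<Prod>p\<in>insert p E. f (fst p) - f (snd p)) = (f a - f b) * (\<Prod>p\<in>E. f (fst p) - f (snd p))"
    for f :: "nat \<Rightarrow> complex" using insert.hyps p by simp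
  ultimately show ?case
    by (elim line_holo_on_cong)
      (simp only: shift ab sum_subtractf[symmetric], rule sum.cong[OF refl], simp add: algebra_simps)
qed

text \<open>The sum is a polynomial in the power sums of the zeros. It vanishes when there are fewer than \<open>q\<close>
  distinct zeros, and all its nonzero terms coincide when there are exactly \<open>q\<close>.\<close>

definition discriminant :: "nat \<Rightarrow> complex^'n \<Rightarrow> complex" where
  "discriminant q z = (\<Sum>f\<in>PiE {..<q} (\<lambda>_. zeros z). (\<Prod>a<q. of_nat (mult z (f a)) * f a ^ 0) *
     (\<Prod>p\<in>{p \<in> {..<q} \<times> {..<q}. fst p \<noteq> snd p}. f (fst p) - f (snd p)))"

text \<open>The factors \<open>f a ^ 0\<close> in the definition make it literally the tuple sum
  with all exponents zero.\<close>

lemma line_holo_on_discriminant: "line_holo_on (discriminant q) G"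
proof -
  have "line_holo_on (\<lambda>z. discriminant q z) G"
    unfolding discriminant_def
    by (rule line_holo_on_weighted_tuple_sum[where k="\<lambda>_. 0"]) auto
  then show ?thesis by simp
qed

lemma discriminant_term_zero:
  fixes q :: nat
  assumes "\<not> inj_on f {..<q}"
  shows "(\<Prod>p\<in>{p \<in> {..<q} \<times> {..<q}. fst p \<noteq> snd p}. f (fst p) - f (snd p) :: complex) = 0"
proof -
  obtain a b where "a < q" "b < q" "a \<noteq> b" "f a = f b"
    using assms unfolding inj_on_def by auto
  then have "(a, b) \<in> {p \<in> {..<q} \<times> {..<q}. fst p \<noteq> snd p}" "f (fst (a, b)) - f (snd (a, b)) = 0" by auto
  moreover have "finite {p \<in> {..<q} \<times> {..<q}. fst p \<noteq> snd p}" by (rule finite_subset[of _ "{..<q} \<times> {..<q}"]) auto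
  ultimately show ?thesis by (meson prod_zero)
qed

lemma discriminant_nonzero_imp:
  assumes "z \<in> G" "discriminant q z \<noteq> 0" shows "q \<le> card (zeros z)"
proof (rule ccontr)
  assume less: "\<not> q \<le> card (zeros z)"
  have "discriminant q z = 0"
    unfolding discriminant_def
  proof (rule sum.neutral, rule ballI)
    fix f assume f: "f \<in> PiE {..<q} (\<lambda>_. zeros z)"
    have "\<not> inj_on f {..<q}"
    proof
      assume "inj_on f {..<q}"
      moreover have "f ` {..<q} \<subseteq> zeros z" using f by (auto simp: PiE_iff)
      ultimately have "card {..<q} \<le> card (zeros z)"
        using card_inj_on_le finite_zeros[OF assms(1)] by blast
      then show False using less by simp
    qed
    then show "(\<Prod>a<q. of_nat (mult z (f a)) * f a ^ 0) *
     (\<Prod>p\<in>{p \<in> {..<q} \<times> {..<q}. fst p \<noteq> snd p}. f (fst p) - f (snd p)) = 0"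
      by (simp add: discriminant_term_zero)
  qed
  then show False using assms by simp
qed

lemma discriminant_nonzero:
  assumes z: "z \<in> G" and q: "card (zeros z) = q" shows "discriminant q z \<noteq> 0"
proof -
  let ?Z = "zeros z"
  let ?P = "PiE {..<q} (\<lambda>_. ?Z)"
  have fin: "finite ?Z" by (rule finite_zeros[OF z])
  \<comment> \<open>Running over all ordered pairs makes the product independent of how the zeros
    are numbered, so \<open>C\<close> is the value of every injective term.\<close>
  define C where "C = (\<Prod>t\<in>?Z. of_nat (mult z t) :: complex) * (\<Prod>p\<in>{p \<in> ?Z \<times> ?Z. fst p \<noteq> snd p}. fst p - snd p)"
  have "C \<noteq> 0"
    unfolding C_def using fin mult_pos[OF z] by (auto simp: prod_zero_iff)
  have inj: "(\<Prod>a<q. of_nat (mult z (f a)) * f a ^ 0) *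
     (\<Prod>p\<in>{p \<in> {..<q} \<times> {..<q}. fst p \<noteq> snd p}. f (fst p) - f (snd p)) = C"
    if f: "f \<in> ?P" "inj_on f {..<q}" for f
  proof -
    have "f ` {..<q} \<subseteq> ?Z" using f by (auto simp: PiE_iff)
    moreover have "card (f ` {..<q}) = card ?Z" using f(2) q by (simp add: card_image)
    ultimately have im: "f ` {..<q} = ?Z" using card_subset_eq fin by blast
    have b1: "bij_betw f {..<q} ?Z" using im f(2) by (simp add: bij_betw_def)
    have "bij_betw (map_prod f f) {p \<in> {..<q} \<times> {..<q}. fst p \<noteq> snd p} {p \<in> ?Z \<times> ?Z. fst p \<noteq> snd p}"
      unfolding bij_betw_def
    proof
      show "inj_on (map_prod f f) {p \<in> {..<q} \<times> {..<q}. fst p \<noteq> snd p}"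
        using f(2) by (auto simp: inj_on_def)
      show "map_prod f f ` {p \<in> {..<q} \<times> {..<q}. fst p \<noteq> snd p} = {p \<in> ?Z \<times> ?Z. fst p \<noteq> snd p}"
      proof (rule set_eqI, rule iffI)
        fix p assume "p \<in> map_prod f f ` {p \<in> {..<q} \<times> {..<q}. fst p \<noteq> snd p}"
        then show "p \<in> {p \<in> ?Z \<times> ?Z. fst p \<noteq> snd p}"
          using im f(2) by (auto simp: inj_on_def)
      next
        fix p assume p: "p \<in> {p \<in> ?Z \<times> ?Z. fst p \<noteq> snd p}"
        then have "fst p \<in> f ` {..<q}" "snd p \<in> f ` {..<q}" unfolding im by auto
        then obtain a b where "a < q" "b < q" "fst p = f a" "snd p = f b" by blast
        then show "p \<in> map_prod f f ` {p \<in> {..<q} \<times> {..<q}. fst p \<noteq> snd p}"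
          using p by (intro image_eqI[of _ _ "(a, b)"]) (auto simp: prod_eq_iff)
      qed
    qed
    then have "(\<Prod>p\<in>{p \<in> {..<q} \<times> {..<q}. fst p \<noteq> snd p}. fst (map_prod f f p) - snd (map_prod f f p)) =
        (\<Prod>p\<in>{p \<in> ?Z \<times> ?Z. fst p \<noteq> snd p}. fst p - snd p)"
      by (rule prod.reindex_bij_betw)
    moreover have "(\<Prod>a<q. of_nat (mult z (f a)) :: complex) = (\<Prod>t\<in>?Z. of_nat (mult z t))"
      by (rule prod.reindex_bij_betw[OF b1])
    ultimately show ?thesis by (simp add: C_def)
  qed
  have "discriminant q z = (\<Sum>f\<in>{f \<in> ?P. inj_on f {..<q}}. (\<Prod>a<q. of_nat (mult z (f a)) * f a ^ 0) *
     (\<Prod>p\<in>{p \<in> {..<q} \<times> {..<q}. fst p \<noteq> snd p}. f (fst p) - f (snd p)))"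
    unfolding discriminant_def
    by (rule sum.mono_neutral_right) (auto simp: fin finite_PiE discriminant_term_zero)
  also have "\<dots> = (\<Sum>f\<in>{f \<in> ?P. inj_on f {..<q}}. C)"
    by (rule sum.cong[OF refl]) (use inj in blast)
  also have "\<dots> = of_nat (card {f \<in> ?P. inj_on f {..<q}}) * C" by simp
  finally have "discriminant q z = of_nat (card {f \<in> ?P. inj_on f {..<q}}) * C" .
  moreover have "card {f \<in> ?P. inj_on f {..<q}} > 0"
  proof -
    obtain f where f: "bij_betw f {..<q} ?Z"
      using fin q by (metis ex_bij_betw_nat_finite atLeast0LessThan)
    then have "restrict f {..<q} \<in> {f \<in> ?P. inj_on f {..<q}}"
      by (auto simp: bij_betw_def inj_on_def)
    moreover have "finite {f \<in> ?P. inj_on f {..<q}}"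
      by (rule finite_subset[of _ ?P]) (auto simp: fin finite_PiE)
    ultimately show ?thesis unfolding card_gt_0_iff by blast
  qed
  ultimately show ?thesis using \<open>C \<noteq> 0\<close> by simp
qed

text \<open>The unique zero carries the full constant multiplicity \<open>n\<close>, so it is the
  weighted sum of the \<open>i\<close>-th coordinates divided by \<open>n\<close>.\<close>

lemma single_zero:
  assumes "\<And>z. z \<in> G \<Longrightarrow> card (zeros z) = 1"
  shows "\<exists>\<tau>. line_holo_on \<tau> G \<and> (\<forall>z\<in>G. zeros z = {\<tau> z})"
proof -
  obtain n where n: "\<And>z. z \<in> G \<Longrightarrow> (\<Sum>t\<in>zeros z. mult z t) = n"
    using number_of_zeros_constant by blast
  let ?\<tau> = "\<lambda>z. 1 / of_nat n * (\<Sum>t\<in>zeros z. of_nat (mult z t) * (cupd z i t $ i))"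
  have "line_holo_on ?\<tau> G"
    by (intro line_holo_on_mult line_holo_on_const open_G line_holo_on_weighted_sum line_holo_on_nth
        line_holo_on_open[OF F])
  moreover have "zeros z = {?\<tau> z}" if z: "z \<in> G" for z
  proof -
    obtain s where s: "zeros z = {s}" using assms[OF z] card_1_singletonE by blast
    then have "mult z s = n" using n[OF z] by simp
    moreover have "n \<noteq> 0" using mult_pos[OF z, of s] s \<open>mult z s = n\<close> by simp
    ultimately show ?thesis by (simp add: s)
  qed
  ultimately show ?thesis by (intro exI[of _ ?\<tau>]) blast
qed

lemma zeros_nonempty:
  assumes "w \<in> G" "zeros w \<noteq> {}" "z \<in> G" shows "zeros z \<noteq> {}"
proof -
  obtain n where n: "\<And>z. z \<in> G \<Longrightarrow> (\<Sum>t\<in>zeros z. mult z t) = n"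
    using number_of_zeros_constant by blast
  have "card (zeros w) > 0" using assms finite_zeros by (simp add: card_gt_0_iff)
  then have "n > 0" using card_zeros_le[OF assms(1)] n[OF assms(1)] by simp
  then show ?thesis using n[OF assms(3)] by auto
qed

text \<open>Separate the zeros over \<open>w\<close> by disjoint small discs. Each disc keeps at
  least one zero for nearby \<open>z\<close>; as \<open>w\<close> already has the maximal number,
  each keeps exactly one and no zero lies elsewhere.\<close>

lemma zeros_locally_graphs:
  assumes w: "w \<in> G" and max: "\<And>z. z \<in> G \<Longrightarrow> card (zeros z) \<le> card (zeros w)"
  shows "\<exists>r>0. \<exists>T. finite T \<and> ball w r \<subseteq> G \<and> (\<forall>\<tau>\<in>T. line_holo_on \<tau> (ball w r)) \<and>
    (\<forall>z\<in>ball w r. zeros z = (\<lambda>\<tau>. \<tau> z) ` T \<and> inj_on (\<lambda>\<tau>. \<tau> z) T)"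
proof -
  let ?Z = "zeros w"
  have fin: "finite ?Z" by (rule finite_zeros[OF w])
  have "\<exists>\<epsilon>>0. cball t \<epsilon> \<subseteq> ball c \<rho> \<and> (\<forall>s\<in>?Z. s \<noteq> t \<longrightarrow> 2 * \<epsilon> < dist s t)" if t: "t \<in> ?Z" for t
  proof -
    have "t \<in> ball c \<rho>" using t by (simp add: zeros_def)
    then obtain e1 where e1: "e1 > 0" "cball t e1 \<subseteq> ball c \<rho>"
      using open_contains_cball open_ball by metis
    obtain e2 where e2: "e2 > 0" "\<forall>s\<in>?Z. s \<noteq> t \<longrightarrow> e2 \<le> dist t s"
      using finite_set_avoid[OF fin] by metis
    \<comment> \<open>A third of the separation gives the strict inequality that keeps even the
      closed discs disjoint.\<close>
    have "2 * min e1 (e2/3) < dist s t" if "s \<in> ?Z" "s \<noteq> t" for s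
    proof -
      have "e2 \<le> dist s t" using e2 that by (simp add: dist_commute)
      then show ?thesis using e2(1) by linarith
    qed
    moreover have "cball t (min e1 (e2/3)) \<subseteq> ball c \<rho>" using e1(2) by auto
    ultimately show ?thesis using e1(1) e2(1) by (intro exI[of _ "min e1 (e2/3)"]) auto
  qed
  then obtain \<epsilon> where \<epsilon>: "\<And>t. t \<in> ?Z \<Longrightarrow> \<epsilon> t > 0" "\<And>t. t \<in> ?Z \<Longrightarrow> cball t (\<epsilon> t) \<subseteq> ball c \<rho>"
    "\<And>s t. t \<in> ?Z \<Longrightarrow> s \<in> ?Z \<Longrightarrow> s \<noteq> t \<Longrightarrow> 2 * \<epsilon> t < dist s t" by metis
  have disj: "cball s (\<epsilon> s) \<inter> cball t (\<epsilon> t) = {}" if "s \<in> ?Z" "t \<in> ?Z" "s \<noteq> t" for s t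
  proof -
    have "x \<notin> cball t (\<epsilon> t)" if x: "x \<in> cball s (\<epsilon> s)" for x
    proof
      assume "x \<in> cball t (\<epsilon> t)"
      then have "dist s t \<le> \<epsilon> s + \<epsilon> t"
        using x dist_triangle_le[of s x t] by (simp add: dist_commute)
      moreover have "2 * \<epsilon> t < dist s t" "2 * \<epsilon> s < dist s t"
        using \<epsilon>(3)[of t s] \<epsilon>(3)[of s t] that \<open>s \<in> ?Z\<close> \<open>t \<in> ?Z\<close> \<open>s \<noteq> t\<close> by (auto simp: dist_commute)
      ultimately show False by linarith
    qed
    then show ?thesis by blast
  qed
  obtain r0 where r0: "r0 > 0" "ball w r0 \<subseteq> G" using open_G w open_contains_ball by blast
  have "\<exists>\<delta>>0. \<forall>z\<in>ball w \<delta>. \<forall>s\<in>sphere t (\<epsilon> t). cupd z i s \<in> {x \<in> U. F x \<noteq> 0}" if t: "t \<in> ?Z" for t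
  proof -
    have "\<exists>\<delta>>0. \<forall>z\<in>cyl w (-{i}) \<delta>. \<forall>s\<in>sphere t (\<epsilon> t). cupd z i s \<in> {x \<in> U. F x \<noteq> 0}"
    proof (rule cupd_tube[OF line_holo_on_open_nonzero[OF F] compact_sphere])
      fix s assume s: "s \<in> sphere t (\<epsilon> t)"
      then have sc: "s \<in> cball t (\<epsilon> t)" using sphere_cball by blast
      then have sb: "s \<in> ball c \<rho>" using \<epsilon>(2)[OF t] by blast
      have "s \<notin> ?Z"
      proof
        assume "s \<in> ?Z"
        moreover have "s \<noteq> t" using s \<epsilon>(1)[OF t] by auto
        ultimately have "2 * \<epsilon> t < dist s t" using \<epsilon>(3)[OF t] by blast
        then show False using s \<epsilon>(1)[OF t] by (simp add: dist_commute)
      qed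
      then show "cupd w i s \<in> {x \<in> U. F x \<noteq> 0}"
        using sb in_U[OF w, of s] by (auto simp: zeros_def)
    qed
    then obtain \<delta> where \<delta>: "\<delta> > 0" "\<forall>z\<in>cyl w (-{i}) \<delta>. \<forall>s\<in>sphere t (\<epsilon> t). cupd z i s \<in> {x \<in> U. F x \<noteq> 0}"
      by blast
    show ?thesis using \<delta> ball_subset_cyl[of w \<delta> "-{i}"] by blast
  qed
  then have "\<forall>t\<in>?Z. \<exists>d. d > 0 \<and> (\<forall>z\<in>ball w d. \<forall>s\<in>sphere t (\<epsilon> t). cupd z i s \<in> {x \<in> U. F x \<noteq> 0})"
    by blast
  from bchoice[OF this] obtain \<delta> where
    "\<forall>t\<in>?Z. \<delta> t > 0 \<and> (\<forall>z\<in>ball w (\<delta> t). \<forall>s\<in>sphere t (\<epsilon> t). cupd z i s \<in> {x \<in> U. F x \<noteq> 0})"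
    by blast
  then have \<delta>: "\<And>t. t \<in> ?Z \<Longrightarrow> \<delta> t > 0"
    "\<And>t z s. t \<in> ?Z \<Longrightarrow> z \<in> ball w (\<delta> t) \<Longrightarrow> s \<in> sphere t (\<epsilon> t) \<Longrightarrow> cupd z i s \<in> {x \<in> U. F x \<noteq> 0}"
    by blast+
  define r where "r = Min (insert r0 (\<delta> ` ?Z))"
  have r: "r > 0" "r \<le> r0" "\<And>t. t \<in> ?Z \<Longrightarrow> r \<le> \<delta> t"
    using fin r0 \<delta>(1) by (auto simp: r_def)
  have rG: "ball w r \<subseteq> G" using r0(2) r(2) by auto
  have win: "zero_window F U i t (\<epsilon> t) (ball w r)" if t: "t \<in> ?Z" for t
  proof
    show "cupd z i s \<in> U" if "z \<in> ball w r" "s \<in> cball t (\<epsilon> t)" for z s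
    proof (rule in_U)
      show "z \<in> G" using that rG by blast
      show "s \<in> cball c \<rho>" using that \<epsilon>(2)[OF t] ball_subset_cball by blast
    qed
    show "F (cupd z i s) \<noteq> 0" if "z \<in> ball w r" "s \<in> sphere t (\<epsilon> t)" for z s
    proof -
      have "z \<in> ball w (\<delta> t)" using that r(3)[OF t] by simp
      then show ?thesis using \<delta>(2)[OF t _ that(2)] by blast
    qed
  qed (use F \<epsilon>(1)[OF t] in auto)
  define Zt where "Zt t z = zero_window.zeros F i t (\<epsilon> t) z" for t z
  have Zt: "Zt t z = {s \<in> ball t (\<epsilon> t). F (cupd z i s) = 0}" if "t \<in> ?Z" for t z
    unfolding Zt_def zero_window.zeros_def[OF win[OF that]] ..
  have sub: "Zt t z \<subseteq> zeros z" if "t \<in> ?Z" for t z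
    unfolding Zt[OF that] zeros_def using \<epsilon>(2)[OF that] ball_subset_cball[of t "\<epsilon> t"] by blast
  have ne: "Zt t z \<noteq> {}" if t: "t \<in> ?Z" and z: "z \<in> ball w r" for t z
    unfolding Zt_def
  proof (rule zero_window.zeros_nonempty[OF win[OF t] _ _ z])
    show "w \<in> ball w r" using r by simp
    have "t \<in> Zt t w" using t \<epsilon>(1)[OF t] by (simp add: Zt[OF t]) (simp add: zeros_def)
    then show "zero_window.zeros F i t (\<epsilon> t) w \<noteq> {}" unfolding Zt_def by blast
  qed
  \<comment> \<open>Squeeze: there is at least one zero per disc, the discs together contain at most
    \<open>card (zeros z)\<close> zeros, and by maximality this is at most the number of
    discs.\<close>
  have key: "(\<forall>t\<in>?Z. card (Zt t z) = 1) \<and> zeros z = (\<Union>t\<in>?Z. Zt t z)" if z: "z \<in> ball w r" for z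
  proof -
    have zG: "z \<in> G" using z rG by blast
    have finZt: "finite (Zt t z)" if "t \<in> ?Z" for t
      by (rule finite_subset[OF sub[OF that] finite_zeros[OF zG]])
    have "card (\<Union>t\<in>?Z. Zt t z) = (\<Sum>t\<in>?Z. card (Zt t z))"
    proof (rule card_UN_disjoint[OF fin])
      show "\<forall>s\<in>?Z. \<forall>t\<in>?Z. s \<noteq> t \<longrightarrow> Zt s z \<inter> Zt t z = {}"
      proof (intro ballI impI)
        fix s t assume st: "s \<in> ?Z" "t \<in> ?Z" "s \<noteq> t"
        have "Zt s z \<subseteq> cball s (\<epsilon> s)" "Zt t z \<subseteq> cball t (\<epsilon> t)"
          using st by (auto simp: Zt)
        then show "Zt s z \<inter> Zt t z = {}" using disj[OF st] by blast
      qed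
    qed (use finZt in blast)
    moreover have Usub: "(\<Union>t\<in>?Z. Zt t z) \<subseteq> zeros z" using sub by blast
    ultimately have le: "(\<Sum>t\<in>?Z. card (Zt t z)) \<le> card (zeros z)"
      using card_mono[OF finite_zeros[OF zG] Usub] by simp
    have ge: "1 \<le> card (Zt t z)" if "t \<in> ?Z" for t
      using ne[OF that z] finZt[OF that] by (simp add: Suc_le_eq card_gt_0_iff)
    have eq: "(\<Sum>t\<in>?Z. card (Zt t z)) = card ?Z"
    proof (rule antisym)
      show "(\<Sum>t\<in>?Z. card (Zt t z)) \<le> card ?Z" using le max[OF zG] by simp
      have "(\<Sum>t\<in>?Z. 1) \<le> (\<Sum>t\<in>?Z. card (Zt t z))" by (rule sum_mono) (rule ge)
      then show "card ?Z \<le> (\<Sum>t\<in>?Z. card (Zt t z))" by simp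
    qed
    have "card (Zt t z) = 1" if t: "t \<in> ?Z" for t
    proof (rule ccontr)
      assume "card (Zt t z) \<noteq> 1"
      then have "1 < card (Zt t z)" using ge[OF t] by simp
      then have "(\<Sum>t\<in>?Z. 1) < (\<Sum>t\<in>?Z. card (Zt t z))"
        by (intro sum_strict_mono_ex1[OF fin]) (use ge t in auto)
      then show False using eq by simp
    qed
    moreover have "(\<Union>t\<in>?Z. Zt t z) = zeros z"
    proof (rule card_subset_eq[OF finite_zeros[OF zG] Usub])
      have "card (zeros z) \<le> card (\<Union>t\<in>?Z. Zt t z)"
        using max[OF zG] eq \<open>card (\<Union>t\<in>?Z. Zt t z) = (\<Sum>t\<in>?Z. card (Zt t z))\<close> by simp
      then show "card (\<Union>t\<in>?Z. Zt t z) = card (zeros z)"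
        using card_mono[OF finite_zeros[OF zG] Usub] by simp
    qed
    ultimately show ?thesis by blast
  qed
  have "\<exists>\<tau>. line_holo_on \<tau> (ball w r) \<and> (\<forall>z\<in>ball w r. Zt t z = {\<tau> z})" if t: "t \<in> ?Z" for t
    unfolding Zt_def
    by (rule zero_window.single_zero[OF win[OF t]]) (use key t in \<open>simp only: Zt_def\<close>)
  then obtain \<tau> where \<tau>: "\<And>t. t \<in> ?Z \<Longrightarrow> line_holo_on (\<tau> t) (ball w r)"
    "\<And>t z. t \<in> ?Z \<Longrightarrow> z \<in> ball w r \<Longrightarrow> Zt t z = {\<tau> t z}"
    by metis
  have "inj_on (\<lambda>\<tau>. \<tau> z) (\<tau> ` ?Z)" if z: "z \<in> ball w r" for z
  proof (rule inj_onI)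
    fix x y assume "x \<in> \<tau> ` ?Z" "y \<in> \<tau> ` ?Z" and eq: "x z = y z"
    then obtain s t where st: "s \<in> ?Z" "t \<in> ?Z" "x = \<tau> s" "y = \<tau> t" by blast
    have "\<tau> s z \<in> Zt s z" "\<tau> t z \<in> Zt t z" using \<tau>(2) st z by blast+
    then have "\<tau> s z \<in> cball s (\<epsilon> s)" "\<tau> s z \<in> cball t (\<epsilon> t)"
      using eq st by (auto simp: Zt)
    then have "s = t" using disj[OF st(1,2)] by blast
    then show "x = y" using st by simp
  qed
  moreover have "zeros z = (\<lambda>\<tau>. \<tau> z) ` (\<tau> ` ?Z)" if z: "z \<in> ball w r" for z
  proof -
    have "zeros z = (\<Union>t\<in>?Z. Zt t z)" using key[OF z] by blast
    also have "\<dots> = (\<Union>t\<in>?Z. {\<tau> t z})" by (rule SUP_cong[OF refl]) (rule \<tau>(2)[OF _ z])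
    finally show ?thesis by auto
  qed
  ultimately show ?thesis
    using r(1) rG fin \<tau>(1) by (intro exI[of _ r] conjI exI[of _ "\<tau> ` ?Z"]) blast+
qed

text \<open>The number of distinct zeros is bounded by the number with multiplicity, so it has a
  maximum \<open>q\<close> on \<open>G\<close>; wherever \<open>discriminant q\<close> is nonzero
  this maximum is attained.\<close>

lemma generic_zeros_graphs:
  assumes "a \<in> G"
  shows "generic_at a (\<lambda>w. \<exists>r>0. \<exists>T. finite T \<and> (\<forall>\<tau>\<in>T. line_holo_on \<tau> (ball w r)) \<and>
    (\<forall>z\<in>ball w r. zeros z = (\<lambda>\<tau>. \<tau> z) ` T \<and> inj_on (\<lambda>\<tau>. \<tau> z) T))"
proof -
  obtain n where n: "\<And>z. z \<in> G \<Longrightarrow> (\<Sum>t\<in>zeros z. mult z t) = n"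
    using number_of_zeros_constant by blast
  define C where "C = (\<lambda>z. card (zeros z)) ` G"
  have "C \<subseteq> {..n}" using card_zeros_le n by (fastforce simp: C_def)
  then have fin: "finite C" using finite_subset by blast
  have ne: "C \<noteq> {}" using assms by (auto simp: C_def)
  define q where "q = Max C"
  have max: "card (zeros z) \<le> q" if "z \<in> G" for z
    unfolding q_def by (rule Max_ge[OF fin]) (use that in \<open>simp add: C_def\<close>)
  have "q \<in> C" unfolding q_def by (rule Max_in[OF fin ne])
  then obtain w0 where w0: "w0 \<in> G" "card (zeros w0) = q" by (auto simp: C_def)
  show ?thesis
  proof (rule generic_atI_within[OF line_holo_on_discriminant[of q] convex_G assms])
    show "\<exists>z\<in>G. discriminant q z \<noteq> 0" using discriminant_nonzero w0 by blast
    fix w assume w: "w \<in> G" "discriminant q w \<noteq> 0"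
    have "card (zeros w) = q" using discriminant_nonzero_imp[OF w] max[OF w(1)] by simp
    then have "card (zeros z) \<le> card (zeros w)" if "z \<in> G" for z
      using max[OF that] by simp
    from zeros_locally_graphs[OF w(1) this]
    show "\<exists>r>0. \<exists>T. finite T \<and> (\<forall>\<tau>\<in>T. line_holo_on \<tau> (ball w r)) \<and>
      (\<forall>z\<in>ball w r. zeros z = (\<lambda>\<tau>. \<tau> z) ` T \<and> inj_on (\<lambda>\<tau>. \<tau> z) T)"
      by blast
  qed
qed

end

section \<open>Analytic sets and elimination of a variable\<close>

text \<open>Asks for holomorphy along lines, because this is the form in which resultants are shown
  to be holomorphic.\<close>

definition line_analytic_at :: "(complex^'n) set \<Rightarrow> complex^'n \<Rightarrow> bool" where
  "line_analytic_at X a \<longleftrightarrow> (\<exists>U F. a \<in> U \<and> open U \<and> finite F \<and> (\<forall>f\<in>F. line_holo_on f U) \<and>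
     X \<inter> U = {z \<in> U. \<forall>f\<in>F. f z = 0})"

lemma line_analytic_at_cong:
  assumes "line_analytic_at X a" "open W" "a \<in> W" "X \<inter> W = Y \<inter> W"
  shows "line_analytic_at Y a"
proof -
  obtain U F where U: "a \<in> U" "open U" "finite F" "\<forall>f\<in>F. line_holo_on f U"
    "X \<inter> U = {z \<in> U. \<forall>f\<in>F. f z = 0}"
    using assms unfolding line_analytic_at_def by blast
  have "line_holo_on f (U \<inter> W)" if "f \<in> F" for f
    by (rule line_holo_on_subset[of f U]) (use U that assms in auto)
  moreover have "Y \<inter> (U \<inter> W) = {z \<in> U \<inter> W. \<forall>f\<in>F. f z = 0}"
    using U(5) assms(4) by blast
  ultimately show ?thesis
    unfolding line_analytic_at_def using U(1-3) assms(2,3) by (intro exI[of _ "U \<inter> W"] exI[of _ F]) (simp add: open_Int)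
qed

lemma line_analytic_at_empty: "line_analytic_at {} a"
  unfolding line_analytic_at_def
  by (intro exI[of _ UNIV] exI[of _ "{\<lambda>_. 1}"]) (simp add: line_holo_on_const)

lemma line_analytic_at_Un:
  assumes "line_analytic_at X a" "line_analytic_at Y a" shows "line_analytic_at (X \<union> Y) a"
proof -
  obtain U F where U: "a \<in> U" "open U" "finite F" "\<forall>f\<in>F. line_holo_on f U"
    "X \<inter> U = {z \<in> U. \<forall>f\<in>F. f z = 0}"
    using assms unfolding line_analytic_at_def by blast
  obtain V H where V: "a \<in> V" "open V" "finite H" "\<forall>f\<in>H. line_holo_on f V"
    "Y \<inter> V = {z \<in> V. \<forall>f\<in>H. f z = 0}"
    using assms unfolding line_analytic_at_def by blast
  define K where "K = (\<lambda>(f, h) z. f z * h z) ` (F \<times> H)"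
  have "line_holo_on k (U \<inter> V)" if k: "k \<in> K" for k
  proof -
    obtain f h where "f \<in> F" "h \<in> H" "k = (\<lambda>z. f z * h z)" using k by (auto simp: K_def)
    moreover have "line_holo_on f (U \<inter> V)" "line_holo_on h (U \<inter> V)"
      using U V calculation by (auto intro: line_holo_on_subset)
    ultimately show ?thesis by (simp add: line_holo_on_mult)
  qed
  moreover have "(X \<union> Y) \<inter> (U \<inter> V) = {z \<in> U \<inter> V. \<forall>k\<in>K. k z = 0}"
  proof (rule set_eqI, rule iffI)
    fix z assume z: "z \<in> (X \<union> Y) \<inter> (U \<inter> V)"
    then have "(\<forall>f\<in>F. f z = 0) \<or> (\<forall>h\<in>H. h z = 0)" using U(5) V(5) by blast
    then show "z \<in> {z \<in> U \<inter> V. \<forall>k\<in>K. k z = 0}" using z by (auto simp: K_def)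
  next
    fix z assume z: "z \<in> {z \<in> U \<inter> V. \<forall>k\<in>K. k z = 0}"
    then have "\<forall>f\<in>F. \<forall>h\<in>H. f z * h z = 0" by (auto simp: K_def)
    then have "(\<forall>f\<in>F. f z = 0) \<or> (\<forall>h\<in>H. h z = 0)" by (meson mult_eq_0_iff)
    then show "z \<in> (X \<union> Y) \<inter> (U \<inter> V)" using U(5) V(5) z by blast
  qed
  moreover have "finite K" using U V by (simp add: K_def)
  ultimately show ?thesis
    unfolding line_analytic_at_def using U(1,2) V(1,2) by (intro exI[of _ "U \<inter> V"] exI[of _ K]) (simp add: open_Int)
qed

lemma line_analytic_at_finite_UN:
  assumes "finite S" "\<And>s. s \<in> S \<Longrightarrow> line_analytic_at (A s) a"
  shows "line_analytic_at (\<Union>s\<in>S. A s) a"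
  using assms
proof (induction S)
  case empty
  then show ?case using line_analytic_at_empty by simp
next
  case (insert s S)
  have "line_analytic_at (A s \<union> (\<Union>s\<in>S. A s)) a"
    by (intro line_analytic_at_Un insert.IH insert.prems) auto
  then show ?case by (simp only: UN_insert)
qed

lemma line_analytic_closed:
  assumes "\<And>a. line_analytic_at X a" shows "closed X"
  unfolding closed_def open_subopen[of "- X"]
proof
  fix a assume a: "a \<in> - X"
  obtain U F where U: "a \<in> U" "open U" "finite F" "\<forall>f\<in>F. line_holo_on f U"
    "X \<inter> U = {z \<in> U. \<forall>f\<in>F. f z = 0}"
    using assms[of a] unfolding line_analytic_at_def by blast
  then obtain f where f: "f \<in> F" "f a \<noteq> 0" using a by blast
  have "open {z \<in> U. f z \<noteq> 0}" by (rule line_holo_on_open_nonzero) (use U f in blast)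
  moreover have "{z \<in> U. f z \<noteq> 0} \<subseteq> - X" using U(5) f by blast
  ultimately show "\<exists>T. open T \<and> a \<in> T \<and> T \<subseteq> - X" using f U(1) by blast
qed

text \<open>Properness over the base, locally, of the projection that forgets coordinate
  \<open>i\<close>.\<close>

definition dir_bounded :: "(complex^'n) set \<Rightarrow> 'n \<Rightarrow> bool" where
  "dir_bounded A i \<longleftrightarrow> (\<forall>a. \<exists>\<delta>>0. \<exists>B. \<forall>z\<in>cyl a (-{i}) \<delta>. \<forall>t. cupd z i t \<in> A \<longrightarrow> norm t \<le> B)"

text \<open>The fibre is a bounded closed analytic subset of a complex line. If it were infinite,
  its limit points would form a nonempty set that is closed, and open by the identity theorem, hence
  the whole line, against boundedness.\<close>

lemma dir_fibre_finite:
  assumes an: "\<And>a. line_analytic_at A a" and "dir_bounded A i"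
  shows "finite {t. cupd a i t \<in> A}" (is "finite ?T")
proof (rule ccontr)
  assume inf: "infinite ?T"
  obtain \<delta> B where B: "\<delta> > 0" "\<forall>z\<in>cyl a (-{i}) \<delta>. \<forall>t. cupd z i t \<in> A \<longrightarrow> norm t \<le> B"
    using assms(2) unfolding dir_bounded_def by meson
  have bd: "?T \<subseteq> cball 0 B" using B centre_in_cyl[OF B(1), of a "-{i}"] by auto
  have cl: "closed ?T"
  proof -
    have "open {t. cupd a i t \<in> - A}"
      by (rule open_cupd_preimage) (use line_analytic_closed[OF an] in auto)
    moreover have "{t. cupd a i t \<in> - A} = - ?T" by auto
    ultimately show ?thesis by (simp add: closed_def)
  qed
  define Q where "Q = {t. t islimpt ?T}"
  have "Q \<subseteq> ?T" using cl unfolding Q_def closed_limpt by blast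
  obtain t0 where "t0 islimpt ?T"
    using inf bd Heine_Borel_imp_Bolzano_Weierstrass[of "cball 0 B" ?T] by (metis compact_cball)
  then have ne: "Q \<noteq> {}" by (auto simp: Q_def)
  have "open Q"
    unfolding open_subopen[of Q]
  proof
    fix t assume t: "t \<in> Q"
    obtain U F where U: "cupd a i t \<in> U" "open U" "finite F" "\<forall>f\<in>F. line_holo_on f U"
      "A \<inter> U = {z \<in> U. \<forall>f\<in>F. f z = 0}"
      using an[of "cupd a i t"] unfolding line_analytic_at_def by blast
    have "open {s. cupd a i s \<in> U}" by (rule open_cupd_preimage) fact
    then obtain r where r: "r > 0" "ball t r \<subseteq> {s. cupd a i s \<in> U}"
      using U(1) open_contains_ball by blast
    have lim: "t islimpt (?T \<inter> ball t r)"
      unfolding islimpt_approachable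
    proof (intro allI impI)
      fix e :: real assume "e > 0"
      then obtain s where "s \<in> ?T" "s \<noteq> t" "dist s t < min e r"
        using t r(1) unfolding Q_def islimpt_approachable mem_Collect_eq
        by (metis (mono_tags, lifting) mem_Collect_eq min_less_iff_conj)
      then show "\<exists>s\<in>?T \<inter> ball t r. s \<noteq> t \<and> dist s t < e" by (auto simp: dist_commute)
    qed
    have "f (cupd a i s) = 0" if f: "f \<in> F" and s: "s \<in> ball t r" for f s
    proof (rule analytic_continuation[where f="\<lambda>s. f (cupd a i s)" and S="ball t r" and U="?T \<inter> ball t r" and \<xi>=t])
      show "(\<lambda>s. f (cupd a i s)) holomorphic_on ball t r"
        by (rule holomorphic_on_subset[OF holomorphic_on_cupd r(2)]) (use U f in blast)
      show "f (cupd a i s) = 0" if "s \<in> ?T \<inter> ball t r" for s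
        using that U(5) f r(2) by blast
    qed (use r s lim in auto)
    then have "ball t r \<subseteq> ?T" using U(5) r(2) by blast
    moreover have "x islimpt ball t r" if "x \<in> ball t r" for x
      using that interior_limit_point[of x "ball t r"] interior_open[OF open_ball] by simp
    ultimately have "ball t r \<subseteq> Q"
      unfolding Q_def using islimpt_subset by blast
    then show "\<exists>T. open T \<and> t \<in> T \<and> T \<subseteq> Q" using r(1) by (intro exI[of _ "ball t r"]) auto
  qed
  moreover have "closed Q" unfolding Q_def by (rule closed_limpts)
  ultimately have "Q = UNIV" using ne clopen[of Q] by blast
  then have "of_real (\<bar>B\<bar> + 1) \<in> cball (0::complex) B" using \<open>Q \<subseteq> ?T\<close> bd by blast
  then show False by (simp add: abs_if split: if_splits)
qed

text \<open>Over points near \<open>a\<close> the forgotten coordinate stays in a fixed compact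
  disc, and on the part of this disc outside \<open>V\<close> the tube lemma keeps the points away
  from \<open>A\<close>.\<close>

lemma dir_fibre_stable:
  assumes "closed A" "dir_bounded A i" "open V" "{t. cupd a i t \<in> A} \<subseteq> V"
  shows "\<exists>\<delta>>0. \<forall>z\<in>cyl a (-{i}) \<delta>. {t. cupd z i t \<in> A} \<subseteq> V"
proof -
  obtain \<delta>0 B where B: "\<delta>0 > 0" "\<forall>z\<in>cyl a (-{i}) \<delta>0. \<forall>t. cupd z i t \<in> A \<longrightarrow> norm t \<le> B"
    using assms(2) unfolding dir_bounded_def by meson
  have "\<exists>\<delta>>0. \<forall>z\<in>cyl a (-{i}) \<delta>. \<forall>t\<in>cball 0 B - V. cupd z i t \<in> - A"
    by (rule cupd_tube) (use assms in \<open>auto intro: compact_diff\<close>)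
  then obtain \<delta>1 where \<delta>1: "\<delta>1 > 0" "\<forall>z\<in>cyl a (-{i}) \<delta>1. \<forall>t\<in>cball 0 B - V. cupd z i t \<in> - A"
    by blast
  have "{t. cupd z i t \<in> A} \<subseteq> V" if "z \<in> cyl a (-{i}) (min \<delta>0 \<delta>1)" for z
  proof
    fix t assume t: "t \<in> {t. cupd z i t \<in> A}"
    have z: "z \<in> cyl a (-{i}) \<delta>0" "z \<in> cyl a (-{i}) \<delta>1"
      using that cyl_mono[of "min \<delta>0 \<delta>1" _ a "-{i}"] by (meson min.cobounded1 min.cobounded2 subsetD)+
    have "t \<in> cball 0 B" using B(2) z(1) t by simp
    then show "t \<in> V" using \<delta>1(2) z(2) t by blast
  qed
  then show ?thesis using B(1) \<delta>1(1) by (intro exI[of _ "min \<delta>0 \<delta>1"]) auto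
qed

text \<open>Since \<open>f\<close> does not vanish identically on the line, a small circle around
  \<open>t0\<close> avoids its zeros; two tube arguments preserve the domain and the nonvanishing
  for nearby base points.\<close>

lemma window_exists:
  assumes f: "line_holo_on f U" and r: "ball t0 r \<subseteq> {t. cupd a i t \<in> U}"
    and \<beta>: "\<beta> \<in> ball t0 r" "f (cupd a i \<beta>) \<noteq> 0" and "\<epsilon> > 0"
  shows "\<exists>\<rho> \<delta>. 0 < \<rho> \<and> \<rho> < \<epsilon> \<and> 0 < \<delta> \<and> zero_window f U i t0 \<rho> (cyl a (-{i}) \<delta>)"
proof -
  have "r > 0" using \<beta>(1) by (metis ball_eq_empty empty_iff not_less)
  have H: "(\<lambda>t. f (cupd a i t)) holomorphic_on ball t0 r"
    by (rule holomorphic_on_subset[OF holomorphic_on_cupd[OF f] r])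
  obtain \<rho> where \<rho>: "0 < \<rho>" "\<rho> < \<epsilon>" "cball t0 \<rho> \<subseteq> ball t0 r"
      "\<forall>t\<in>cball t0 \<rho> - {t0}. f (cupd a i t) \<noteq> 0"
    using nonzero_punctured_disc[OF H open_ball connected_ball _ \<beta> \<open>\<epsilon> > 0\<close>, of t0] \<open>r > 0\<close> by auto
  have "\<exists>\<delta>>0. \<forall>z\<in>cyl a (-{i}) \<delta>. \<forall>t\<in>cball t0 \<rho>. cupd z i t \<in> U"
    by (rule cupd_tube[OF line_holo_on_open[OF f] compact_cball]) (use \<rho>(3) r in blast)
  then obtain \<delta>1 where \<delta>1: "\<delta>1 > 0" "\<forall>z\<in>cyl a (-{i}) \<delta>1. \<forall>t\<in>cball t0 \<rho>. cupd z i t \<in> U" by blast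
  have "\<exists>\<delta>>0. \<forall>z\<in>cyl a (-{i}) \<delta>. \<forall>t\<in>sphere t0 \<rho>. cupd z i t \<in> {x \<in> U. f x \<noteq> 0}"
  proof (rule cupd_tube[OF line_holo_on_open_nonzero[OF f] compact_sphere])
    fix t assume "t \<in> sphere t0 \<rho>"
    then have "t \<in> cball t0 \<rho> - {t0}" using \<rho>(1) by auto
    then show "cupd a i t \<in> {x \<in> U. f x \<noteq> 0}" using \<rho>(3,4) r by blast
  qed
  then obtain \<delta>2 where \<delta>2: "\<delta>2 > 0" "\<forall>z\<in>cyl a (-{i}) \<delta>2. \<forall>t\<in>sphere t0 \<rho>. cupd z i t \<in> {x \<in> U. f x \<noteq> 0}"
    by blast
  have sub: "cyl a (-{i}) (min \<delta>1 \<delta>2) \<subseteq> cyl a (-{i}) \<delta>1" "cyl a (-{i}) (min \<delta>1 \<delta>2) \<subseteq> cyl a (-{i}) \<delta>2"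
    by (simp_all add: cyl_mono)
  have "zero_window f U i t0 \<rho> (cyl a (-{i}) (min \<delta>1 \<delta>2))"
  proof
    show "cupd z i t \<in> U" if "z \<in> cyl a (-{i}) (min \<delta>1 \<delta>2)" "t \<in> cball t0 \<rho>" for z t
      using \<delta>1(2) sub(1) that by blast
    show "f (cupd z i t) \<noteq> 0" if "z \<in> cyl a (-{i}) (min \<delta>1 \<delta>2)" "t \<in> sphere t0 \<rho>" for z t
      using \<delta>2(2) sub(2) that by blast
  qed (use f \<rho>(1) open_cyl convex_cyl in auto)
  then show ?thesis using \<rho>(1,2) \<delta>1(1) \<delta>2(1) by (intro exI[of _ \<rho>] exI[of _ "min \<delta>1 \<delta>2"]) auto
qed

text \<open>The fibre is finite and a disc is not, so some nearby point of the line lies outside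
  \<open>A\<close>. A defining function that is nonzero there has isolated zeros on the line and can
  define a window.\<close>

lemma analytic_window_exists:
  assumes an: "\<And>a. line_analytic_at A a" and bd: "dir_bounded A i" and t0: "cupd a i t0 \<in> A" and "\<epsilon> > 0"
  shows "\<exists>\<rho> \<delta> U F f. 0 < \<rho> \<and> \<rho> < \<epsilon> \<and> 0 < \<delta> \<and> finite F \<and> (\<forall>f\<in>F. line_holo_on f U) \<and> f \<in> F \<and>
    A \<inter> U = {z \<in> U. \<forall>f\<in>F. f z = 0} \<and> zero_window f U i t0 \<rho> (cyl a (-{i}) \<delta>)"
proof -
  obtain U F where U: "cupd a i t0 \<in> U" "open U" "finite F" "\<forall>f\<in>F. line_holo_on f U"
    "A \<inter> U = {z \<in> U. \<forall>f\<in>F. f z = 0}"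
    using an[of "cupd a i t0"] unfolding line_analytic_at_def by blast
  have "open {s. cupd a i s \<in> U}" by (rule open_cupd_preimage) fact
  then obtain r where r: "r > 0" "ball t0 r \<subseteq> {s. cupd a i s \<in> U}"
    using U(1) open_contains_ball by blast
  have "infinite (ball t0 r)"
    using r(1) uncountable_ball uncountable_infinite by blast
  then have "infinite (ball t0 r - {t. cupd a i t \<in> A})"
    using dir_fibre_finite[OF an bd] by (rule Diff_infinite_finite[rotated])
  from infinite_imp_nonempty[OF this] obtain \<beta> where \<beta>: "\<beta> \<in> ball t0 r" "cupd a i \<beta> \<notin> A"
    by blast
  then have "cupd a i \<beta> \<in> U" using r(2) by blast
  then obtain f where f: "f \<in> F" "f (cupd a i \<beta>) \<noteq> 0" using U(5) \<beta>(2) by blast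
  have "line_holo_on f U" using U(4) f(1) by blast
  from window_exists[OF this r(2) \<beta>(1) f(2) \<open>\<epsilon> > 0\<close>] obtain \<rho> \<delta> where
    "0 < \<rho>" "\<rho> < \<epsilon>" "0 < \<delta>" "zero_window f U i t0 \<rho> (cyl a (-{i}) \<delta>)" by blast
  then show ?thesis
    using U(3-5) f(1)
    by (intro exI[of _ \<rho>] exI[of _ \<delta>] exI[of _ U] exI[of _ F] exI[of _ f] conjI)
qed

section \<open>Images of analytic sets under forgetting one coordinate\<close>

lemma line_holo_on_Poly:
  assumes "open U" "\<And>h. h \<in> set hs \<Longrightarrow> line_holo_on h U"
  shows "line_holo_on (\<lambda>x. poly (Poly (map (\<lambda>h. h x) hs)) c) U"
  using assms by (induction hs) (simp_all add: line_holo_on_const line_holo_on_add line_holo_on_mult)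

text \<open>The resultants of \<open>F\<close> with sufficiently many linear combinations of the functions in \<open>H\<close> cut out
  the projection of their common zero set.\<close>

lemma (in zero_window) line_analytic_at_projection:
  assumes fin: "finite H" and H: "\<And>h. h \<in> H \<Longrightarrow> line_holo_on h U" and a: "a \<in> G"
  shows "line_analytic_at {z \<in> G. \<exists>t\<in>zeros z. \<forall>h\<in>H. h (cupd z i t) = 0} a"
proof -
  obtain n where n: "\<And>z. z \<in> G \<Longrightarrow> (\<Sum>t\<in>zeros z. mult z t) = n"
    using number_of_zeros_constant by blast
  obtain hs where hs: "set hs = H" using fin finite_list by blast
  define k where "k = length hs"
  \<comment> \<open>Evaluating \<open>p x\<close> at \<open>c\<close> gives the combination of the
    functions in \<open>H\<close> with coefficients 1, c, c^2, ...; it is the zero polynomial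
    exactly when all of them vanish at \<open>x\<close>.\<close>
  define p where "p x = Poly (map (\<lambda>h. h x) hs)" for x
  define N where "N c z = (\<Prod>t\<in>zeros z. poly (p (cupd z i t)) c ^ mult z t)" for c z
  have "line_holo_on (N c) G" for c
  proof -
    have "line_holo_on (\<lambda>z. N c z) G"
      unfolding N_def p_def
      by (rule line_holo_on_weighted_prod[where g="\<lambda>x. poly (Poly (map (\<lambda>h. h x) hs)) c"])
        (rule line_holo_on_Poly[OF line_holo_on_open[OF F]], use H hs in blast)
    then show ?thesis by simp
  qed
  \<comment> \<open>Each of the at most \<open>n\<close> zeros, if its polynomial is nonzero, makes
    \<open>N c z\<close> vanish for at most \<open>k\<close> values of \<open>c\<close>; hence
    \<open>n * k + 1\<close> values suffice.\<close>
  moreover have "(\<exists>t\<in>zeros z. \<forall>h\<in>H. h (cupd z i t) = 0) \<longleftrightarrow> (\<forall>c\<in>of_nat ` {..n * k}. N c z = 0)"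
    if z: "z \<in> G" for z
  proof
    assume "\<exists>t\<in>zeros z. \<forall>h\<in>H. h (cupd z i t) = 0"
    then obtain t where t: "t \<in> zeros z" "\<forall>h\<in>H. h (cupd z i t) = 0" by blast
    have "p (cupd z i t) = 0"
    proof (rule poly_eqI)
      fix m
      show "coeff (p (cupd z i t)) m = coeff 0 m"
        using t(2) hs nth_mem[of m hs] by (auto simp: p_def coeff_Poly_eq nth_default_def)
    qed
    then have "poly (p (cupd z i t)) c ^ mult z t = 0" for c
      using mult_pos[OF z t(1)] by simp
    then show "\<forall>c\<in>of_nat ` {..n * k}. N c z = 0"
      unfolding N_def using finite_zeros[OF z] t(1) by (meson prod_zero)
  next
    assume all: "\<forall>c\<in>of_nat ` {..n * k}. N c z = 0"
    show "\<exists>t\<in>zeros z. \<forall>h\<in>H. h (cupd z i t) = 0"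
    proof (rule ccontr)
      assume neg: "\<not> (\<exists>t\<in>zeros z. \<forall>h\<in>H. h (cupd z i t) = 0)"
      have nz: "p (cupd z i t) \<noteq> 0" if t: "t \<in> zeros z" for t
      proof -
        obtain h where h: "h \<in> set hs" "h (cupd z i t) \<noteq> 0" using neg t hs by blast
        then obtain l where "l < length hs" "hs ! l = h" by (auto simp: in_set_conv_nth)
        then have "coeff (p (cupd z i t)) l \<noteq> 0"
          using h by (simp add: p_def coeff_Poly_eq nth_default_def)
        then show ?thesis by auto
      qed
      define R where "R = (\<Union>t\<in>zeros z. {c. poly (p (cupd z i t)) c = 0})"
      have cardR: "card {c. poly (p (cupd z i t)) c = 0} \<le> k" if "t \<in> zeros z" for t
      proof -
        have "card {c. poly (p (cupd z i t)) c = 0} \<le> degree (p (cupd z i t))"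
          by (rule card_poly_roots_bound[OF nz[OF that]])
        also have "\<dots> \<le> k" using degree_Poly[of "map (\<lambda>h. h (cupd z i t)) hs"] by (simp add: p_def k_def)
        finally show ?thesis .
      qed
      have "card R \<le> (\<Sum>t\<in>zeros z. card {c. poly (p (cupd z i t)) c = 0})"
        unfolding R_def by (rule card_UN_le[OF finite_zeros[OF z]])
      also have "\<dots> \<le> (\<Sum>t\<in>zeros z. k)" by (rule sum_mono) (rule cardR)
      also have "\<dots> \<le> n * k" using card_zeros_le[OF z] n[OF z] by simp
      finally have "card R \<le> n * k" .
      moreover have "finite R" unfolding R_def
        using finite_zeros[OF z] nz poly_roots_finite by blast
      moreover have "(of_nat ` {..n * k} :: complex set) \<subseteq> R"
      proof
        fix c :: complex assume "c \<in> of_nat ` {..n * k}"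
        then have "N c z = 0" using all by blast
        then obtain t where "t \<in> zeros z" "poly (p (cupd z i t)) c ^ mult z t = 0"
          unfolding N_def using finite_zeros[OF z] by (meson prod_zero_iff)
        then show "c \<in> R" unfolding R_def by auto
      qed
      ultimately have "card (of_nat ` {..n * k} :: complex set) \<le> n * k"
        using card_mono by (metis le_trans)
      moreover have "card (of_nat ` {..n * k} :: complex set) = n * k + 1"
        by (subst card_image) (auto simp: inj_on_def)
      ultimately show False by simp
    qed
  qed
  ultimately show ?thesis
    unfolding line_analytic_at_def using a open_G
    by (intro exI[of _ G] exI[of _ "N ` of_nat ` {..n * k}"]) auto
qed

text \<open>Cover the finite fibre over \<open>a\<close> by windows. Since nearby fibres stay in the
  union of the discs, the projection is near \<open>a\<close> the finite union of the projections of
  the windows.\<close>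

theorem line_analytic_projection:
  assumes an: "\<And>a. line_analytic_at A a" and bd: "dir_bounded A i"
  shows "line_analytic_at {z. \<exists>t. cupd z i t \<in> A} a"
proof -
  let ?T = "{t. cupd a i t \<in> A}"
  have fin: "finite ?T" by (rule dir_fibre_finite[OF an bd])
  have "\<forall>t\<in>?T. \<exists>\<rho> \<delta>. 0 < \<rho> \<and> 0 < \<delta> \<and>
    line_analytic_at {z \<in> cyl a (-{i}) \<delta>. \<exists>s\<in>ball t \<rho>. cupd z i s \<in> A} a"
  proof
    fix t assume "t \<in> ?T"
    then have "cupd a i t \<in> A" by simp
    from analytic_window_exists[OF an bd this zero_less_one] obtain \<rho> \<delta> U F f where
      w: "0 < \<rho>" "0 < \<delta>" "finite F" "\<forall>f\<in>F. line_holo_on f U" "f \<in> F"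
      "A \<inter> U = {z \<in> U. \<forall>f\<in>F. f z = 0}" "zero_window f U i t \<rho> (cyl a (-{i}) \<delta>)"
      by blast
    interpret zero_window f U i t \<rho> "cyl a (-{i}) \<delta>" by fact
    have "{z \<in> cyl a (-{i}) \<delta>. \<exists>s\<in>zeros z. \<forall>h\<in>F. h (cupd z i s) = 0} =
        {z \<in> cyl a (-{i}) \<delta>. \<exists>s\<in>ball t \<rho>. cupd z i s \<in> A}" (is "?L = ?R")
    proof (rule set_eqI, rule iffI)
      fix z assume "z \<in> ?L"
      then obtain s where s: "z \<in> cyl a (-{i}) \<delta>" "s \<in> zeros z" "\<forall>h\<in>F. h (cupd z i s) = 0" by blast
      have sb: "s \<in> ball t \<rho>" using s(2) by (simp add: zeros_def)
      then have "cupd z i s \<in> U" using in_U[OF s(1), of s] by simp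
      then have "cupd z i s \<in> A" using w(6) s(3) by blast
      then show "z \<in> ?R" using s(1) sb by blast
    next
      fix z assume "z \<in> ?R"
      then obtain s where s: "z \<in> cyl a (-{i}) \<delta>" "s \<in> ball t \<rho>" "cupd z i s \<in> A" by blast
      have "cupd z i s \<in> U" using in_U[OF s(1), of s] s(2) by simp
      then have all: "\<forall>h\<in>F. h (cupd z i s) = 0" using w(6) s(3) by blast
      then have "s \<in> zeros z" using w(5) s(2) by (simp add: zeros_def)
      then show "z \<in> ?L" using s(1) all by blast
    qed
    moreover have "line_analytic_at ?L a"
      by (rule line_analytic_at_projection) (use w(2-4) centre_in_cyl in auto)
    ultimately have "line_analytic_at ?R a" by simp
    then show "\<exists>\<rho> \<delta>. 0 < \<rho> \<and> 0 < \<delta> \<and>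
        line_analytic_at {z \<in> cyl a (-{i}) \<delta>. \<exists>s\<in>ball t \<rho>. cupd z i s \<in> A} a"
      using w(1,2) by (intro exI[of _ \<rho>] exI[of _ \<delta>] conjI)
  qed
  from bchoice[OF this] obtain \<rho> where
    "\<forall>t\<in>?T. \<exists>\<delta>. 0 < \<rho> t \<and> 0 < \<delta> \<and>
      line_analytic_at {z \<in> cyl a (-{i}) \<delta>. \<exists>s\<in>ball t (\<rho> t). cupd z i s \<in> A} a" by blast
  from bchoice[OF this] obtain \<delta> where
    w': "\<forall>t\<in>?T. 0 < \<rho> t \<and> 0 < \<delta> t \<and>
      line_analytic_at {z \<in> cyl a (-{i}) (\<delta> t). \<exists>s\<in>ball t (\<rho> t). cupd z i s \<in> A} a" by blast
  have w: "\<And>t. t \<in> ?T \<Longrightarrow> 0 < \<rho> t" "\<And>t. t \<in> ?T \<Longrightarrow> 0 < \<delta> t"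
    "\<And>t. t \<in> ?T \<Longrightarrow> line_analytic_at {z \<in> cyl a (-{i}) (\<delta> t). \<exists>s\<in>ball t (\<rho> t). cupd z i s \<in> A} a"
    using bspec[OF w'] by simp_all
  let ?B = "\<lambda>t. {z \<in> cyl a (-{i}) (\<delta> t). \<exists>s\<in>ball t (\<rho> t). cupd z i s \<in> A}"
  have oV: "open (\<Union>t\<in>?T. ball t (\<rho> t))" by (intro open_UN ballI open_ball)
  have "?T \<subseteq> (\<Union>t\<in>?T. ball t (\<rho> t))" using w(1) by force
  from dir_fibre_stable[OF line_analytic_closed[OF an] bd oV this] obtain \<delta>0 where
    \<delta>0: "\<delta>0 > 0" "\<forall>z\<in>cyl a (-{i}) \<delta>0. {t. cupd z i t \<in> A} \<subseteq> (\<Union>t\<in>?T. ball t (\<rho> t))"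
    by blast
  define W where "W = cyl a (-{i}) \<delta>0 \<inter> (\<Inter>t\<in>?T. cyl a (-{i}) (\<delta> t))"
  have "open W" unfolding W_def by (intro open_Int open_INT fin open_cyl ballI)
  moreover have "a \<in> W" unfolding W_def using \<delta>0(1) w(2) centre_in_cyl by blast
  moreover have "line_analytic_at (\<Union>t\<in>?T. ?B t) a"
    by (rule line_analytic_at_finite_UN[OF fin]) (rule w(3))
  moreover have "(\<Union>t\<in>?T. ?B t) \<inter> W = {z. \<exists>t. cupd z i t \<in> A} \<inter> W"
  proof (rule set_eqI, rule iffI)
    fix z assume "z \<in> {z. \<exists>t. cupd z i t \<in> A} \<inter> W"
    then obtain s where s: "cupd z i s \<in> A" and z: "z \<in> W" by blast
    have "z \<in> cyl a (-{i}) \<delta>0" using z by (simp add: W_def)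
    then obtain t where t: "t \<in> ?T" "s \<in> ball t (\<rho> t)" using \<delta>0(2) s by blast
    have "z \<in> cyl a (-{i}) (\<delta> t)" using z t(1) unfolding W_def by blast
    then show "z \<in> (\<Union>t\<in>?T. ?B t) \<inter> W" using t s z by blast
  qed blast
  ultimately show ?thesis by (elim line_analytic_at_cong[rotated 3])
qed

section \<open>Polynomial growth\<close>

definition poly_fun :: "(complex^'n \<Rightarrow> complex) \<Rightarrow> bool" where
  "poly_fun f \<longleftrightarrow> (\<exists>p. \<forall>z. f z = eval_poly p z)"

lemma eval_poly_superset:
  fixes p :: "('n::finite \<Rightarrow>\<^sub>0 nat) \<Rightarrow>\<^sub>0 complex"
  assumes "finite S" "Poly_Mapping.keys p \<subseteq> S"
  shows "eval_poly p z = (\<Sum>m\<in>S. Poly_Mapping.lookup p m * (\<Prod>i\<in>UNIV. (z $ i) ^ Poly_Mapping.lookup m i))"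
  unfolding eval_poly_def
  by (rule sum.mono_neutral_left[OF assms]) (simp add: in_keys_iff)

lemma poly_fun_monomial:
  "poly_fun (\<lambda>z :: complex^'n. c * (\<Prod>i\<in>UNIV. (z $ i) ^ Poly_Mapping.lookup m i))"
  unfolding poly_fun_def
  by (intro exI[of _ "Poly_Mapping.single m c"]) (simp add: eval_poly_def lookup_single)

lemma poly_fun_const: "poly_fun (\<lambda>z. c)"
  using poly_fun_monomial[of c 0] by simp

lemma poly_fun_nth: "poly_fun (\<lambda>z. z $ k)"
proof -
  have "(\<Prod>i\<in>UNIV. (z $ i) ^ Poly_Mapping.lookup (Poly_Mapping.single k 1) i) = z $ k" for z :: "complex^'a"
  proof -
    have "(\<Prod>i\<in>UNIV. (z $ i) ^ Poly_Mapping.lookup (Poly_Mapping.single k 1) i) = (\<Prod>i\<in>UNIV. if i = k then z $ k else 1)"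
      by (rule prod.cong) (auto simp: lookup_single when_def)
    then show ?thesis by simp
  qed
  then show ?thesis using poly_fun_monomial[of 1 "Poly_Mapping.single k 1"] by simp
qed

lemma poly_fun_add:
  assumes "poly_fun f" "poly_fun g" shows "poly_fun (\<lambda>z. f z + g z)"
proof -
  obtain p q where pq: "\<And>z. f z = eval_poly p z" "\<And>z. g z = eval_poly q z"
    using assms unfolding poly_fun_def by blast
  let ?S = "Poly_Mapping.keys p \<union> Poly_Mapping.keys q"
  have "f z + g z = eval_poly (p + q) z" for z
  proof -
    have "eval_poly (p + q) z = (\<Sum>m\<in>?S. Poly_Mapping.lookup (p + q) m * (\<Prod>i\<in>UNIV. (z $ i) ^ Poly_Mapping.lookup m i))"
      by (rule eval_poly_superset) (simp, rule Poly_Mapping.keys_add)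
    also have "\<dots> = eval_poly p z + eval_poly q z"
      by (simp add: lookup_add distrib_right sum.distrib eval_poly_superset[of ?S p] eval_poly_superset[of ?S q])
    finally show ?thesis by (simp add: pq)
  qed
  then show ?thesis unfolding poly_fun_def by blast
qed

lemma poly_fun_sum:
  assumes "\<And>s. s \<in> S \<Longrightarrow> poly_fun (f s)" shows "poly_fun (\<lambda>z. \<Sum>s\<in>S. f s z)"
  using assms
proof (induction S rule: infinite_finite_induct)
  case (insert s S)
  then show ?case by (simp add: poly_fun_add)
qed (simp_all add: poly_fun_const)

lemma poly_fun_mult:
  fixes f g :: "complex^'n \<Rightarrow> complex"
  assumes "poly_fun f" "poly_fun g" shows "poly_fun (\<lambda>z. f z * g z)"
proof -
  obtain p q where pq: "\<And>z. f z = eval_poly p z" "\<And>z. g z = eval_poly q z"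
    using assms unfolding poly_fun_def by blast
  let ?m = "\<lambda>m (z::complex^'n). \<Prod>i\<in>UNIV. (z $ i) ^ Poly_Mapping.lookup m i"
  have "f z * g z = (\<Sum>m\<in>Poly_Mapping.keys p. \<Sum>m'\<in>Poly_Mapping.keys q.
      (Poly_Mapping.lookup p m * Poly_Mapping.lookup q m') * ?m (m + m') z)" for z
    unfolding pq eval_poly_def sum_product
    by (intro sum.cong refl) (simp add: lookup_add power_add prod.distrib mult_ac)
  then show ?thesis
    by (simp only:) (intro poly_fun_sum poly_fun_monomial)
qed

lemma poly_fun_prod:
  assumes "\<And>s. s \<in> S \<Longrightarrow> poly_fun (f s)" shows "poly_fun (\<lambda>z. \<Prod>s\<in>S. f s z)"
  using assms
proof (induction S rule: infinite_finite_induct)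
  case (insert s S)
  then show ?case by (simp add: poly_fun_mult)
qed (simp_all add: poly_fun_const)

lemma poly_fun_compose:
  fixes A :: "complex^'m \<Rightarrow> complex^'n"
  assumes "poly_fun f" "\<And>k. poly_fun (\<lambda>z. A z $ k)" shows "poly_fun (\<lambda>z. f (A z))"
proof -
  obtain p where p: "\<And>z. f z = eval_poly p z" using assms unfolding poly_fun_def by blast
  have pw: "poly_fun (\<lambda>z. (A z $ k) ^ m)" for k m
    by (induction m) (auto intro: poly_fun_const poly_fun_mult assms(2))
  show ?thesis
    unfolding p eval_poly_def by (intro poly_fun_sum poly_fun_mult poly_fun_prod poly_fun_const pw)
qed

section \<open>Entire functions of polynomial growth\<close>

lemma Lagrange_interpolation:
  fixes a :: "nat \<Rightarrow> complex" and N :: nat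
  defines "p \<equiv> \<lambda>t. \<Sum>k\<le>N. a k * t ^ k"
  shows "p t = (\<Sum>j\<le>N. p (of_nat j) * (\<Prod>l\<in>{..N}-{j}. (t - of_nat l) / (of_nat j - of_nat l)))"
proof -
  define P where "P = (\<Sum>k\<le>N. monom (a k) k)"
  define L where "L j = (\<Prod>l\<in>{..N}-{j}. smult (1 / (of_nat j - of_nat l)) [:- of_nat l, 1:] :: complex poly)" for j
  define Q where "Q = (\<Sum>j\<le>N. smult (p (of_nat j)) (L j))"
  have polyP: "poly P t = p t" for t by (simp add: P_def p_def poly_sum poly_monom)
  have polyL: "poly (L j) t = (\<Prod>l\<in>{..N}-{j}. (t - of_nat l) / (of_nat j - of_nat l))" for j t
    by (simp add: L_def poly_prod diff_divide_distrib)
  have polyQ: "poly Q t = (\<Sum>j\<le>N. p (of_nat j) * poly (L j) t)" for t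
    by (simp add: Q_def poly_sum)
  have node: "poly (L j) (of_nat m) = (if m = j then 1 else 0)" if "m \<le> N" for j m
  proof (cases "m = j")
    case True
    then show ?thesis unfolding polyL by (auto intro!: prod.neutral)
  next
    case False
    then show ?thesis unfolding polyL using that by (auto intro!: prod_zero bexI[of _ m])
  qed
  have "P = Q"
  \<comment> \<open>Both polynomials have degree at most \<open>N\<close> and agree at the
    \<open>N + 1\<close> nodes.\<close>
  proof (rule poly_eqI_degree[where A="of_nat ` {..N}"])
    fix x :: complex assume "x \<in> of_nat ` {..N}"
    then obtain m where m: "x = of_nat m" "m \<le> N" by auto
    have "poly Q x = (\<Sum>j\<le>N. if m = j then p (of_nat j) else 0)"
      unfolding polyQ m(1) by (rule sum.cong) (auto simp: node[OF m(2)])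
    then show "poly P x = poly Q x" using m by (simp add: polyP)
  next
    have card: "card (of_nat ` {..N} :: complex set) = N + 1"
      by (subst card_image) (auto simp: inj_on_def)
    have "degree P \<le> N" unfolding P_def
      by (rule degree_sum_le) (auto intro: order_trans[OF degree_monom_le])
    then show "degree P < card (of_nat ` {..N} :: complex set)" unfolding card by simp
    have "degree (L j) \<le> N" if "j \<le> N" for j
    proof -
      have "degree (L j) \<le> (\<Sum>l\<in>{..N}-{j}. degree (smult (1 / (of_nat j - of_nat l)) [:- of_nat l, 1:] :: complex poly))"
        unfolding L_def by (rule degree_prod_sum_le[unfolded o_def]) simp
      also have "\<dots> \<le> (\<Sum>l\<in>{..N}-{j}. 1)" by (rule sum_mono) (simp add: order_trans[OF degree_smult_le])
      also have "\<dots> = N" using that by simp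
      finally show ?thesis .
    qed
    then have "degree Q \<le> N" unfolding Q_def
      by (intro degree_sum_le) (auto intro: order_trans[OF degree_smult_le])
    then show "degree Q < card (of_nat ` {..N} :: complex set)" unfolding card by simp
  qed
  then show ?thesis using polyP[of t] polyQ[of t] by (simp add: polyL)
qed

lemma norm_cupd_le: "norm (cupd z i t) \<le> norm z + norm t"
proof -
  have "cupd z i t = cupd z i 0 + t *s axis i 1" using cupd_shift[of z i 0 t] by simp
  then have "norm (cupd z i t) \<le> norm (cupd z i 0) + norm (t *s axis i (1::complex))"
    by (metis norm_triangle_ineq)
  moreover have "norm (cupd z i 0) \<le> norm z" by (rule norm_le_componentwise_cart) simp
  moreover have "norm (axis i (1::complex)) = 1" by (simp add: norm_eq_sqrt_inner inner_axis_axis)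
  ultimately show ?thesis by (simp add: norm_vector_scalar_mult_complex)
qed

text \<open>Induction on a set \<open>S\<close> of variables that determine \<open>f\<close>. In one
  variable Liouville gives a polynomial of degree at most \<open>N\<close>, and interpolation at 0,
  ..., \<open>N\<close> rebuilds it from values of \<open>f\<close> at fixed integers, which are
  functions of fewer variables with the same growth exponent.\<close>

lemma entire_polynomial_growth_aux:
  fixes f :: "complex^'n \<Rightarrow> complex"
  assumes "finite S" and f: "line_holo_on f UNIV" and gr: "\<And>z. norm (f z) \<le> K * (1 + norm z) ^ N"
    and dep: "\<And>z z'. (\<And>k. k \<in> S \<Longrightarrow> z $ k = z' $ k) \<Longrightarrow> f z = f z'"
  shows "poly_fun f"
  using assms
proof (induction S arbitrary: f K)
  case empty
  then have "f z = f 0" for z by blast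
  then have "f = (\<lambda>z. f 0)" by blast
  then show ?case by (metis poly_fun_const)
next
  case (insert i S)
  note gr = insert.prems(2)
  have K: "0 \<le> K" using order_trans[OF norm_ge_zero gr[of 0]] by simp
  let ?L = "\<lambda>j t. \<Prod>l\<in>{..N}-{j}. (t - of_nat l) / (of_nat j - of_nat l) :: complex"
  have eq: "f z = (\<Sum>j\<le>N. f (cupd z i (of_nat j)) * ?L j (z $ i))" for z
  proof -
    define g where "g t = f (cupd z i t)" for t
    have "g holomorphic_on UNIV" using holomorphic_on_cupd[OF insert.prems(1), of z i] by (simp add: g_def[abs_def])
    moreover have "norm (g t) \<le> (K * 2 ^ N) * norm t ^ N" if "1 + norm z \<le> norm t" for t
    proof -
      have "1 + norm (cupd z i t) \<le> 2 * norm t" using norm_cupd_le[of z i t] that by simp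
      then have "K * (1 + norm (cupd z i t)) ^ N \<le> K * (2 * norm t) ^ N"
        by (intro mult_left_mono power_mono K) auto
      then show ?thesis using gr[of "cupd z i t"] by (simp add: g_def power_mult_distrib mult.assoc)
    qed
    ultimately have eq: "g t = (\<Sum>k\<le>N. (deriv ^^ k) g 0 / fact k * t ^ k)" for t
      by (rule Liouville_polynomial)
    have "g t = (\<Sum>j\<le>N. g (of_nat j) * ?L j t)" for t
      using Lagrange_interpolation[where a="\<lambda>k. (deriv ^^ k) g 0 / fact k" and N=N and t=t] unfolding eq[symmetric] .
    from this[of "z $ i"] show ?thesis by (simp add: g_def)
  qed
  have "poly_fun (\<lambda>z. f (cupd z i (of_nat j)))" for j
  \<comment> \<open>The new constant comes from
    \<open>1 + norm z + j \<le> (1 + j) * (1 + norm z)\<close>.\<close>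
  proof (rule insert.IH[where K="K * (1 + real j) ^ N"])
    show "line_holo_on (\<lambda>z. f (cupd z i (of_nat j))) UNIV"
      by (rule line_holo_on_cupd[OF insert.prems(1)]) auto
    show "norm (f (cupd z i (of_nat j))) \<le> K * (1 + real j) ^ N * (1 + norm z) ^ N" for z
    proof -
      have "1 + norm (cupd z i (of_nat j)) \<le> 1 + norm z + real j" using norm_cupd_le[of z i "of_nat j"] by simp
      also have "\<dots> \<le> (1 + real j) * (1 + norm z)" by (simp add: algebra_simps)
      finally have "K * (1 + norm (cupd z i (of_nat j))) ^ N \<le> K * ((1 + real j) * (1 + norm z)) ^ N"
        by (intro mult_left_mono power_mono K) auto
      then show ?thesis using gr[of "cupd z i (of_nat j)"] by (simp add: power_mult_distrib mult.assoc)
    qed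
    show "f (cupd z i (of_nat j)) = f (cupd z' i (of_nat j))" if "\<And>k. k \<in> S \<Longrightarrow> z $ k = z' $ k" for z z'
      by (rule insert.prems(3)) (use that in auto)
  qed
  moreover have "poly_fun (\<lambda>z. ?L j (z $ i))" for j
  proof -
    have "poly_fun (\<lambda>z. (z $ i + - of_nat l) * (1 / (of_nat j - of_nat l)))" for l
      by (intro poly_fun_mult poly_fun_add poly_fun_nth poly_fun_const)
    then have "poly_fun (\<lambda>z. (z $ i - of_nat l) / (of_nat j - of_nat l))" for l
      by simp
    then show ?thesis by (intro poly_fun_prod)
  qed
  ultimately have "poly_fun (\<lambda>z. \<Sum>j\<le>N. f (cupd z i (of_nat j)) * ?L j (z $ i))"
    by (intro poly_fun_sum poly_fun_mult)
  then show ?case unfolding eq[symmetric] .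
qed

lemma entire_polynomial_growth:
  assumes "line_holo_on f UNIV" "\<And>z. norm (f z) \<le> K * (1 + norm z) ^ N"
  shows "poly_fun f"
  by (rule entire_polynomial_growth_aux[OF finite_class.finite_UNIV assms]) (metis UNIV_I vec_eq_iff)

section \<open>Maps with finite fibres between spaces of equal dimension\<close>

lemma dim_linear_image_less:
  fixes S :: "'a::euclidean_space \<Rightarrow> 'b::euclidean_space"
  assumes "linear S" "subspace R" "w \<in> R" "w \<noteq> 0" "S w = 0"
  shows "dim (S ` R) < dim R"
proof -
  obtain g where g: "range g \<subseteq> R" "linear g" "\<forall>v\<in>S ` R. S (g v) = v"
    using linear_exists_right_inverse_on[OF assms(1,2)] by blast
  have sub: "subspace (S ` R)" by (rule linear_subspace_image[OF assms(1,2)])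
  have sub2: "subspace (g ` S ` R)" by (rule linear_subspace_image[OF g(2) sub])
  have "inj_on g (S ` R)" using g(3) by (metis inj_onI)
  then have "dim (g ` S ` R) = dim (S ` R)"
    using dim_image_eq[OF g(2), of "S ` R"] by (simp add: span_eq_iff[THEN iffD2, OF sub])
  \<comment> \<open>If \<open>w = g v\<close> with \<open>v\<close> in the image of
    \<open>S\<close>, then \<open>v = S (g v) = S w = 0\<close>, hence \<open>w = 0\<close>.\<close>
  moreover have "w \<notin> g ` S ` R"
  proof
    assume "w \<in> g ` S ` R"
    then obtain v where v: "v \<in> S ` R" "w = g v" by blast
    then have "v = 0" using g(3) assms(5) by auto
    then show False using v(2) assms(4) linear_0[OF g(2)] by simp
  qed
  then have "g ` S ` R \<subset> R" using g(1) assms(3) by blast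
  then have "dim (g ` S ` R) < dim R"
    by (intro dim_psubset) (simp add: span_eq_iff[THEN iffD2, OF sub2] span_eq_iff[THEN iffD2, OF assms(2)])
  ultimately show ?thesis by simp
qed

text \<open>If the rank of the derivative is smaller than the dimension, then by the constant rank theorem
  the fibre through a point of maximal rank contains a curve.\<close>

theorem finite_fibres_imp_interior_image:
  fixes f :: "'a::euclidean_space \<Rightarrow> 'a" and f' :: "'a \<Rightarrow> 'a \<Rightarrow>\<^sub>L 'a"
  assumes W: "open W" "W \<noteq> {}"
    and der: "\<And>x. x \<in> W \<Longrightarrow> (f has_derivative blinfun_apply (f' x)) (at x)"
    and cont: "continuous_on W f'"
    and fin: "\<And>y. finite {x \<in> W. f x = y}"
  shows "interior (f ` W) \<noteq> {}"
proof -
  define rk where "rk x = dim (range (blinfun_apply (f' x)))" for x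
  have lin: "linear (blinfun_apply (f' x))" for x
    by (rule bounded_linear.linear[OF blinfun.bounded_linear_right])
  have "finite (rk ` W)"
    by (rule finite_subset[of _ "{..DIM('a)}"]) (auto simp: rk_def dim_subset_UNIV)
  then have "Max (rk ` W) \<in> rk ` W" using W(2) by (intro Max_in) auto
  then obtain a where a: "a \<in> W" "rk a = Max (rk ` W)" by auto
  have max: "rk x \<le> rk a" if "x \<in> W" for x
    using \<open>finite (rk ` W)\<close> that a(2) by simp
  define K where "K = {v. f' a v = 0}"
  have subK: "subspace K" unfolding K_def by (rule subspaceI) (simp_all add: blinfun.add_right blinfun.scaleR_right)
  define N where "N = orthogonal_comp K"
  have subN: "subspace N" unfolding N_def by (rule subspace_orthogonal_comp)
  have NK: "v = 0" if "v \<in> N" "v \<in> K" for v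
    using that unfolding N_def orthogonal_comp_def orthogonal_def by auto
  have decomp: "\<exists>n k. n \<in> N \<and> k \<in> K \<and> v = n + k" for v
  proof -
    have "v \<in> K + N" unfolding N_def using subspace_sum_orthogonal_comp[OF subK] by simp
    then show ?thesis by (auto simp: set_plus_def add.commute)
  qed
  have injN: "inj_on (blinfun_apply (f' a)) N"
  proof (rule inj_onI)
    fix x y assume xy: "x \<in> N" "y \<in> N" "f' a x = f' a y"
    have "x - y \<in> N" by (rule subspace_diff[OF subN xy(1,2)])
    moreover have "x - y \<in> K" using xy(3) by (simp add: K_def blinfun.diff_right)
    ultimately show "x = y" using NK by force
  qed
  \<comment> \<open>\<open>S\<close> inverts \<open>f' a\<close> on the complement \<open>N\<close>
    of its kernel, and \<open>Q\<close> below is the resulting projection onto the kernel.\<close>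
  obtain S where S: "range S \<subseteq> N" "linear S" "\<forall>v\<in>N. S (f' a v) = v"
    using linear_exists_left_inverse_on[OF lin subN injN] by blast
  define Q where "Q v = v - S (f' a v)" for v
  have linQ: "linear Q"
    unfolding Q_def using S(2) by (intro linear_compose_sub linear_id[unfolded id_def] linear_compose[OF lin S(2), unfolded o_def])
  have QK: "Q v \<in> K" for v
  proof -
    obtain n k where nk: "n \<in> N" "k \<in> K" "v = n + k" using decomp by blast
    have "f' a v = f' a n" using nk by (simp add: K_def blinfun.add_right)
    then have "Q v = k" using nk S(3) by (simp add: Q_def)
    then show ?thesis using nk by simp
  qed
  show ?thesis
  proof (cases "K = {0}")
    \<comment> \<open>Full rank at \<open>a\<close>: the derivative is invertible, so
      \<open>f a\<close> is interior to the image.\<close>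
    case True
    have "N = UNIV" unfolding N_def True by simp
    then have SS: "S (f' a v) = v" for v using S(3) by blast
    then have injf: "inj (blinfun_apply (f' a))" by (metis injI)
    have "surj (blinfun_apply (f' a))" by (rule linear_injective_imp_surjective[OF lin injf]) simp
    then have "blinfun_apply (f' a) \<circ> S = id"
      using SS by (metis (no_types, opaque_lifting) comp_apply eq_id_iff surj_def)
    moreover have "continuous_on W f"
      using der W(1) by (meson continuous_at_imp_continuous_on has_derivative_continuous)
    ultimately have "f a \<in> interior (f ` W)"
      using sussmann_open_mapping[OF W(1) _ a(1) der[OF a(1)], of S W] S(2) a(1) W(1)
      by (simp add: linear_conv_bounded_linear interior_open)
    then show ?thesis by blast
  next
    case False
    then obtain k where k: "k \<in> K" "k \<noteq> 0" using subspace_0[OF subK] by blast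
    have blS: "bounded_linear S" and blQ: "bounded_linear Q"
      using S(2) linQ by (simp_all add: linear_conv_bounded_linear)
    \<comment> \<open>Straightens \<open>f\<close>: the derivative of \<open>\<Phi>\<close> at
      \<open>a\<close> is the identity, its \<open>N\<close> part records \<open>f\<close> and its
      kernel part is linear.\<close>
    define \<Phi> where "\<Phi> x = S (f x) + Q x" for x
    define \<Phi>' where "\<Phi>' x = (Blinfun S o\<^sub>L f' x) + Blinfun Q" for x
    have \<Phi>'_apply: "\<Phi>' x v = S (f' x v) + Q v" for x v
      by (simp add: \<Phi>'_def blinfun.add_left bounded_linear_Blinfun_apply blS blQ)
    have der\<Phi>: "(\<Phi> has_derivative blinfun_apply (\<Phi>' x)) (at x)" if "x \<in> W" for x
    proof -
      have "((\<lambda>x. S (f x) + Q x) has_derivative (\<lambda>v. S (f' x v) + Q v)) (at x)"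
        by (intro has_derivative_add bounded_linear.has_derivative[OF blS der[OF that]]
            bounded_linear_imp_has_derivative[OF blQ])
      moreover have "blinfun_apply (\<Phi>' x) = (\<lambda>v. S (f' x v) + Q v)" using \<Phi>'_apply by blast
      ultimately show ?thesis by (simp add: \<Phi>_def[abs_def])
    qed
    have cont\<Phi>: "continuous_on W \<Phi>'"
      unfolding \<Phi>'_def by (intro continuous_intros cont)
    have "id_blinfun o\<^sub>L \<Phi>' a = id_blinfun"
      by (rule blinfun_eqI) (simp add: \<Phi>'_apply Q_def)
    from inverse_function_theorem[OF W(1) der\<Phi> cont\<Phi> a(1) this]
    obtain U V g g' where U: "open U" "U \<subseteq> W" "a \<in> U" "open V" "\<Phi> a \<in> V" "homeomorphism U V \<Phi> g"
      and g: "\<And>y. y \<in> V \<Longrightarrow> (g has_derivative g' y) (at y)"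
      "\<And>y. y \<in> V \<Longrightarrow> g' y = inv (blinfun_apply (\<Phi>' (g y)))"
      "\<And>y. y \<in> V \<Longrightarrow> bij (blinfun_apply (\<Phi>' (g y)))" by blast
    have gU: "g y \<in> U" "\<Phi> (g y) = y" if "y \<in> V" for y
      using U(6) that unfolding homeomorphism_def by auto
    \<comment> \<open>In the direction that \<open>\<Phi>\<close> turns into \<open>k\<close>,
      \<open>f\<close> does not move: a nonzero image vector would be killed by \<open>S\<close>,
      while \<open>S\<close> still maps the range of the derivative onto \<open>N\<close>. The rank
      would then exceed \<open>dim N\<close>, hence the maximal rank.\<close>
    have zero: "f' (g y) (g' y k) = 0" if y: "y \<in> V" for y
    proof (rule ccontr)
      let ?x = "g y"
      let ?R = "range (blinfun_apply (f' ?x))"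
      assume ne: "f' ?x (g' y k) \<noteq> 0"
      have xW: "?x \<in> W" using gU(1)[OF y] U(2) by blast
      have surj: "surj (blinfun_apply (\<Phi>' ?x))" using g(3)[OF y] by (rule bij_is_surj)
      have "\<Phi>' ?x (g' y k) = k" unfolding g(2)[OF y] by (rule surj_f_inv_f[OF surj])
      then have "S (f' ?x (g' y k)) = k - Q (g' y k)" by (simp add: \<Phi>'_apply algebra_simps)
      then have "S (f' ?x (g' y k)) \<in> K" using subspace_diff[OF subK k(1) QK] by simp
      moreover have "S (f' ?x (g' y k)) \<in> N" using S(1) by blast
      ultimately have S0: "S (f' ?x (g' y k)) = 0" by (rule NK[rotated])
      have "N \<subseteq> S ` ?R"
      proof
        fix n assume n: "n \<in> N"
        obtain u where "n = \<Phi>' ?x u" using surj by (metis surj_def)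
        then have eq: "Q u = n - S (f' ?x u)" by (simp add: \<Phi>'_apply)
        have "n - S (f' ?x u) \<in> N" using S(1) by (intro subspace_diff[OF subN n]) blast
        then have "Q u = 0" using NK QK[of u] eq by metis
        then have "n = S (f' ?x u)" using eq by simp
        then show "n \<in> S ` ?R" by blast
      qed
      then have "dim N \<le> dim (S ` ?R)" by (rule dim_subset)
      also have "dim (S ` ?R) < dim ?R"
        by (rule dim_linear_image_less[OF S(2) _ _ ne S0]) (auto intro: linear_subspace_image[OF lin subspace_UNIV])
      also have "\<dots> \<le> rk a" using max[OF xW] by (simp add: rk_def)
      also have "rk a \<le> dim N"
      proof -
        have "range (blinfun_apply (f' a)) \<subseteq> blinfun_apply (f' a) ` N"
        proof
          fix w assume "w \<in> range (blinfun_apply (f' a))"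
          then obtain v where v: "w = f' a v" by blast
          obtain n k where nk: "n \<in> N" "k \<in> K" "v = n + k" using decomp by blast
          then have "w = f' a n" using v by (simp add: K_def blinfun.add_right)
          then show "w \<in> blinfun_apply (f' a) ` N" using nk by blast
        qed
        then have "rk a \<le> dim (blinfun_apply (f' a) ` N)" unfolding rk_def by (rule dim_subset)
        also have "\<dots> \<le> dim N" by (rule dim_image_le[OF lin])
        finally show ?thesis .
      qed
      finally show False by simp
    qed
    obtain \<epsilon> where \<epsilon>: "\<epsilon> > 0" "ball (\<Phi> a) \<epsilon> \<subseteq> V" using U(4,5) open_contains_ball by blast
    define e where "e = \<epsilon> / norm k"
    have e: "e > 0" using \<epsilon>(1) k(2) by (simp add: e_def)
    \<comment> \<open>\<open>g\<close> carries this segment in direction \<open>k\<close> to an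
      injective curve on which \<open>f\<close> is constant, contradicting finite fibres.\<close>
    define \<gamma> where "\<gamma> s = \<Phi> a + s *\<^sub>R k" for s
    have \<gamma>V: "\<gamma> s \<in> V" if "s \<in> ball 0 e" for s
    proof -
      have "norm (s *\<^sub>R k) < \<epsilon>" using that k(2) by (simp add: e_def pos_less_divide_eq)
      then have "\<gamma> s \<in> ball (\<Phi> a) \<epsilon>" by (simp add: \<gamma>_def dist_norm)
      then show ?thesis using \<epsilon>(2) by blast
    qed
    have "\<exists>c. \<forall>s\<in>ball 0 e. f (g (\<gamma> s)) = c"
    proof (rule has_derivative_zero_constant[OF convex_ball])
      fix s :: real assume s: "s \<in> ball 0 e"
      have d1: "(\<gamma> has_derivative (\<lambda>h. h *\<^sub>R k)) (at s)"
        unfolding \<gamma>_def[abs_def] by (auto intro!: derivative_eq_intros)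
      have d2: "((\<lambda>s. g (\<gamma> s)) has_derivative (\<lambda>h. g' (\<gamma> s) (h *\<^sub>R k))) (at s)"
        by (rule has_derivative_compose[OF d1 g(1)[OF \<gamma>V[OF s]]])
      have "g (\<gamma> s) \<in> W" using gU(1)[OF \<gamma>V[OF s]] U(2) by blast
      from has_derivative_compose[OF d2 der[OF this]]
      have "((\<lambda>s. f (g (\<gamma> s))) has_derivative (\<lambda>h. f' (g (\<gamma> s)) (g' (\<gamma> s) (h *\<^sub>R k)))) (at s)" .
      moreover have "f' (g (\<gamma> s)) (g' (\<gamma> s) (h *\<^sub>R k)) = 0" for h
      proof -
        have "linear (g' (\<gamma> s))" using g(1)[OF \<gamma>V[OF s]] has_derivative_linear by blast
        then have "g' (\<gamma> s) (h *\<^sub>R k) = h *\<^sub>R g' (\<gamma> s) k" by (rule linear_scale)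
        then show ?thesis using zero[OF \<gamma>V[OF s]] by (simp add: blinfun.scaleR_right)
      qed
      ultimately show "((\<lambda>s. f (g (\<gamma> s))) has_derivative (\<lambda>h. 0)) (at s within ball 0 e)"
        using has_derivative_at_withinI by simp
    qed
    then obtain c where c: "\<And>s. s \<in> ball 0 e \<Longrightarrow> f (g (\<gamma> s)) = c" by blast
    have "(\<lambda>s. g (\<gamma> s)) ` ball 0 e \<subseteq> {x \<in> W. f x = c}"
    proof (rule image_subsetI)
      fix s :: real assume s: "s \<in> ball 0 e"
      then show "g (\<gamma> s) \<in> {x \<in> W. f x = c}" using c[OF s] gU(1)[OF \<gamma>V[OF s]] U(2) by blast
    qed
    then have "finite ((\<lambda>s. g (\<gamma> s)) ` ball 0 e)" by (rule finite_subset[OF _ fin])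
    moreover have "inj_on (\<lambda>s. g (\<gamma> s)) (ball 0 e)"
    proof (rule inj_onI)
      fix s t :: real assume st: "s \<in> ball 0 e" "t \<in> ball 0 e" "g (\<gamma> s) = g (\<gamma> t)"
      have "\<gamma> s = \<Phi> (g (\<gamma> s))" by (rule gU(2)[OF \<gamma>V[OF st(1)], symmetric])
      also have "\<dots> = \<Phi> (g (\<gamma> t))" by (simp only: st(3))
      also have "\<dots> = \<gamma> t" by (rule gU(2)[OF \<gamma>V[OF st(2)]])
      finally show "s = t" using k(2) by (simp add: \<gamma>_def)
    qed
    ultimately have "finite (ball 0 e :: real set)" by (rule finite_imageD)
    moreover have "infinite (ball 0 e :: real set)"
      by (rule uncountable_infinite[OF uncountable_ball[OF e]])
    ultimately show ?thesis by (rule notE[rotated])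
  qed
qed

section \<open>Graphs over a generic point\<close>

text \<open>The full preimage of the projection of \<open>X\<close> to the coordinates in
  \<open>S\<close>, kept as a cylinder in the same space.\<close>

definition sat :: "'n set \<Rightarrow> (complex^'n) set \<Rightarrow> (complex^'n) set" where
  "sat S X = {z. \<exists>x\<in>X. \<forall>k\<in>S. x $ k = z $ k}"

definition fibre :: "'n set \<Rightarrow> (complex^'n) set \<Rightarrow> complex^'n \<Rightarrow> (complex^'n) set" where
  "fibre I X z = {x \<in> X. \<forall>k\<in>I. x $ k = z $ k}"

lemma sat_UNIV: "sat UNIV X = X"
  by (auto simp: sat_def vec_eq_iff[symmetric])

lemma sat_project: "{z. \<exists>t. cupd z i t \<in> sat S X} = sat (S - {i}) X"
proof (rule set_eqI, rule iffI)
  fix z assume "z \<in> {z. \<exists>t. cupd z i t \<in> sat S X}"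
  then obtain t x where x: "x \<in> X" "\<forall>k\<in>S. x $ k = cupd z i t $ k" by (auto simp: sat_def)
  then have "\<forall>k\<in>S - {i}. x $ k = z $ k" by simp
  then show "z \<in> sat (S - {i}) X" using x(1) by (auto simp: sat_def)
next
  fix z assume "z \<in> sat (S - {i}) X"
  then obtain x where x: "x \<in> X" "\<forall>k\<in>S - {i}. x $ k = z $ k" by (auto simp: sat_def)
  then have "\<forall>k\<in>S. x $ k = cupd z i (x $ i) $ k" by simp
  then have "cupd z i (x $ i) \<in> sat S X" unfolding sat_def using x(1) by blast
  then show "z \<in> {z. \<exists>t. cupd z i t \<in> sat S X}" by blast
qed

lemma generic_at_open:
  assumes "open V" "a \<in> V" shows "generic_at a (\<lambda>w. w \<in> V)"
proof -
  obtain r where "r > 0" "ball a r \<subseteq> V" using assms open_contains_ball by blast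
  then show ?thesis
    unfolding generic_at_def
    by (intro exI[of _ r] conjI exI[of _ "\<lambda>z. 1"] line_holo_on_const bexI[of _ a]) auto
qed

text \<open>The graphs cover the fibre but may contain further points, as they come from the zeros
  of one defining function. Confining their values to \<open>B\<close> keeps families that belong to
  disjoint discs distinct.\<close>

definition dir_graphs :: "(complex^'n) set \<Rightarrow> 'n \<Rightarrow> complex set \<Rightarrow> complex^'n \<Rightarrow> real \<Rightarrow> (complex^'n \<Rightarrow> complex) set \<Rightarrow> bool" where
  "dir_graphs A i B w r T \<longleftrightarrow> finite T \<and> (\<forall>\<tau>\<in>T. line_holo_on \<tau> (ball w r)) \<and>
     (\<forall>z\<in>ball w r. {t \<in> B. cupd z i t \<in> A} \<subseteq> (\<lambda>\<tau>. \<tau> z) ` T \<and> (\<lambda>\<tau>. \<tau> z) ` T \<subseteq> B \<and> inj_on (\<lambda>\<tau>. \<tau> z) T)"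

lemma dir_graphs_mono:
  assumes "dir_graphs A i B w r T" "r' \<le> r" shows "dir_graphs A i B w r' T"
proof -
  have sub: "ball w r' \<subseteq> ball w r" using assms(2) by auto
  show ?thesis
    using assms(1) sub line_holo_on_subset[OF _ open_ball sub] unfolding dir_graphs_def by blast
qed

text \<open>Inside a window the fibre of \<open>A\<close> lies among the zeros of a single defining
  function, which supply both the bound on its size and, generically, the graphs.\<close>

lemma local_dir_graphs:
  assumes an: "\<And>a. line_analytic_at A a" and bd: "dir_bounded A i" and t0: "cupd a i t0 \<in> A" and "\<epsilon> > 0"
  shows "\<exists>\<rho>. 0 < \<rho> \<and> \<rho> < \<epsilon> \<and>
    (\<exists>\<delta>>0. \<exists>n. \<forall>z\<in>cyl a (-{i}) \<delta>. card {t \<in> ball t0 \<rho>. cupd z i t \<in> A} \<le> n) \<and>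
    generic_at a (\<lambda>w. \<exists>r>0. \<exists>T. dir_graphs A i (ball t0 \<rho>) w r T)"
proof -
  obtain \<rho> \<delta> U F f where w: "0 < \<rho>" "\<rho> < \<epsilon>" "0 < \<delta>" "f \<in> F"
      "A \<inter> U = {z \<in> U. \<forall>f\<in>F. f z = 0}" "zero_window f U i t0 \<rho> (cyl a (-{i}) \<delta>)"
    using analytic_window_exists[OF assms] by blast
  interpret zero_window f U i t0 \<rho> "cyl a (-{i}) \<delta>" by fact
  have aG: "a \<in> cyl a (-{i}) \<delta>" by (rule centre_in_cyl) fact
  have sub: "{t \<in> ball t0 \<rho>. cupd z i t \<in> A} \<subseteq> zeros z" if z: "z \<in> cyl a (-{i}) \<delta>" for z
  proof
    fix t assume t: "t \<in> {t \<in> ball t0 \<rho>. cupd z i t \<in> A}"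
    then have "cupd z i t \<in> U" using in_U[OF z, of t] by simp
    then have "f (cupd z i t) = 0" using w(4,5) t by blast
    then show "t \<in> zeros z" using t by (simp add: zeros_def)
  qed
  obtain n where n: "\<And>z. z \<in> cyl a (-{i}) \<delta> \<Longrightarrow> (\<Sum>t\<in>zeros z. mult z t) = n"
    using number_of_zeros_constant by blast
  have "card {t \<in> ball t0 \<rho>. cupd z i t \<in> A} \<le> n" if z: "z \<in> cyl a (-{i}) \<delta>" for z
    using card_mono[OF finite_zeros[OF z] sub[OF z]] card_zeros_le[OF z] n[OF z] by simp
  moreover have "generic_at a (\<lambda>w. \<exists>r>0. \<exists>T. dir_graphs A i (ball t0 \<rho>) w r T)"
  proof (rule generic_at_mono[OF generic_at_conj[OF generic_zeros_graphs[OF aG] generic_at_open[OF open_G aG]]])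
    fix v assume "(\<exists>r>0. \<exists>T. finite T \<and> (\<forall>\<tau>\<in>T. line_holo_on \<tau> (ball v r)) \<and>
      (\<forall>z\<in>ball v r. zeros z = (\<lambda>\<tau>. \<tau> z) ` T \<and> inj_on (\<lambda>\<tau>. \<tau> z) T)) \<and> v \<in> cyl a (-{i}) \<delta>"
    then obtain r T where r: "r > 0" "finite T" "\<forall>\<tau>\<in>T. line_holo_on \<tau> (ball v r)"
      "\<forall>z\<in>ball v r. zeros z = (\<lambda>\<tau>. \<tau> z) ` T \<and> inj_on (\<lambda>\<tau>. \<tau> z) T" and v: "v \<in> cyl a (-{i}) \<delta>" by blast
    obtain r1 where r1: "r1 > 0" "ball v r1 \<subseteq> cyl a (-{i}) \<delta>" using v open_cyl open_contains_ball by blast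
    have b: "ball v (min r r1) \<subseteq> ball v r" "ball v (min r r1) \<subseteq> cyl a (-{i}) \<delta>" using r1(2) by auto
    have "dir_graphs A i (ball t0 \<rho>) v (min r r1) T"
      unfolding dir_graphs_def
    proof (intro conjI ballI)
      show "finite T" by fact
      show "line_holo_on \<tau> (ball v (min r r1))" if "\<tau> \<in> T" for \<tau>
        using line_holo_on_subset[OF _ open_ball b(1)] r(3) that by blast
      fix z assume z: "z \<in> ball v (min r r1)"
      then have eq: "zeros z = (\<lambda>\<tau>. \<tau> z) ` T" "inj_on (\<lambda>\<tau>. \<tau> z) T" using r(4) b(1) by blast+
      show "{t \<in> ball t0 \<rho>. cupd z i t \<in> A} \<subseteq> (\<lambda>\<tau>. \<tau> z) ` T"
        using sub[of z] z b(2) eq(1) by blast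
      show "(\<lambda>\<tau>. \<tau> z) ` T \<subseteq> ball t0 \<rho>" unfolding eq(1)[symmetric] by (auto simp: zeros_def)
      show "inj_on (\<lambda>\<tau>. \<tau> z) T" by fact
    qed
    then show "\<exists>r>0. \<exists>T. dir_graphs A i (ball t0 \<rho>) v r T"
      using r(1) r1(1) by (intro exI[of _ "min r r1"] conjI exI[of _ T]) auto
  qed
  ultimately show ?thesis using w(1-3) by blast
qed

lemma dir_fibre_graphs:
  assumes an: "\<And>a. line_analytic_at A a" and bd: "dir_bounded A i"
  shows "\<exists>\<delta>>0. \<exists>n. \<forall>z\<in>cyl a (-{i}) \<delta>. card {t. cupd z i t \<in> A} \<le> n"
    and "generic_at a (\<lambda>w. \<exists>r>0. \<exists>T. dir_graphs A i UNIV w r T)"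
proof -
  let ?T = "{t. cupd a i t \<in> A}"
  have fin: "finite ?T" by (rule dir_fibre_finite[OF an bd])
  have "\<forall>t\<in>?T. \<exists>e>0. \<forall>s\<in>?T. s \<noteq> t \<longrightarrow> e \<le> dist t s"
    using finite_set_avoid[OF fin] by blast
  then have "\<forall>t\<in>?T. \<exists>e. e > 0 \<and> (\<forall>s\<in>?T. s \<noteq> t \<longrightarrow> e \<le> dist t s)" by blast
  from bchoice[OF this] obtain e where e: "\<forall>t\<in>?T. e t > 0 \<and> (\<forall>s\<in>?T. s \<noteq> t \<longrightarrow> e t \<le> dist t s)" by blast
  \<comment> \<open>Half of a lower bound for the distances between fibre points, so that discs of
    smaller radius are disjoint. The 1 keeps \<open>Min\<close> defined for an empty fibre.\<close>
  define \<epsilon> where "\<epsilon> = Min (insert 1 (e ` ?T)) / 2"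
  have "Min (insert 1 (e ` ?T)) \<in> insert 1 (e ` ?T)" by (rule Min_in) (use fin in auto)
  then have \<epsilon>: "\<epsilon> > 0" using e by (auto simp: \<epsilon>_def)
  have sep: "2 * \<epsilon> \<le> dist s t" if "s \<in> ?T" "t \<in> ?T" "s \<noteq> t" for s t
  proof -
    have "2 * \<epsilon> \<le> e s" unfolding \<epsilon>_def using fin that(1) by simp
    also have "e s \<le> dist s t" using e that by auto
    finally show ?thesis .
  qed
  have "\<forall>t\<in>?T. \<exists>\<rho>. 0 < \<rho> \<and> \<rho> < \<epsilon> \<and>
    (\<exists>\<delta>>0. \<exists>n. \<forall>z\<in>cyl a (-{i}) \<delta>. card {s \<in> ball t \<rho>. cupd z i s \<in> A} \<le> n) \<and>
    generic_at a (\<lambda>w. \<exists>r>0. \<exists>T. dir_graphs A i (ball t \<rho>) w r T)"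
    using local_dir_graphs[OF an bd _ \<epsilon>] by simp
  from bchoice[OF this] obtain \<rho> where "\<forall>t\<in>?T. 0 < \<rho> t \<and> \<rho> t < \<epsilon> \<and>
    (\<exists>\<delta>>0. \<exists>n. \<forall>z\<in>cyl a (-{i}) \<delta>. card {s \<in> ball t (\<rho> t). cupd z i s \<in> A} \<le> n) \<and>
    generic_at a (\<lambda>w. \<exists>r>0. \<exists>T. dir_graphs A i (ball t (\<rho> t)) w r T)" by blast
  then have \<rho>: "\<And>t. t \<in> ?T \<Longrightarrow> 0 < \<rho> t" "\<And>t. t \<in> ?T \<Longrightarrow> \<rho> t < \<epsilon>"
    and cb: "\<forall>t\<in>?T. \<exists>\<delta>. \<delta> > 0 \<and> (\<exists>n. \<forall>z\<in>cyl a (-{i}) \<delta>. card {s \<in> ball t (\<rho> t). cupd z i s \<in> A} \<le> n)"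
    and gen: "\<And>t. t \<in> ?T \<Longrightarrow> generic_at a (\<lambda>w. \<exists>r>0. \<exists>T. dir_graphs A i (ball t (\<rho> t)) w r T)"
    by blast+
  have oV: "open (\<Union>t\<in>?T. ball t (\<rho> t))" by (intro open_UN ballI open_ball)
  have "?T \<subseteq> (\<Union>t\<in>?T. ball t (\<rho> t))" using \<rho>(1) by force
  from dir_fibre_stable[OF line_analytic_closed[OF an] bd oV this] obtain \<delta>0 where
    \<delta>0: "\<delta>0 > 0" "\<forall>z\<in>cyl a (-{i}) \<delta>0. {t. cupd z i t \<in> A} \<subseteq> (\<Union>t\<in>?T. ball t (\<rho> t))"
    by blast
  have split: "{t. cupd z i t \<in> A} = (\<Union>t\<in>?T. {s \<in> ball t (\<rho> t). cupd z i s \<in> A})"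
    if "z \<in> cyl a (-{i}) \<delta>0" for z
    using \<delta>0(2) that by blast
  from bchoice[OF cb] obtain \<delta> where \<delta>: "\<forall>t\<in>?T. \<delta> t > 0 \<and>
    (\<exists>n. \<forall>z\<in>cyl a (-{i}) (\<delta> t). card {s \<in> ball t (\<rho> t). cupd z i s \<in> A} \<le> n)" by blast
  then have "\<forall>t\<in>?T. \<exists>n. \<forall>z\<in>cyl a (-{i}) (\<delta> t). card {s \<in> ball t (\<rho> t). cupd z i s \<in> A} \<le> n" by blast
  from bchoice[OF this] obtain n where
    n: "\<forall>t\<in>?T. \<forall>z\<in>cyl a (-{i}) (\<delta> t). card {s \<in> ball t (\<rho> t). cupd z i s \<in> A} \<le> n t" by blast
  define d where "d = Min (insert \<delta>0 (\<delta> ` ?T))"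
  have "d \<in> insert \<delta>0 (\<delta> ` ?T)" unfolding d_def by (rule Min_in) (use fin in auto)
  then have d: "d > 0" using \<delta> \<delta>0(1) by auto
  have dle: "d \<le> \<delta>0" "\<And>t. t \<in> ?T \<Longrightarrow> d \<le> \<delta> t" unfolding d_def using fin by auto
  have "card {t. cupd z i t \<in> A} \<le> (\<Sum>t\<in>?T. n t)" if z: "z \<in> cyl a (-{i}) d" for z
  proof -
    have z0: "z \<in> cyl a (-{i}) \<delta>0" using z cyl_mono[OF dle(1)] by blast
    have "card {t. cupd z i t \<in> A} \<le> (\<Sum>t\<in>?T. card {s \<in> ball t (\<rho> t). cupd z i s \<in> A})"
      unfolding split[OF z0] by (rule card_UN_le[OF fin])
    also have "\<dots> \<le> (\<Sum>t\<in>?T. n t)"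
    proof (rule sum_mono)
      fix t assume t: "t \<in> ?T"
      then have "z \<in> cyl a (-{i}) (\<delta> t)" using z cyl_mono[OF dle(2)[OF t]] by blast
      then show "card {s \<in> ball t (\<rho> t). cupd z i s \<in> A} \<le> n t" using n t by blast
    qed
    finally show ?thesis .
  qed
  then show "\<exists>\<delta>>0. \<exists>n. \<forall>z\<in>cyl a (-{i}) \<delta>. card {t. cupd z i t \<in> A} \<le> n" using d by blast
  show "generic_at a (\<lambda>w. \<exists>r>0. \<exists>T. dir_graphs A i UNIV w r T)"
  proof (rule generic_at_mono[OF generic_at_conj[OF generic_at_finite_all[OF fin gen]
          generic_at_open[OF open_cyl[of a "-{i}" \<delta>0] centre_in_cyl[OF \<delta>0(1)]]]])
    fix w assume "(\<forall>t\<in>?T. \<exists>r>0. \<exists>T. dir_graphs A i (ball t (\<rho> t)) w r T) \<and> w \<in> cyl a (-{i}) \<delta>0"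
    then have w: "w \<in> cyl a (-{i}) \<delta>0" and "\<forall>t\<in>?T. \<exists>r. r > 0 \<and> (\<exists>T. dir_graphs A i (ball t (\<rho> t)) w r T)" by blast+
    from bchoice[OF this(2)] obtain r where r: "\<forall>t\<in>?T. r t > 0 \<and> (\<exists>T. dir_graphs A i (ball t (\<rho> t)) w (r t) T)" by blast
    then have "\<forall>t\<in>?T. \<exists>T. dir_graphs A i (ball t (\<rho> t)) w (r t) T" by blast
    from bchoice[OF this] obtain T where T: "\<forall>t\<in>?T. dir_graphs A i (ball t (\<rho> t)) w (r t) (T t)" by blast
    obtain r0 where r0: "r0 > 0" "ball w r0 \<subseteq> cyl a (-{i}) \<delta>0" using w open_cyl open_contains_ball by blast
    define q where "q = Min (insert r0 (r ` ?T))"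
    have "q \<in> insert r0 (r ` ?T)" unfolding q_def by (rule Min_in) (use fin in auto)
    then have q: "q > 0" using r r0(1) by auto
    have qle: "q \<le> r0" "\<And>t. t \<in> ?T \<Longrightarrow> q \<le> r t" unfolding q_def using fin by auto
    have G: "dir_graphs A i (ball t (\<rho> t)) w q (T t)" if "t \<in> ?T" for t
      using dir_graphs_mono[OF bspec[OF T that] qle(2)[OF that]] .
    have "dir_graphs A i UNIV w q (\<Union>t\<in>?T. T t)"
      unfolding dir_graphs_def
    proof (intro conjI ballI)
      show "finite (\<Union>t\<in>?T. T t)" using fin G unfolding dir_graphs_def by blast
      show "line_holo_on \<tau> (ball w q)" if "\<tau> \<in> (\<Union>t\<in>?T. T t)" for \<tau>
        using that G unfolding dir_graphs_def by blast
      fix z assume z: "z \<in> ball w q"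
      have zG: "{s \<in> ball t (\<rho> t). cupd z i s \<in> A} \<subseteq> (\<lambda>\<tau>. \<tau> z) ` T t" "(\<lambda>\<tau>. \<tau> z) ` T t \<subseteq> ball t (\<rho> t)"
        "inj_on (\<lambda>\<tau>. \<tau> z) (T t)" if "t \<in> ?T" for t
        using G[OF that] z unfolding dir_graphs_def by blast+
      have "z \<in> ball w r0" using z qle(1) by auto
      then have z0: "z \<in> cyl a (-{i}) \<delta>0" using r0(2) by blast
      have "{t. cupd z i t \<in> A} \<subseteq> (\<Union>t\<in>?T. (\<lambda>\<tau>. \<tau> z) ` T t)"
        unfolding split[OF z0] using zG(1) by blast
      then show "{t \<in> UNIV. cupd z i t \<in> A} \<subseteq> (\<lambda>\<tau>. \<tau> z) ` (\<Union>t\<in>?T. T t)" by (simp add: image_UN)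
      show "inj_on (\<lambda>\<tau>. \<tau> z) (\<Union>t\<in>?T. T t)"
      proof (rule inj_onI)
        fix x y assume "x \<in> (\<Union>t\<in>?T. T t)" "y \<in> (\<Union>t\<in>?T. T t)" and eq: "x z = y z"
        then obtain s t where st: "s \<in> ?T" "t \<in> ?T" "x \<in> T s" "y \<in> T t" by blast
        have "x z \<in> ball s (\<rho> s)" "y z \<in> ball t (\<rho> t)" using zG(2) st by blast+
        then have "dist s t < \<rho> s + \<rho> t" using eq dist_triangle_less_add[of s "x z" "\<rho> s" t "\<rho> t"]
          by (simp add: dist_commute)
        then have "dist s t < 2 * \<epsilon>" using \<rho>(2)[OF st(1)] \<rho>(2)[OF st(2)] by simp
        then have "s = t" using sep[OF st(1,2)] by linarith
        then show "x = y" using zG(3)[OF st(1)] st eq unfolding inj_on_def by blast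
      qed
    qed auto
    then show "\<exists>r>0. \<exists>T. dir_graphs A i UNIV w r T" using q by blast
  qed
qed

section \<open>Composition with sections and mixing of coordinates\<close>

lemma continuous_on_vec_components:
  fixes \<gamma> :: "'a::topological_space \<Rightarrow> complex^'n"
  assumes "\<And>k. continuous_on B (\<lambda>z. \<gamma> z $ k)" shows "continuous_on B \<gamma>"
proof -
  have "continuous_on B (\<lambda>z. \<chi> k. \<gamma> z $ k)" by (rule continuous_on_vec_lambda) (rule assms)
  then show ?thesis by simp
qed

text \<open>The chain rule wants an outer function that is differentiable in the full sense, while
  the inner map need only be holomorphic along lines. Hence the original equations of
  \<open>X\<close>, and not resultants, are used when sections are inserted.\<close>

lemma line_holo_on_compose:
  fixes \<gamma> :: "complex^'n \<Rightarrow> complex^'n"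
  assumes f: "holomorphic_fun_on f U" and "open B"
    and \<gamma>: "\<And>k. line_holo_on (\<lambda>z. \<gamma> z $ k) B" and BU: "\<And>z. z \<in> B \<Longrightarrow> \<gamma> z \<in> U"
  shows "line_holo_on (\<lambda>z. f (\<gamma> z)) B"
  unfolding line_holo_on_def
proof (intro conjI allI)
  show "open B" by fact
  have "continuous_on B \<gamma>" by (rule continuous_on_vec_components) (rule line_holo_on_continuous[OF \<gamma>])
  then show "continuous_on B (\<lambda>z. f (\<gamma> z))"
    using BU by (intro continuous_on_compose2[OF line_holo_on_continuous[OF holomorphic_fun_on_imp_line_holo_on[OF f]]]) auto
  fix z v
  show "(\<lambda>t. f (\<gamma> (z + t *s v))) holomorphic_on {t. z + t *s v \<in> B}"
    unfolding holomorphic_on_def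
  proof
    fix t assume t: "t \<in> {t. z + t *s v \<in> B}"
    then have "\<gamma> (z + t *s v) \<in> U" using BU by simp
    then obtain D where D: "(f has_derivative D) (at (\<gamma> (z + t *s v)))" "\<And>c v. D (c *s v) = c * D v"
      using f unfolding holomorphic_fun_on_def by blast
    have "\<exists>d. ((\<lambda>s. \<gamma> (z + s *s v) $ k) has_field_derivative d) (at t)" for k
      using holomorphic_on_imp_differentiable_at[OF line_holo_on_line[OF \<gamma>] open_line_preimage[OF \<open>open B\<close>] t]
      unfolding field_differentiable_def .
    then obtain d where d: "\<And>k. ((\<lambda>s. \<gamma> (z + s *s v) $ k) has_field_derivative d k) (at t)" by metis
    have "((\<lambda>s. f (\<gamma> (z + s *s v))) has_field_derivative D (\<chi> k. d k)) (at t)"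
      by (rule has_field_derivative_along_curve[where \<gamma>="\<lambda>s. \<gamma> (z + s *s v)", OF D]) (simp add: d)
    then show "(\<lambda>t. f (\<gamma> (z + t *s v))) field_differentiable at t within {t. z + t *s v \<in> B}"
      unfolding field_differentiable_def by (blast intro: has_field_derivative_at_within)
  qed
qed

definition mix :: "'n set \<Rightarrow> complex^'n \<Rightarrow> complex^'n \<Rightarrow> complex^'n" where
  "mix I x z = (\<chi> k. if k \<in> I then x $ k else z $ k)"

lemma mix_nth [simp]: "mix I x z $ k = (if k \<in> I then x $ k else z $ k)"
  by (simp add: mix_def)

lemma open_mix_preimage: "open V \<Longrightarrow> open {x. mix I x z \<in> V}"
proof -
  assume "open V"
  moreover have "continuous_on UNIV (\<lambda>x. mix I x z)"
  proof (rule continuous_on_vec_components)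
    fix k show "continuous_on UNIV (\<lambda>x. mix I x z $ k)"
      by (cases "k \<in> I") (auto intro!: continuous_intros)
  qed
  ultimately show ?thesis using open_vimage[of V "\<lambda>x. mix I x z"] by (simp add: vimage_def)
qed

text \<open>The linear bound gives properness of the projection to the coordinates in
  \<open>I\<close> and, later, polynomial growth of the defining functions.\<close>

locale proper_projection =
  fixes X :: "(complex^'n) set" and I :: "'n set" and C :: real
  assumes analytic: "complex_analytic_set X"
    and growth: "\<And>x k. x \<in> X \<Longrightarrow> norm (x $ k) \<le> C * (1 + (\<Sum>j\<in>I. norm (x $ j)))"
begin

section \<open>Finiteness of the fibres over the coordinates in \<open>I\<close>\<close>

lemma line_analytic: "line_analytic_at X a"
proof -
  obtain U F where U: "open U" "a \<in> U" "finite F" "\<forall>f\<in>F. holomorphic_fun_on f U" "X \<inter> U = {z \<in> U. \<forall>f\<in>F. f z = 0}"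
    using analytic unfolding complex_analytic_set_def by meson
  have "\<forall>f\<in>F. line_holo_on f U" using U(4) holomorphic_fun_on_imp_line_holo_on by blast
  then show ?thesis
    unfolding line_analytic_at_def using U by (intro exI[of _ U] exI[of _ F]) simp
qed

lemma closed_X: "closed X"
  by (rule line_analytic_closed) (rule line_analytic)

lemma sat_dir_bounded:
  assumes "I \<subseteq> S" "i \<in> S" "i \<notin> I" shows "dir_bounded (sat S X) i"
  unfolding dir_bounded_def
proof
  fix a :: "complex^'n"
  \<comment> \<open>The absolute value is there because \<open>C\<close> is not assumed to be
    nonnegative.\<close>
  let ?B = "\<bar>C\<bar> * (1 + (\<Sum>j\<in>I. norm (a $ j) + 1))"
  have "norm t \<le> ?B" if z: "z \<in> cyl a (-{i}) 1" and t: "cupd z i t \<in> sat S X" for z t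
  proof -
    obtain x where x: "x \<in> X" "\<forall>k\<in>S. x $ k = cupd z i t $ k" using t by (auto simp: sat_def)
    have "norm (x $ j) \<le> norm (a $ j) + 1" if "j \<in> I" for j
    proof -
      have "j \<noteq> i" using that assms(3) by blast
      then have "x $ j = z $ j" using x(2) that assms(1) by auto
      moreover have "norm (z $ j - a $ j) < 1" using z \<open>j \<noteq> i\<close> by (simp add: cyl_def)
      moreover have "norm (z $ j) \<le> norm (a $ j) + norm (z $ j - a $ j)" by (rule norm_triangle_sub)
      ultimately show ?thesis by simp
    qed
    then have le: "1 + (\<Sum>j\<in>I. norm (x $ j)) \<le> 1 + (\<Sum>j\<in>I. norm (a $ j) + 1)"
      by (simp only: add_le_cancel_left sum_mono)
    have "norm t = norm (x $ i)" using x(2) assms(2) by simp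
    also have "\<dots> \<le> C * (1 + (\<Sum>j\<in>I. norm (x $ j)))" by (rule growth[OF x(1)])
    also have "\<dots> \<le> \<bar>C\<bar> * (1 + (\<Sum>j\<in>I. norm (x $ j)))"
      by (rule mult_right_mono) (auto intro!: add_nonneg_nonneg sum_nonneg)
    also have "\<dots> \<le> ?B" by (rule mult_left_mono[OF le]) simp
    finally show ?thesis .
  qed
  then show "\<exists>\<delta>>0. \<exists>B. \<forall>z\<in>cyl a (- {i}) \<delta>. \<forall>t. cupd z i t \<in> sat S X \<longrightarrow> norm t \<le> B"
    by (intro exI[of _ 1] conjI exI[of _ ?B]) auto
qed

text \<open>Coordinates outside \<open>I\<close> are eliminated one at a time; at every stage those
  in \<open>I\<close> are still present and bound the one to be dropped.\<close>

lemma sat_analytic: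
  assumes "finite R" "R \<subseteq> - I" shows "line_analytic_at (sat (- R) X) a"
  using assms
proof (induction R arbitrary: a)
  case empty
  then show ?case by (simp add: sat_UNIV line_analytic)
next
  case (insert i R a)
  have "line_analytic_at (sat (- R) X) b" for b using insert by simp
  moreover have "dir_bounded (sat (- R) X) i" by (rule sat_dir_bounded) (use insert in auto)
  ultimately have "line_analytic_at {z. \<exists>t. cupd z i t \<in> sat (- R) X} a" by (rule line_analytic_projection)
  moreover have "- R - {i} = - insert i R" by auto
  ultimately show ?case by (simp add: sat_project)
qed

text \<open>Dropping all coordinates except those in \<open>I\<close> and one \<open>j\<close>
  leaves a set that confines the \<open>j\<close>-th coordinate of fibre points to finitely many
  values.\<close>

lemma coordinate_set:
  assumes "j \<notin> I"
  shows "line_analytic_at (sat (insert j I) X) a" and "dir_bounded (sat (insert j I) X) j"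
proof -
  have "- (- I - {j}) = insert j I" by auto
  then show "line_analytic_at (sat (insert j I) X) a" using sat_analytic[of "- I - {j}" a] by simp
  show "dir_bounded (sat (insert j I) X) j" by (rule sat_dir_bounded) (use assms in auto)
qed

lemma fibre_coordinate:
  assumes "x \<in> fibre I X z" "j \<notin> I" shows "cupd z j (x $ j) \<in> sat (insert j I) X"
  using assms unfolding fibre_def sat_def by auto

text \<open>Coordinates are treated separately, so the product of the candidate sets is in general
  larger than the fibre; it serves as a finite superset.\<close>

definition candidates :: "complex^'n \<Rightarrow> 'n \<Rightarrow> complex set" where
  "candidates z k = (if k \<in> I then {z $ k} else {t. cupd z k t \<in> sat (insert k I) X})"

lemma finite_candidates: "finite (candidates z k)"
  using dir_fibre_finite[OF coordinate_set] by (simp add: candidates_def)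

lemma fibre_subset: "fibre I X z \<subseteq> vec_lambda ` PiE UNIV (candidates z)"
proof
  fix x assume x: "x \<in> fibre I X z"
  have "x $ k \<in> candidates z k" for k
    using fibre_coordinate[OF x, of k] x by (simp add: candidates_def fibre_def)
  then have "vec_nth x \<in> PiE UNIV (candidates z)" by auto
  then have "vec_lambda (vec_nth x) \<in> vec_lambda ` PiE UNIV (candidates z)" by (rule imageI)
  then show "x \<in> vec_lambda ` PiE UNIV (candidates z)" by simp
qed

lemma finite_PiE_candidates: "finite (PiE UNIV (candidates z))"
  by (rule finite_PiE) (simp_all add: finite_candidates)

lemma finite_fibre: "finite (fibre I X z)"
  by (rule finite_subset[OF fibre_subset]) (rule finite_imageI[OF finite_PiE_candidates])

text \<open>The bound also holds near branch points, which is what the removable singularity theorem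
  asks for when it is applied to the number of sheets and to products over the fibre.\<close>

lemma fibre_card_bounded: "\<exists>r>0. \<exists>N. \<forall>z\<in>ball a r. card (fibre I X z) \<le> N"
proof -
  have "\<exists>r. r > 0 \<and> (\<exists>n. \<forall>z\<in>ball a r. card (candidates z k) \<le> n)" for k
  proof (cases "k \<in> I")
    case True
    then show ?thesis by (intro exI[of _ 1] conjI exI[of _ 1]) (auto simp: candidates_def)
  next
    case False
    obtain \<delta> n where "\<delta> > 0" "\<forall>z\<in>cyl a (-{k}) \<delta>. card {t. cupd z k t \<in> sat (insert k I) X} \<le> n"
      using dir_fibre_graphs(1)[OF coordinate_set(1)[OF False] coordinate_set(2)[OF False]] by meson
    then show ?thesis
      using ball_subset_cyl[of a \<delta> "-{k}"] False
      by (intro exI[of _ \<delta>] conjI exI[of _ n]) (auto simp: candidates_def)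
  qed
  then have "\<forall>k. \<exists>r. r > 0 \<and> (\<exists>n. \<forall>z\<in>ball a r. card (candidates z k) \<le> n)" by blast
  from choice[OF this] obtain r where r: "\<forall>k. r k > 0 \<and> (\<exists>n. \<forall>z\<in>ball a (r k). card (candidates z k) \<le> n)" by blast
  then have "\<forall>k. \<exists>n. \<forall>z\<in>ball a (r k). card (candidates z k) \<le> n" by blast
  from choice[OF this] obtain n where n: "\<forall>k. \<forall>z\<in>ball a (r k). card (candidates z k) \<le> n k" by blast
  define q where "q = Min (range r)"
  have "q \<in> range r" unfolding q_def by (rule Min_in) auto
  then have q: "q > 0" using r by auto
  have "card (fibre I X z) \<le> (\<Prod>k\<in>UNIV. n k)" if z: "z \<in> ball a q" for z
  proof -
    have "card (fibre I X z) \<le> card (vec_lambda ` PiE UNIV (candidates z))"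
      by (rule card_mono[OF finite_imageI[OF finite_PiE_candidates] fibre_subset])
    also have "\<dots> \<le> card (PiE UNIV (candidates z))" by (rule card_image_le[OF finite_PiE_candidates])
    also have "\<dots> = (\<Prod>k\<in>UNIV. card (candidates z k))" by (rule card_PiE) simp
    also have "\<dots> \<le> (\<Prod>k\<in>UNIV. n k)"
    proof (rule prod_mono)
      fix k :: 'n
      have "q \<le> r k" unfolding q_def by simp
      then have "z \<in> ball a (r k)" using z by simp
      then show "0 \<le> card (candidates z k) \<and> card (candidates z k) \<le> n k" using n by simp
    qed
    finally show ?thesis .
  qed
  then show ?thesis using q by blast
qed

end

text \<open>\<open>thick\<close> is the only consequence of purity of dimension that is needed: no open piece of \<open>X\<close>
  lies over a nowhere dense set.\<close>

locale branched_cover = proper_projection X I C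
  for X :: "(complex^'n) set" and I :: "'n set" and C :: real +
  assumes thick: "\<And>U. open U \<Longrightarrow> X \<inter> U \<noteq> {} \<Longrightarrow> interior (sat I (X \<inter> U)) \<noteq> {}"
begin

definition section_cover :: "complex^'n \<Rightarrow> real \<Rightarrow> (complex^'n \<Rightarrow> complex^'n) set \<Rightarrow> bool" where
  "section_cover w r \<Gamma> \<longleftrightarrow> finite \<Gamma> \<and> (\<forall>\<gamma>\<in>\<Gamma>. \<forall>k. line_holo_on (\<lambda>z. \<gamma> z $ k) (ball w r)) \<and>
     (\<forall>z\<in>ball w r. fibre I X z = (\<lambda>\<gamma>. \<gamma> z) ` \<Gamma> \<and> inj_on (\<lambda>\<gamma>. \<gamma> z) \<Gamma>)"

text \<open>The base points over which one graph lies in \<open>X\<close> form a closed subset of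
  the ball; it is open as well, so connectedness decides. Openness combines \<open>thick\<close>
  with the separation of the graphs: points of \<open>X\<close> close to this graph exist over an
  open set of base points, and they can lie on no other graph.\<close>

lemma section_all_or_nothing:
  fixes \<Gamma> :: "'a \<Rightarrow> complex^'n \<Rightarrow> complex^'n"
  assumes fin: "finite S"
    and holo: "\<And>\<alpha> k. \<alpha> \<in> S \<Longrightarrow> line_holo_on (\<lambda>z. \<Gamma> \<alpha> z $ k) (ball w r)"
    and base: "\<And>\<alpha> z k. \<alpha> \<in> S \<Longrightarrow> k \<in> I \<Longrightarrow> \<Gamma> \<alpha> z $ k = z $ k"
    and sub: "\<And>z. z \<in> ball w r \<Longrightarrow> fibre I X z \<subseteq> (\<lambda>\<alpha>. \<Gamma> \<alpha> z) ` S"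
    and inj: "\<And>z. z \<in> ball w r \<Longrightarrow> inj_on (\<lambda>\<alpha>. \<Gamma> \<alpha> z) S"
    and \<alpha>: "\<alpha> \<in> S" and z1: "z1 \<in> ball w r" "\<Gamma> \<alpha> z1 \<in> X" and z2: "z2 \<in> ball w r"
  shows "\<Gamma> \<alpha> z2 \<in> X"
proof -
  define A where "A = {z \<in> ball w r. \<Gamma> \<alpha> z \<in> X}"
  have cont: "continuous_on (ball w r) (\<Gamma> \<beta>)" if "\<beta> \<in> S" for \<beta>
    by (rule continuous_on_vec_components) (rule line_holo_on_continuous[OF holo[OF that]])
  have "open A"
    unfolding open_subopen[of A]
  proof
    fix z0 assume "z0 \<in> A"
    then have z0: "z0 \<in> ball w r" "\<Gamma> \<alpha> z0 \<in> X" by (auto simp: A_def)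
    define x0 where "x0 = \<Gamma> \<alpha> z0"
    obtain U F where U: "open U" "x0 \<in> U" "finite F" "\<forall>f\<in>F. holomorphic_fun_on f U"
      "X \<inter> U = {z \<in> U. \<forall>f\<in>F. f z = 0}"
      using analytic unfolding complex_analytic_set_def by meson
    have "open (ball w r \<inter> \<Gamma> \<alpha> -` U)"
      by (rule continuous_open_preimage[OF cont[OF \<alpha>] open_ball U(1)])
    moreover have "z0 \<in> ball w r \<inter> \<Gamma> \<alpha> -` U" using z0 U(2) by (simp add: x0_def)
    ultimately obtain r1 where r1: "r1 > 0" "ball z0 r1 \<subseteq> ball w r \<inter> \<Gamma> \<alpha> -` U"
      using open_contains_ball by blast
    let ?D = "(\<lambda>\<beta>. dist (\<Gamma> \<beta> z0) x0) ` (S - {\<alpha>})"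
    \<comment> \<open>Half the least distance, over \<open>z0\<close>, from \<open>x0\<close> to the
      other graphs; the 1 serves when there is no other graph.\<close>
    define e where "e = Min (insert 1 ?D) / 2"
    have pos: "dist (\<Gamma> \<beta> z0) x0 > 0" if "\<beta> \<in> S - {\<alpha>}" for \<beta>
      using inj[OF z0(1)] that \<alpha> unfolding x0_def inj_on_def by auto
    have finD: "finite (insert 1 ?D)" using fin by simp
    have "Min (insert 1 ?D) \<in> insert 1 ?D" by (rule Min_in[OF finD]) simp
    moreover have "x > 0" if "x \<in> insert 1 ?D" for x
      using that by (elim insertE imageE) (simp, simp only: pos)
    ultimately have "Min (insert 1 ?D) > 0" by blast
    then have e: "e > 0" by (simp add: e_def)
    have far: "e < dist (\<Gamma> \<beta> z0) x0" if "\<beta> \<in> S - {\<alpha>}" for \<beta>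
    proof -
      have "Min (insert 1 ?D) \<le> dist (\<Gamma> \<beta> z0) x0" by (rule Min_le[OF finD]) (use that in blast)
      then show ?thesis using e by (simp add: e_def)
    qed
    have "open (ball w r \<inter> \<Gamma> \<beta> -` (- cball x0 e))" if "\<beta> \<in> S - {\<alpha>}" for \<beta>
      by (rule continuous_open_preimage[OF cont open_ball]) (use that in auto)
    then have oV: "open (ball z0 r1 \<inter> (\<Inter>\<beta>\<in>S - {\<alpha>}. ball w r \<inter> \<Gamma> \<beta> -` (- cball x0 e)))"
      using fin by (intro open_Int open_ball open_INT) auto
    have zV: "z0 \<in> ball z0 r1 \<inter> (\<Inter>\<beta>\<in>S - {\<alpha>}. ball w r \<inter> \<Gamma> \<beta> -` (- cball x0 e))"
      using r1(1) z0(1) far by (auto simp: dist_commute not_le)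
    obtain s where s: "s > 0" "ball z0 s \<subseteq> ball z0 r1 \<inter> (\<Inter>\<beta>\<in>S - {\<alpha>}. ball w r \<inter> \<Gamma> \<beta> -` (- cball x0 e))"
      by (rule openE[OF oV zV])
    have sw: "ball z0 s \<subseteq> ball w r" using s(2) r1(2) by blast
    have sU: "\<Gamma> \<alpha> z \<in> U" if "z \<in> ball z0 s" for z using that s(2) r1(2) by blast
    have sfar: "\<Gamma> \<beta> z \<notin> cball x0 e" if "z \<in> ball z0 s" "\<beta> \<in> S - {\<alpha>}" for z \<beta>
      using that s(2) by blast
    \<comment> \<open>Points near \<open>x0\<close> whose base coordinates, completed by the
      remaining coordinates of \<open>z0\<close>, stay in the small ball.\<close>
    define Ux where "Ux = ball x0 e \<inter> {x. mix I x z0 \<in> ball z0 s}"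
    have "open Ux" unfolding Ux_def by (intro open_Int open_ball open_mix_preimage)
    moreover have "x0 \<in> X \<inter> Ux"
    proof -
      have "mix I x0 z0 = z0" using base[OF \<alpha>] by (simp add: vec_eq_iff x0_def)
      then show ?thesis using z0 e s(1) by (simp add: Ux_def x0_def)
    qed
    ultimately have "interior (sat I (X \<inter> Ux)) \<noteq> {}" using thick by blast
    then obtain y where y: "y \<in> interior (sat I (X \<inter> Ux))" by blast
    \<comment> \<open>A cylinder does not see the coordinates outside \<open>I\<close>. Its interior
      point \<open>y\<close> may be far from \<open>z0\<close> in those, so they are exchanged to
      obtain an open set of base points close to \<open>z0\<close>.\<close>
    define W where "W = ball z0 s \<inter> {z. mix I z y \<in> interior (sat I (X \<inter> Ux))}"
    have oW: "open W" unfolding W_def by (intro open_Int open_ball open_mix_preimage open_interior)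
    have "mix I y z0 \<in> W"
    proof -
      have "y \<in> sat I (X \<inter> Ux)" using y interior_subset by blast
      then obtain x where x: "x \<in> X \<inter> Ux" "\<forall>k\<in>I. x $ k = y $ k" by (auto simp: sat_def)
      have "mix I y z0 = mix I x z0" using x(2) by (simp add: vec_eq_iff)
      then have "mix I y z0 \<in> ball z0 s" using x(1) by (simp add: Ux_def)
      moreover have "mix I (mix I y z0) y = y" by (simp add: vec_eq_iff)
      ultimately show ?thesis using y by (simp add: W_def)
    qed
    then have neW: "W \<noteq> {}" by blast
    have WX: "\<Gamma> \<alpha> z \<in> X" if z: "z \<in> W" for z
    proof -
      have zs: "z \<in> ball z0 s" using z by (simp add: W_def)
      have "mix I z y \<in> sat I (X \<inter> Ux)" using z interior_subset unfolding W_def by blast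
      then obtain x where x: "x \<in> X \<inter> Ux" "\<forall>k\<in>I. x $ k = mix I z y $ k" unfolding sat_def by blast
      then have "x \<in> fibre I X z" by (simp add: fibre_def)
      then obtain \<beta> where \<beta>: "\<beta> \<in> S" "x = \<Gamma> \<beta> z" using sub[of z] zs sw by blast
      have "\<beta> = \<alpha>"
      proof (rule ccontr)
        assume "\<beta> \<noteq> \<alpha>"
        then have "x \<notin> cball x0 e" using sfar[OF zs, of \<beta>] \<beta> by blast
        then show False using x(1) by (simp add: Ux_def)
      qed
      then show ?thesis using \<beta> x(1) by blast
    qed
    \<comment> \<open>The equations of \<open>X\<close>, pulled back along the graph, vanish on the
      open set \<open>W\<close>, hence on the whole ball around \<open>z0\<close>.\<close>
    have "f (\<Gamma> \<alpha> z) = 0" if f: "f \<in> F" and z: "z \<in> ball z0 s" for f z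
    proof (rule line_holo_on_identity[where f="\<lambda>z. f (\<Gamma> \<alpha> z)", OF _ convex_ball oW neW _ _ z])
      show "line_holo_on (\<lambda>z. f (\<Gamma> \<alpha> z)) (ball z0 s)"
      proof (rule line_holo_on_compose)
        show "holomorphic_fun_on f U" using U(4) f by blast
        show "line_holo_on (\<lambda>z. \<Gamma> \<alpha> z $ k) (ball z0 s)" for k
          by (rule line_holo_on_subset[OF holo[OF \<alpha>] open_ball sw])
      qed (use sU in auto)
      show "W \<subseteq> ball z0 s" by (simp add: W_def)
      show "f (\<Gamma> \<alpha> z) = 0" if "z \<in> W" for z
        using WX[OF that] sU[of z] that U(5) f unfolding W_def by blast
    qed
    then have "\<Gamma> \<alpha> z \<in> X" if "z \<in> ball z0 s" for z using that sU[OF that] U(5) by blast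
    then have "ball z0 s \<subseteq> A" using sw unfolding A_def by blast
    then show "\<exists>T. open T \<and> z0 \<in> T \<and> T \<subseteq> A" using s(1) by (intro exI[of _ "ball z0 s"]) auto
  qed
  then have "openin (top_of_set (ball w r)) A" by (intro open_subset) (auto simp: A_def)
  moreover have "closedin (top_of_set (ball w r)) A"
  proof -
    have "A = ball w r \<inter> \<Gamma> \<alpha> -` X" by (auto simp: A_def)
    then show ?thesis using continuous_closedin_preimage[OF cont[OF \<alpha>] closed_X] by simp
  qed
  moreover have "connected (ball w r)" by (rule connected_ball)
  ultimately have "A = {} \<or> A = ball w r" unfolding connected_clopen by blast
  moreover have "z1 \<in> A" using z1 by (simp add: A_def)
  ultimately show ?thesis using z2 unfolding A_def by blast
qed

text \<open>Choosing one coordinate graph for each coordinate outside \<open>I\<close> gives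
  finitely many candidate sections. They cover the fibres, and by the all-or-nothing property those
  lying in \<open>X\<close> over the centre describe \<open>X\<close> over the whole ball.\<close>

theorem generic_section_cover: "generic_at a (\<lambda>w. \<exists>r>0. \<exists>\<Gamma>. section_cover w r \<Gamma>)"
proof -
  have "generic_at a (\<lambda>w. \<forall>j\<in>-I. \<exists>r>0. \<exists>T. dir_graphs (sat (insert j I) X) j UNIV w r T)"
    by (rule generic_at_finite_all) (auto intro!: dir_fibre_graphs(2) coordinate_set)
  then show ?thesis
  proof (rule generic_at_mono)
    fix w assume "\<forall>j\<in>-I. \<exists>r>0. \<exists>T. dir_graphs (sat (insert j I) X) j UNIV w r T"
    then have "\<forall>j\<in>-I. \<exists>r. r > 0 \<and> (\<exists>T. dir_graphs (sat (insert j I) X) j UNIV w r T)" by blast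
    from bchoice[OF this] obtain r where r: "\<forall>j\<in>-I. r j > 0 \<and> (\<exists>T. dir_graphs (sat (insert j I) X) j UNIV w (r j) T)" by blast
    then have "\<forall>j\<in>-I. \<exists>T. dir_graphs (sat (insert j I) X) j UNIV w (r j) T" by blast
    from bchoice[OF this] obtain T where T: "\<forall>j\<in>-I. dir_graphs (sat (insert j I) X) j UNIV w (r j) (T j)" by blast
    \<comment> \<open>The 1 keeps \<open>Min\<close> defined when \<open>I\<close> contains every
      coordinate.\<close>
    define q where "q = Min (insert 1 (r ` (-I)))"
    have "q \<in> insert 1 (r ` (-I))" unfolding q_def by (rule Min_in) auto
    then have q: "q > 0" using r by auto
    have G: "dir_graphs (sat (insert j I) X) j UNIV w q (T j)" if "j \<in> -I" for j
    proof (rule dir_graphs_mono[OF bspec[OF T that]])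
      show "q \<le> r j" unfolding q_def using that by simp
    qed
    define S where "S = PiE (-I) T"
    define \<Gamma> where "\<Gamma> \<alpha> z = (\<chi> k. if k \<in> I then z $ k else \<alpha> k z)" for \<alpha> :: "'n \<Rightarrow> complex^'n \<Rightarrow> complex" and z
    have fin: "finite S" unfolding S_def using G by (intro finite_PiE) (auto simp: dir_graphs_def)
    have holo: "line_holo_on (\<lambda>z. \<Gamma> \<alpha> z $ k) (ball w q)" if "\<alpha> \<in> S" for \<alpha> k
    proof (cases "k \<in> I")
      case True then show ?thesis by (simp add: \<Gamma>_def line_holo_on_nth)
    next
      case False
      then have "\<alpha> k \<in> T k" using that by (auto simp: S_def PiE_iff)
      then have "line_holo_on (\<alpha> k) (ball w q)" using G[of k] False by (simp add: dir_graphs_def)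
      then show ?thesis using False by (simp add: \<Gamma>_def)
    qed
    have base: "\<Gamma> \<alpha> z $ k = z $ k" if "k \<in> I" for \<alpha> z k using that by (simp add: \<Gamma>_def)
    have sub: "fibre I X z \<subseteq> (\<lambda>\<alpha>. \<Gamma> \<alpha> z) ` S" if z: "z \<in> ball w q" for z
    proof
      fix x assume x: "x \<in> fibre I X z"
      have "\<forall>j\<in>-I. \<exists>\<tau>. \<tau> \<in> T j \<and> \<tau> z = x $ j"
      proof
        fix j assume j: "j \<in> -I"
        then have "cupd z j (x $ j) \<in> sat (insert j I) X" using fibre_coordinate[OF x] by blast
        then have "x $ j \<in> {t \<in> UNIV. cupd z j t \<in> sat (insert j I) X}" by blast
        moreover have "{t \<in> UNIV. cupd z j t \<in> sat (insert j I) X} \<subseteq> (\<lambda>\<tau>. \<tau> z) ` T j"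
          using G[OF j] z unfolding dir_graphs_def by blast
        ultimately have "x $ j \<in> (\<lambda>\<tau>. \<tau> z) ` T j" by blast
        then show "\<exists>\<tau>. \<tau> \<in> T j \<and> \<tau> z = x $ j" by auto
      qed
      from bchoice[OF this] obtain \<alpha> where \<alpha>: "\<forall>j\<in>-I. \<alpha> j \<in> T j \<and> \<alpha> j z = x $ j" by blast
      have "restrict \<alpha> (-I) \<in> S" unfolding S_def using \<alpha> by auto
      moreover have "\<Gamma> (restrict \<alpha> (-I)) z = x"
        using \<alpha> x by (auto simp: \<Gamma>_def vec_eq_iff fibre_def)
      ultimately show "x \<in> (\<lambda>\<alpha>. \<Gamma> \<alpha> z) ` S" by blast
    qed
    have inj: "inj_on (\<lambda>\<alpha>. \<Gamma> \<alpha> z) S" if z: "z \<in> ball w q" for z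
    proof (rule inj_onI)
      fix \<alpha> \<beta> assume ab: "\<alpha> \<in> S" "\<beta> \<in> S" and eq: "\<Gamma> \<alpha> z = \<Gamma> \<beta> z"
      show "\<alpha> = \<beta>"
      proof (rule PiE_ext[OF ab[unfolded S_def]])
        fix j assume j: "j \<in> -I"
        have "\<Gamma> \<alpha> z $ j = \<Gamma> \<beta> z $ j" using eq by simp
        then have "\<alpha> j z = \<beta> j z" using j by (simp add: \<Gamma>_def)
        moreover have "\<alpha> j \<in> T j" "\<beta> j \<in> T j" using ab j by (auto simp: S_def PiE_iff)
        moreover have "inj_on (\<lambda>\<tau>. \<tau> z) (T j)" using G[OF j] z by (simp add: dir_graphs_def)
        ultimately show "\<alpha> j = \<beta> j" by (simp add: inj_on_def)
      qed
    qed
    have aon: "\<Gamma> \<alpha> z2 \<in> X" if "\<alpha> \<in> S" "z1 \<in> ball w q" "\<Gamma> \<alpha> z1 \<in> X" "z2 \<in> ball w q" for \<alpha> z1 z2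
      by (rule section_all_or_nothing[of S \<Gamma> w q, OF fin holo base sub inj that])
    define S' where "S' = {\<alpha> \<in> S. \<Gamma> \<alpha> w \<in> X}"
    have wq: "w \<in> ball w q" using q by simp
    have "section_cover w q (\<Gamma> ` S')"
      unfolding section_cover_def
    proof (intro conjI ballI allI)
      show "finite (\<Gamma> ` S')" using fin by (simp add: S'_def)
      show "line_holo_on (\<lambda>z. \<gamma> z $ k) (ball w q)" if "\<gamma> \<in> \<Gamma> ` S'"
        for \<gamma> :: "complex^'n \<Rightarrow> complex^'n" and k
        using that holo by (auto simp: S'_def)
      fix z assume z: "z \<in> ball w q"
      show "fibre I X z = (\<lambda>\<gamma>. \<gamma> z) ` \<Gamma> ` S'"
      proof (rule set_eqI, rule iffI)
        fix x assume x: "x \<in> fibre I X z"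
        then obtain \<alpha> where \<alpha>: "\<alpha> \<in> S" "x = \<Gamma> \<alpha> z" using sub[OF z] by blast
        have "x \<in> X" using x by (simp add: fibre_def)
        then have "\<Gamma> \<alpha> w \<in> X" using aon[OF \<alpha>(1) z _ wq] \<alpha>(2) by simp
        then show "x \<in> (\<lambda>\<gamma>. \<gamma> z) ` \<Gamma> ` S'" using \<alpha> by (auto simp: S'_def)
      next
        fix x assume "x \<in> (\<lambda>\<gamma>. \<gamma> z) ` \<Gamma> ` S'"
        then obtain \<alpha> where \<alpha>: "\<alpha> \<in> S" "\<Gamma> \<alpha> w \<in> X" "x = \<Gamma> \<alpha> z" by (auto simp: S'_def)
        have "x \<in> X" using aon[OF \<alpha>(1) wq \<alpha>(2) z] \<alpha>(3) by simp
        then show "x \<in> fibre I X z" using base \<alpha>(3) by (simp add: fibre_def)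
      qed
      show "inj_on (\<lambda>\<gamma>. \<gamma> z) (\<Gamma> ` S')"
      proof (rule inj_onI)
        fix x y assume "x \<in> \<Gamma> ` S'" "y \<in> \<Gamma> ` S'" and eq: "x z = y z"
        then obtain \<alpha> \<beta> where ab: "\<alpha> \<in> S" "\<beta> \<in> S" "x = \<Gamma> \<alpha>" "y = \<Gamma> \<beta>" by (auto simp: S'_def)
        then have "\<alpha> = \<beta>" using inj_onD[OF inj[OF z], of \<alpha> \<beta>] eq by simp
        then show "x = y" using ab by simp
      qed
    qed
    then show "\<exists>r>0. \<exists>\<Gamma>. section_cover w r \<Gamma>" using q by blast
  qed
qed

end

section \<open>Algebraicity of branched covers\<close>

text \<open>Bilinear, without conjugation, so that \<open>lin u\<close> is holomorphic.\<close>

definition lin :: "complex^'n \<Rightarrow> complex^'n \<Rightarrow> complex" where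
  "lin u x = (\<Sum>k\<in>UNIV. u $ k * x $ k)"

lemma lin_diff: "lin u (x - y) = lin u x - lin u y"
  by (simp add: lin_def algebra_simps sum_subtractf)

lemma continuous_on_lin: "continuous_on S (lin u)"
  unfolding lin_def by (intro continuous_intros)

lemma line_holo_on_lin:
  fixes \<gamma> :: "complex^'m \<Rightarrow> complex^'n"
  assumes "open B" "\<And>k. line_holo_on (\<lambda>z. \<gamma> z $ k) B"
  shows "line_holo_on (\<lambda>z. lin u (\<gamma> z)) B"
  unfolding lin_def by (intro line_holo_on_sum line_holo_on_mult line_holo_on_const assms)

lemma norm_lin_le: "norm (lin u x) \<le> (\<Sum>k\<in>UNIV. norm (u $ k)) * norm x"
proof -
  have "norm (lin u x) \<le> (\<Sum>k\<in>UNIV. norm (u $ k * x $ k))" unfolding lin_def by (rule norm_sum)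
  also have "\<dots> \<le> (\<Sum>k\<in>UNIV. norm (u $ k) * norm x)"
    by (rule sum_mono) (simp add: norm_mult mult_left_mono Finite_Cartesian_Product.norm_nth_le)
  finally show ?thesis by (simp add: sum_distrib_right)
qed

text \<open>On the moment curve \<open>u $ k = c ^ e k\<close> with distinct exponents,
  \<open>lin u v\<close> is for every nonzero \<open>v\<close> a nonzero polynomial in
  \<open>c\<close>, and finitely many of these have finitely many roots.\<close>

lemma separating_functional:
  fixes V :: "(complex^'n) set"
  assumes "finite V" "0 \<notin> V" shows "\<exists>u. \<forall>v\<in>V. lin u v \<noteq> 0"
proof -
  obtain e :: "'n \<Rightarrow> nat" where e: "inj e"
    using finite_imp_inj_to_nat_seg[OF finite_class.finite_UNIV] by blast
  define p where "p v = (\<Sum>k\<in>UNIV. monom (v $ k) (e k))" for v :: "complex^'n"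
  have pc: "poly (p v) c = lin (\<chi> k. c ^ e k) v" for v c
    by (simp add: p_def poly_sum poly_monom lin_def mult.commute)
  have nz: "p v \<noteq> 0" if v: "v \<in> V" for v
  proof -
    have "v \<noteq> 0" using v assms(2) by blast
    then obtain j where j: "v $ j \<noteq> 0" by (auto simp: vec_eq_iff)
    have "coeff (p v) (e j) = (\<Sum>k\<in>UNIV. if k = j then v $ k else 0)"
      unfolding p_def coeff_sum by (rule sum.cong) (use e in \<open>auto simp: inj_def\<close>)
    then have "coeff (p v) (e j) = v $ j" by simp
    then show ?thesis using j by auto
  qed
  have "finite (\<Union>v\<in>V. {c. poly (p v) c = 0})"
    using assms(1) nz poly_roots_finite by blast
  then obtain c where "c \<notin> (\<Union>v\<in>V. {c. poly (p v) c = 0})"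
    using ex_new_if_finite[OF infinite_UNIV_char_0] by blast
  then have "\<forall>v\<in>V. lin (\<chi> k. c ^ e k) v \<noteq> 0" by (simp add: pc)
  then show ?thesis by blast
qed

section \<open>Defining functions built from the fibres, and their growth\<close>

context proper_projection
begin

text \<open>The monic polynomial whose roots are the values of the form on the fibre, evaluated at
  \<open>lin u y\<close>; so \<open>y\<close> enters both through its base coordinates and through
  this argument.\<close>

definition \<Phi> :: "complex^'n \<Rightarrow> complex^'n \<Rightarrow> complex" where
  "\<Phi> u y = (\<Prod>x\<in>fibre I X y. lin u y - lin u x)"

text \<open>A fibre point shares the coordinates in \<open>I\<close> with \<open>z\<close>, so
  growth in these coordinates becomes growth in \<open>norm z\<close>.\<close>

lemma fibre_bound: "\<exists>K\<ge>0. \<forall>z. \<forall>x\<in>fibre I X z. norm x \<le> K * (1 + norm z)"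
proof -
  let ?n = "real CARD('n)"
  have "norm x \<le> ?n * (\<bar>C\<bar> * (1 + ?n)) * (1 + norm z)" if x: "x \<in> fibre I X z" for x z
  proof -
    have xX: "x \<in> X" and xI: "\<And>j. j \<in> I \<Longrightarrow> x $ j = z $ j" using x by (auto simp: fibre_def)
    have "(\<Sum>j\<in>I. norm (x $ j)) \<le> (\<Sum>j\<in>I. norm z)"
      by (rule sum_mono) (simp add: xI Finite_Cartesian_Product.norm_nth_le)
    also have "\<dots> \<le> ?n * norm z"
      using card_mono[of UNIV I] by (simp add: mult_right_mono)
    finally have "1 + (\<Sum>j\<in>I. norm (x $ j)) \<le> 1 + ?n * norm z" by simp
    also have "\<dots> \<le> (1 + ?n) * (1 + norm z)" by (simp add: algebra_simps)
    finally have le: "1 + (\<Sum>j\<in>I. norm (x $ j)) \<le> (1 + ?n) * (1 + norm z)" .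
    have "norm (x $ k) \<le> \<bar>C\<bar> * (1 + ?n) * (1 + norm z)" for k
    proof -
      have "norm (x $ k) \<le> C * (1 + (\<Sum>j\<in>I. norm (x $ j)))" by (rule growth[OF xX])
      also have "\<dots> \<le> \<bar>C\<bar> * (1 + (\<Sum>j\<in>I. norm (x $ j)))"
        by (rule mult_right_mono) (auto intro!: add_nonneg_nonneg sum_nonneg)
      also have "\<dots> \<le> \<bar>C\<bar> * ((1 + ?n) * (1 + norm z))" by (rule mult_left_mono[OF le]) simp
      finally show ?thesis by (simp add: mult.assoc)
    qed
    then have "(\<Sum>k\<in>UNIV. norm (x $ k)) \<le> (\<Sum>k\<in>(UNIV::'n set). \<bar>C\<bar> * (1 + ?n) * (1 + norm z))"
      by (intro sum_mono)
    then show ?thesis using norm_vec_le_sum[of x] by (simp add: mult.assoc)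
  qed
  then show ?thesis by (intro exI[of _ "?n * (\<bar>C\<bar> * (1 + ?n))"]) auto
qed

lemma factor_bound:
  "\<exists>L\<ge>0. \<forall>z. \<forall>x\<in>fibre I X z. norm (lin u z - lin u x) \<le> L * (1 + norm z)"
proof -
  obtain K where K: "K \<ge> 0" "\<And>z x. x \<in> fibre I X z \<Longrightarrow> norm x \<le> K * (1 + norm z)"
    using fibre_bound by blast
  define M where "M = (\<Sum>k\<in>UNIV. norm (u $ k))"
  have M: "M \<ge> 0" unfolding M_def by (rule sum_nonneg) simp
  have "norm (lin u z - lin u x) \<le> (M * (1 + K)) * (1 + norm z)" if x: "x \<in> fibre I X z" for x z
  proof -
    have "norm (z - x) \<le> norm z + norm x" by (rule norm_triangle_ineq4)
    also have "\<dots> \<le> (1 + norm z) + K * (1 + norm z)" using K(2)[OF x] by simp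
    also have "\<dots> = (1 + K) * (1 + norm z)" by (simp add: algebra_simps)
    finally have "M * norm (z - x) \<le> M * ((1 + K) * (1 + norm z))" by (rule mult_left_mono[OF _ M])
    then show ?thesis using norm_lin_le[of u "z - x"] by (simp add: lin_diff M_def mult.assoc)
  qed
  then show ?thesis using M K(1) by (intro exI[of _ "M * (1 + K)"]) auto
qed

lemma \<Phi>_bound:
  assumes "L \<ge> 0" "\<forall>x\<in>fibre I X z. norm (lin u z - lin u x) \<le> L * (1 + norm z)"
  shows "norm (\<Phi> u z) \<le> (L * (1 + norm z)) ^ card (fibre I X z)"
proof -
  have "norm (\<Phi> u z) = (\<Prod>x\<in>fibre I X z. norm (lin u z - lin u x))"
    unfolding \<Phi>_def by (simp add: prod_norm)
  also have "\<dots> \<le> (\<Prod>x\<in>fibre I X z. L * (1 + norm z))"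
    by (rule prod_mono) (use assms in auto)
  finally show ?thesis by simp
qed

lemma \<Phi>_locally_bounded: "\<exists>q>0. \<exists>B. \<forall>z\<in>ball a q. norm (\<Phi> u z) \<le> B"
proof -
  obtain L where L: "L \<ge> 0" "\<forall>z. \<forall>x\<in>fibre I X z. norm (lin u z - lin u x) \<le> L * (1 + norm z)"
    using factor_bound by blast
  obtain r N where r: "r > 0" "\<forall>z\<in>ball a r. card (fibre I X z) \<le> N" using fibre_card_bounded by meson
  have "norm (\<Phi> u z) \<le> (1 + L * (1 + (norm a + r))) ^ N" if z: "z \<in> ball a r" for z
  proof -
    have "norm z \<le> norm a + norm (z - a)" by (rule norm_triangle_sub)
    then have nz: "norm z \<le> norm a + r" using z by (simp add: dist_norm norm_minus_commute)
    then have "L * (1 + norm z) \<le> L * (1 + (norm a + r))" using L(1) by (intro mult_left_mono) auto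
    then have le: "L * (1 + norm z) \<le> 1 + L * (1 + (norm a + r))" by simp
    have "norm (\<Phi> u z) \<le> (L * (1 + norm z)) ^ card (fibre I X z)"
      by (rule \<Phi>_bound) (use L in auto)
    also have "\<dots> \<le> (1 + L * (1 + (norm a + r))) ^ card (fibre I X z)"
      by (rule power_mono[OF le]) (use L(1) in auto)
    also have "\<dots> \<le> (1 + L * (1 + (norm a + r))) ^ N"
      by (rule power_increasing) (use r z L(1) in auto)
    finally show ?thesis .
  qed
  then show ?thesis using r(1) by blast
qed

text \<open>By properness the points of nearby fibres accumulate only at the fibre over \<open>y\<close>.\<close>

lemma fibres_stay_separated:
  assumes sep: "\<And>x. x \<in> fibre I X y \<Longrightarrow> lin u y \<noteq> lin u x"
  shows "\<exists>\<eta>>0. \<exists>r>0. \<forall>z\<in>ball y r. \<forall>x\<in>fibre I X z. \<eta> \<le> norm (lin u z - lin u x)"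
proof (rule ccontr)
  assume neg: "\<not> ?thesis"
  have "\<exists>z x. z \<in> ball y (1 / real (Suc n)) \<and> x \<in> fibre I X z \<and> norm (lin u z - lin u x) < 1 / real (Suc n)" for n
  proof -
    have "(0::real) < 1 / real (Suc n)" by simp
    then show ?thesis using neg by (meson not_le)
  qed
  then obtain z x where zx: "\<And>n. z n \<in> ball y (1 / real (Suc n))" "\<And>n. x n \<in> fibre I X (z n)"
    "\<And>n. norm (lin u (z n) - lin u (x n)) < 1 / real (Suc n)" by metis
  have lim0: "(\<lambda>n. 1 / real (Suc n)) \<longlonglongrightarrow> 0" using LIMSEQ_inverse_real_of_nat by (simp add: inverse_eq_divide)
  have "z \<longlonglongrightarrow> y"
  proof (rule LIMSEQ_I, goal_cases)
    case (1 e)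
    then obtain N where N: "1 / real (Suc N) < e" using nat_approx_posE by blast
    have "norm (z n - y) < e" if "n \<ge> N" for n
    proof -
      have "norm (z n - y) < 1 / real (Suc n)" using zx(1)[of n] by (simp add: dist_norm norm_minus_commute)
      also have "\<dots> \<le> 1 / real (Suc N)" using that by (simp add: frac_le)
      finally show ?thesis using N by simp
    qed
    then show ?case by blast
  qed
  obtain K where K: "K \<ge> 0" "\<And>z x. x \<in> fibre I X z \<Longrightarrow> norm x \<le> K * (1 + norm z)"
    using fibre_bound by blast
  have "norm (x n) \<le> K * (1 + (norm y + 1))" for n
  proof -
    have "norm (z n) \<le> norm y + norm (z n - y)" by (rule norm_triangle_sub)
    moreover have "norm (z n - y) < 1 / real (Suc n)" using zx(1)[of n] by (simp add: dist_norm norm_minus_commute)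
    moreover have "1 / real (Suc n) \<le> 1" by simp
    ultimately have "norm (z n) \<le> norm y + 1" by linarith
    then have "K * (1 + norm (z n)) \<le> K * (1 + (norm y + 1))" using K(1) by (intro mult_left_mono) auto
    then show ?thesis using K(2)[OF zx(2)[of n]] by simp
  qed
  then have "x n \<in> cball 0 (K * (1 + (norm y + 1)))" for n by simp
  then obtain l \<sigma> where l: "strict_mono (\<sigma> :: nat \<Rightarrow> nat)" "(x \<circ> \<sigma>) \<longlonglongrightarrow> l"
    using compact_cball[of "0 :: complex^'n"] unfolding compact_def by meson
  have zl: "(z \<circ> \<sigma>) \<longlonglongrightarrow> y" by (rule LIMSEQ_subseq_LIMSEQ) fact+
  have "l \<in> X"
    by (rule closed_sequentially[OF closed_X _ l(2)]) (use zx(2) in \<open>simp add: fibre_def\<close>)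
  moreover have "l $ k = y $ k" if "k \<in> I" for k
  proof (rule LIMSEQ_unique)
    show "(\<lambda>n. (x \<circ> \<sigma>) n $ k) \<longlonglongrightarrow> l $ k" by (rule tendsto_vec_nth[OF l(2)])
    have "(\<lambda>n. (z \<circ> \<sigma>) n $ k) \<longlonglongrightarrow> y $ k" by (rule tendsto_vec_nth[OF zl])
    moreover have "(z \<circ> \<sigma>) n $ k = (x \<circ> \<sigma>) n $ k" for n using zx(2) that by (simp add: fibre_def)
    ultimately show "(\<lambda>n. (x \<circ> \<sigma>) n $ k) \<longlonglongrightarrow> y $ k" by simp
  qed
  ultimately have "l \<in> fibre I X y" by (simp add: fibre_def)
  have cl: "isCont (lin u) p" for p using continuous_on_lin[of UNIV u] by (simp add: continuous_on_eq_continuous_at)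
  have "(\<lambda>n. lin u ((z \<circ> \<sigma>) n) - lin u ((x \<circ> \<sigma>) n)) \<longlonglongrightarrow> lin u y - lin u l"
    by (intro tendsto_diff isCont_tendsto_compose[OF cl] zl l(2))
  moreover have "(\<lambda>n. lin u ((z \<circ> \<sigma>) n) - lin u ((x \<circ> \<sigma>) n)) \<longlonglongrightarrow> 0"
  proof (rule Lim_null_comparison)
    show "((\<lambda>n. 1 / real (Suc n)) \<circ> \<sigma>) \<longlonglongrightarrow> 0" by (rule LIMSEQ_subseq_LIMSEQ[OF lim0 l(1)])
    show "\<forall>\<^sub>F n in sequentially. norm (lin u ((z \<circ> \<sigma>) n) - lin u ((x \<circ> \<sigma>) n)) \<le> ((\<lambda>n. 1 / real (Suc n)) \<circ> \<sigma>) n"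
      using zx(3) by (simp add: less_imp_le)
  qed
  ultimately have "lin u y - lin u l = 0" by (rule LIMSEQ_unique)
  then show False using sep[OF \<open>l \<in> fibre I X y\<close>] by simp
qed

end

section \<open>The number of sheets and the extension to polynomials\<close>

context branched_cover
begin

definition good :: "complex^'n \<Rightarrow> bool" where
  "good w \<longleftrightarrow> (\<exists>r>0. \<exists>\<Gamma>. section_cover w r \<Gamma>)"

lemma generic_good: "generic_at a good"
  unfolding good_def[abs_def] by (rule generic_section_cover)

lemma good_dense: "closure {z. good z} = UNIV"
proof (rule ccontr)
  assume "closure {z. good z} \<noteq> UNIV"
  then obtain a where a: "a \<in> - closure {z. good z}" by blast
  have "\<exists>z\<in>- closure {z. good z}. good z"
    by (rule generic_at_dense[OF generic_good _ a]) (rule open_Compl[OF closed_closure])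
  then show False using closure_subset[of "{z. good z}"] by blast
qed

text \<open>Fibres depend only on the coordinates in \<open>I\<close>, so sections can be
  translated. This passes from a good point of a cylinder to the point of \<open>X\<close> with the
  same base coordinates.\<close>

lemma good_shift:
  assumes "good y" "\<And>k. k \<in> I \<Longrightarrow> x $ k = y $ k" shows "good x"
proof -
  obtain r \<Gamma> where r: "r > 0" "section_cover y r \<Gamma>" using assms(1) unfolding good_def by blast
  define \<phi> where "\<phi> \<gamma> z = \<gamma> (z + (y - x))" for \<gamma> :: "complex^'n \<Rightarrow> complex^'n" and z
  have sh: "z + (y - x) \<in> ball y r" if "z \<in> ball x r" for z
    using that by (simp add: dist_norm algebra_simps)
  have fib: "fibre I X (z + (y - x)) = fibre I X z" for z
    using assms(2) by (simp add: fibre_def)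
  have "section_cover x r (\<phi> ` \<Gamma>)"
    unfolding section_cover_def
  proof (intro conjI ballI allI)
    show "finite (\<phi> ` \<Gamma>)" using r(2) by (simp add: section_cover_def)
    show "line_holo_on (\<lambda>z. \<gamma>' z $ k) (ball x r)" if g: "\<gamma>' \<in> \<phi> ` \<Gamma>"
      for \<gamma>' :: "complex^'n \<Rightarrow> complex^'n" and k
    proof -
      obtain \<gamma> where \<gamma>: "\<gamma> \<in> \<Gamma>" "\<gamma>' = \<phi> \<gamma>" using g by blast
      have "line_holo_on (\<lambda>z. \<gamma> z $ k) (ball y r)" using r(2) \<gamma>(1) by (simp add: section_cover_def)
      then have "line_holo_on (\<lambda>z. \<gamma> (z + (y - x)) $ k) (ball x r)"
        by (rule line_holo_on_affine[where A="\<lambda>z. z + (y - x)" and B="\<lambda>v. v"])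
          (use sh in \<open>auto intro!: continuous_intros\<close>)
      then show ?thesis by (simp add: \<gamma>(2) \<phi>_def)
    qed
    fix z assume z: "z \<in> ball x r"
    have cov: "fibre I X (z + (y - x)) = (\<lambda>\<gamma>. \<gamma> (z + (y - x))) ` \<Gamma>" "inj_on (\<lambda>\<gamma>. \<gamma> (z + (y - x))) \<Gamma>"
      using r(2) sh[OF z] unfolding section_cover_def by blast+
    show "fibre I X z = (\<lambda>\<gamma>. \<gamma> z) ` \<phi> ` \<Gamma>" using cov(1) by (simp add: fib image_image \<phi>_def)
    show "inj_on (\<lambda>\<gamma>. \<gamma> z) (\<phi> ` \<Gamma>)"
    proof (rule inj_onI)
      fix g h assume "g \<in> \<phi> ` \<Gamma>" "h \<in> \<phi> ` \<Gamma>" and eq: "g z = h z"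
      then obtain \<alpha> \<beta> where ab: "\<alpha> \<in> \<Gamma>" "\<beta> \<in> \<Gamma>" "g = \<phi> \<alpha>" "h = \<phi> \<beta>" by blast
      then have "\<alpha> = \<beta>" using inj_onD[OF cov(2), of \<alpha> \<beta>] eq by (simp add: \<phi>_def)
      then show "g = h" using ab by simp
    qed
  qed
  then show ?thesis using r(1) unfolding good_def by blast
qed

lemma good_card_holo:
  assumes "good y" shows "\<exists>s>0. line_holo_on (\<lambda>z. of_nat (card (fibre I X z))) (ball y s)"
proof -
  obtain r \<Gamma> where r: "r > 0" "section_cover y r \<Gamma>" using assms unfolding good_def by blast
  have "line_holo_on (\<lambda>z. of_nat (card \<Gamma>)) (ball y r)" by (rule line_holo_on_const) simp
  then have "line_holo_on (\<lambda>z. of_nat (card (fibre I X z))) (ball y r)"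
  proof (rule line_holo_on_cong)
    fix z assume "z \<in> ball y r"
    then have "fibre I X z = (\<lambda>\<gamma>. \<gamma> z) ` \<Gamma>" "inj_on (\<lambda>\<gamma>. \<gamma> z) \<Gamma>"
      using r(2) unfolding section_cover_def by blast+
    then have "card (fibre I X z) = card \<Gamma>" by (simp add: card_image)
    then show "of_nat (card \<Gamma>) = (of_nat (card (fibre I X z)) :: complex)" by simp
  qed
  then show ?thesis using r(1) by blast
qed

lemma good_\<Phi>_holo:
  assumes "good y" shows "\<exists>s>0. line_holo_on (\<Phi> u) (ball y s)"
proof -
  obtain r \<Gamma> where r: "r > 0" "section_cover y r \<Gamma>" using assms unfolding good_def by blast
  have holo: "line_holo_on (\<lambda>z. \<gamma> z $ k) (ball y r)" if "\<gamma> \<in> \<Gamma>" for \<gamma> :: "complex^'n \<Rightarrow> complex^'n" and k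
    using r(2) that by (simp add: section_cover_def)
  have "line_holo_on (\<lambda>z. \<Prod>\<gamma>\<in>\<Gamma>. lin u z - lin u (\<gamma> z)) (ball y r)"
    by (intro line_holo_on_prod line_holo_on_diff line_holo_on_lin line_holo_on_nth holo open_ball)
  then have "line_holo_on (\<Phi> u) (ball y r)"
  proof (rule line_holo_on_cong)
    fix z assume "z \<in> ball y r"
    then have "fibre I X z = (\<lambda>\<gamma>. \<gamma> z) ` \<Gamma>" "inj_on (\<lambda>\<gamma>. \<gamma> z) \<Gamma>"
      using r(2) unfolding section_cover_def by blast+
    then show "(\<Prod>\<gamma>\<in>\<Gamma>. lin u z - lin u (\<gamma> z)) = \<Phi> u z"
      unfolding \<Phi>_def by (simp add: prod.reindex)
  qed
  then show ?thesis using r(1) by blast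
qed

text \<open>The number of sheets is treated as a holomorphic function: locally constant at good
  points and locally bounded everywhere, it extends to an entire function. By density of the good
  points the values of the extension lie in the closed discrete set of natural numbers.\<close>

lemma good_card_constant: "\<exists>p. \<forall>z. good z \<longrightarrow> card (fibre I X z) = p"
proof -
  let ?e = "\<lambda>z. of_nat (card (fibre I X z)) :: complex"
  have "\<exists>h. line_holo_on h UNIV \<and> (\<forall>z. (\<exists>s>0. line_holo_on ?e (ball z s)) \<longrightarrow> h z = ?e z)"
  proof (rule Riemann_extension)
    show "generic_at a (\<lambda>z. \<exists>s>0. line_holo_on ?e (ball z s))" for a
      by (rule generic_at_mono[OF generic_good]) (rule good_card_holo)
    show "\<exists>q>0. \<exists>B. \<forall>z\<in>ball a q. norm (?e z) \<le> B" for a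
    proof -
      obtain r N where "r > 0" "\<forall>z\<in>ball a r. card (fibre I X z) \<le> N" using fibre_card_bounded by meson
      then show ?thesis by (intro exI[of _ r] conjI exI[of _ "real N"]) auto
    qed
  qed
  then obtain h where h: "line_holo_on h UNIV" "\<And>z. good z \<Longrightarrow> h z = ?e z" using good_card_holo by blast
  have hc: "continuous_on UNIV h" by (rule line_holo_on_continuous[OF h(1)])
  have "h ` closure {z. good z} \<subseteq> range of_nat"
  proof (rule image_closure_subset)
    show "continuous_on (closure {z. good z}) h" using hc continuous_on_subset by blast
    show "closed (range of_nat :: complex set)" by (rule closed_of_nat_image)
    show "h ` {z. good z} \<subseteq> range of_nat" using h(2) by auto
  qed
  then have vals: "h z \<in> range of_nat" for z using good_dense by auto
  have "h constant_on UNIV"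
  proof (rule continuous_discrete_range_constant[OF connected_UNIV hc])
    fix x
    have "1 \<le> norm (h y - h x)" if "h y \<noteq> h x" for y
    proof -
      obtain m k where mk: "h y = of_nat m" "h x = of_nat k" using vals[of y] vals[of x] by auto
      have "m \<noteq> k" using that mk by auto
      then show ?thesis unfolding mk by (rule norm_of_nat_diff_ge_1)
    qed
    then show "\<exists>e>0. \<forall>y. y \<in> UNIV \<and> h y \<noteq> h x \<longrightarrow> e \<le> norm (h y - h x)" by (intro exI[of _ 1]) auto
  qed
  then obtain d where d: "\<And>z. h z = d" unfolding constant_on_def by auto
  obtain p where p: "d = of_nat p" using vals[of 0] d by auto
  have "card (fibre I X z) = p" if "good z" for z
  proof -
    have "(of_nat (card (fibre I X z)) :: complex) = of_nat p" using h(2)[OF that] d p by simp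
    then show ?thesis using of_nat_eq_iff by blast
  qed
  then show ?thesis by blast
qed

text \<open>Near a good point \<open>\<Phi> u\<close> is a product over sections, hence holomorphic.
  Its growth exponent is the common number of sheets, and the estimate passes from good points to
  all points by density.\<close>

lemma \<Phi>_extension:
  "\<exists>h. poly_fun h \<and> continuous_on UNIV h \<and> (\<forall>z. good z \<longrightarrow> h z = \<Phi> u z)"
proof -
  have "\<exists>h. line_holo_on h UNIV \<and> (\<forall>z. (\<exists>s>0. line_holo_on (\<Phi> u) (ball z s)) \<longrightarrow> h z = \<Phi> u z)"
  proof (rule Riemann_extension)
    show "generic_at a (\<lambda>z. \<exists>s>0. line_holo_on (\<Phi> u) (ball z s))" for a
      by (rule generic_at_mono[OF generic_good]) (rule good_\<Phi>_holo)
  qed (rule \<Phi>_locally_bounded)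
  then obtain h where h: "line_holo_on h UNIV" "\<And>z. good z \<Longrightarrow> h z = \<Phi> u z" using good_\<Phi>_holo by blast
  have hc: "continuous_on UNIV h" by (rule line_holo_on_continuous[OF h(1)])
  obtain p where p: "\<And>z. good z \<Longrightarrow> card (fibre I X z) = p" using good_card_constant by blast
  obtain L where L: "L \<ge> 0" "\<forall>z. \<forall>x\<in>fibre I X z. norm (lin u z - lin u x) \<le> L * (1 + norm z)"
    using factor_bound by blast
  let ?S = "{z. norm (h z) \<le> (L * (1 + norm z)) ^ p}"
  have "{z. good z} \<subseteq> ?S"
  proof
    fix z assume "z \<in> {z. good z}"
    then have z: "good z" by simp
    show "z \<in> ?S" using \<Phi>_bound[OF L(1), of z u] L(2) h(2)[OF z] p[OF z] by simp
  qed
  moreover have "closed ?S" by (intro closed_Collect_le continuous_intros hc)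
  ultimately have "closure {z. good z} \<subseteq> ?S" by (rule closure_minimal)
  then have "norm (h z) \<le> L ^ p * (1 + norm z) ^ p" for z
    using good_dense by (auto simp: power_mult_distrib)
  then have "poly_fun h" by (rule entire_polynomial_growth[OF h(1)])
  then show ?thesis using h(2) hc by blast
qed

theorem algebraic: "algebraic_set X"
proof -
  have "\<forall>u. \<exists>h. poly_fun h \<and> continuous_on UNIV h \<and> (\<forall>z. good z \<longrightarrow> h z = \<Phi> u z)"
    using \<Phi>_extension by blast
  from choice[OF this] obtain h where
    "\<forall>u. poly_fun (h u) \<and> continuous_on UNIV (h u) \<and> (\<forall>z. good z \<longrightarrow> h u z = \<Phi> u z)" by blast
  then have h: "\<And>u. poly_fun (h u)" "\<And>u. continuous_on UNIV (h u)" "\<And>u z. good z \<Longrightarrow> h u z = \<Phi> u z" by blast+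
  have "X = {y. \<forall>u. h u y = 0}"
  proof (rule set_eqI, rule iffI)
    fix y assume y: "y \<in> X"
    \<comment> \<open>If the extension were nonzero at \<open>y\<close>, then \<open>thick\<close>
      would give some good \<open>x\<close> in \<open>X\<close> where it is still nonzero; but there
      \<open>\<Phi> u x\<close> contains the zero factor belonging to \<open>x\<close>
      itself.\<close>
    have "h u y = 0" for u
    proof (rule ccontr)
      assume ne: "h u y \<noteq> 0"
      define V where "V = {z. h u z \<noteq> 0}"
      have "open (h u -` (- {0}))" by (rule open_vimage[OF _ h(2)]) auto
      moreover have "h u -` (- {0}) = V" by (auto simp: V_def)
      ultimately have "open V" by simp
      moreover have "X \<inter> V \<noteq> {}" using y ne by (auto simp: V_def)
      ultimately have "interior (sat I (X \<inter> V)) \<noteq> {}" by (rule thick)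
      then obtain b where "b \<in> interior (sat I (X \<inter> V))" by blast
      then have "\<exists>z\<in>interior (sat I (X \<inter> V)). good z"
        by (rule generic_at_dense[OF generic_good open_interior])
      then obtain z where z: "z \<in> sat I (X \<inter> V)" "good z" using interior_subset by blast
      then obtain x where x: "x \<in> X \<inter> V" "\<forall>k\<in>I. x $ k = z $ k" unfolding sat_def by blast
      have "good x" by (rule good_shift[OF z(2)]) (use x(2) in blast)
      then have "h u x = \<Phi> u x" by (rule h(3))
      moreover have "x \<in> fibre I X x" using x(1) by (simp add: fibre_def)
      then have "\<Phi> u x = 0" unfolding \<Phi>_def using finite_fibre by (auto intro!: prod_zero bexI[of _ x])
      ultimately show False using x(1) by (simp add: V_def)
    qed
    then show "y \<in> {y. \<forall>u. h u y = 0}" by blast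
  next
    fix y assume "y \<in> {y. \<forall>u. h u y = 0}"
    then have y: "h u y = 0" for u by blast
    show "y \<in> X"
    proof (rule ccontr)
      assume "y \<notin> X"
      then have "0 \<notin> (\<lambda>x. x - y) ` fibre I X y" by (auto simp: fibre_def)
      moreover have "finite ((\<lambda>x. x - y) ` fibre I X y)" using finite_fibre by simp
      \<comment> \<open>This form separates \<open>y\<close> from the points of \<open>X\<close>
        over its base. The factors then stay above some \<open>\<eta>\<close> near \<open>y\<close>,
        so at nearby good points the extension is at least \<open>\<eta> ^ p\<close> in norm and
        cannot tend to 0.\<close>
      ultimately obtain u where u: "\<forall>v\<in>(\<lambda>x. x - y) ` fibre I X y. lin u v \<noteq> 0"
        using separating_functional by blast
      have "lin u y \<noteq> lin u x" if "x \<in> fibre I X y" for x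
      proof -
        have "lin u (x - y) \<noteq> 0" using u that by blast
        then show ?thesis by (simp add: lin_diff)
      qed
      then obtain \<eta> r where \<eta>: "\<eta> > 0" "r > 0" "\<forall>z\<in>ball y r. \<forall>x\<in>fibre I X z. \<eta> \<le> norm (lin u z - lin u x)"
        using fibres_stay_separated[of y u] by blast
      obtain p where p: "\<And>z. good z \<Longrightarrow> card (fibre I X z) = p" using good_card_constant by blast
      let ?V = "ball y r \<inter> h u -` ball 0 (\<eta> ^ p)"
      have "open ?V" by (intro open_Int open_ball open_vimage h(2))
      moreover have "y \<in> ?V" using y[of u] \<eta> by simp
      ultimately have "\<exists>z\<in>?V. good z" by (rule generic_at_dense[OF generic_good])
      then obtain z where z: "z \<in> ball y r" "norm (h u z) < \<eta> ^ p" "good z" by auto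
      have "\<eta> ^ p = (\<Prod>x\<in>fibre I X z. \<eta>)" using p[OF z(3)] by simp
      also have "\<dots> \<le> (\<Prod>x\<in>fibre I X z. norm (lin u z - lin u x))"
        by (rule prod_mono) (use \<eta> z(1) in auto)
      also have "\<dots> = norm (\<Phi> u z)" unfolding \<Phi>_def by (simp add: prod_norm)
      finally show False using z(2) h(3)[OF z(3), of u] by simp
    qed
  qed
  moreover have "\<forall>u. \<exists>p. \<forall>z. h u z = eval_poly p z" using h(1) unfolding poly_fun_def by blast
  from choice[OF this] obtain P where P: "\<forall>u z. h u z = eval_poly (P u) z" by blast
  ultimately have "X = {z. \<forall>p\<in>range P. eval_poly p z = 0}" by auto
  then show ?thesis unfolding algebraic_set_def by blast
qed

end

section \<open>Change of coordinates and the asymptotic condition\<close>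

lemma matrix_vector_mult_vector_scalar: "(A :: complex^'n^'m) *v (c *s x) = c *s (A *v x)"
  by (simp add: matrix_vector_mult_def vec_eq_iff sum_distrib_left mult_ac)

lemma matrix_vector_mult_inverse: "(A :: complex^'n^'n) ** B = mat 1 \<Longrightarrow> A *v (B *v x) = x"
  by (simp add: matrix_vector_mul_assoc)

lemma continuous_on_matrix_vector_mult [continuous_intros]:
  fixes A :: "complex^'n^'n"
  assumes "continuous_on S f" shows "continuous_on S (\<lambda>x. A *v f x)"
  by (rule bounded_linear.continuous_on[OF matrix_vector_mul_bounded_linear assms])

text \<open>The columns of \<open>N\<close> are a basis of the whole space extending one of
  \<open>L\<close>, numbered so that \<open>J\<close> indexes the basis of \<open>L\<close>;
  \<open>M\<close> reads off the coordinates.\<close>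

lemma subspace_as_coordinate_subspace:
  fixes L :: "(complex^'n) set" and J :: "'n set"
  assumes L: "vec.subspace L" and dim: "vec.dim L = card J"
  shows "\<exists>M N :: complex^'n^'n. M ** N = mat 1 \<and> N ** M = mat 1 \<and>
    L = {x. \<forall>k. k \<notin> J \<longrightarrow> (M *v x) $ k = 0}"
proof -
  obtain B where B: "B \<subseteq> L" "vec.independent B" "L \<subseteq> vec.span B" "card B = vec.dim L"
    using vec.basis_exists by blast
  obtain B' where B': "B \<subseteq> B'" "vec.independent B'" "(UNIV :: (complex^'n) set) \<subseteq> vec.span B'"
    using vec.maximal_independent_subset_extend[of B UNIV] B(2) by auto
  have fin: "finite B'" "finite B"
    using vec.finiteI_independent B'(2) B(2) by blast+
  have "card B' = vec.dim (UNIV :: (complex^'n) set)"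
    by (rule vec.basis_card_eq_dim[OF subset_UNIV B'(3,2)])
  then have cB': "card B' = CARD('n)" by (simp only: vec_dim_card)
  have cJ: "card J = card B" using B(4) dim by simp
  obtain g1 where g1: "bij_betw g1 J B" using finite_same_card_bij[OF _ fin(2) cJ] by auto
  have "card (-J) = card (B' - B)"
    using cJ cB' fin B'(1) by (simp add: card_Diff_subset Compl_eq_Diff_UNIV)
  then obtain g2 where g2: "bij_betw g2 (-J) (B' - B)" using finite_same_card_bij[of "-J" "B' - B"] fin(1) by auto
  define g where "g k = (if k \<in> J then g1 k else g2 k)" for k
  have gJ: "bij_betw g J B" using g1 by (rule bij_betw_cong[THEN iffD1, rotated]) (simp add: g_def)
  have "bij_betw g (-J) (B' - B)" using g2 by (rule bij_betw_cong[THEN iffD1, rotated]) (simp add: g_def)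
  from bij_betw_combine[OF gJ this] have g: "bij_betw g UNIV B'"
    using B'(1) by (simp add: Un_absorb1)
  define N :: "complex^'n^'n" where "N = (\<chi> i j. g j $ i)"
  have col: "column j N = g j" for j by (simp add: N_def column_def vec_eq_iff)
  have Nx: "N *v y = (\<Sum>k\<in>UNIV. y $ k *s g k)" for y by (simp add: matrix_mult_sum col)
  have "\<exists>M :: complex^'n^'n. M ** N = mat 1"
    unfolding matrix_left_invertible_independent_columns col
  proof (intro allI impI)
    fix c :: "'n \<Rightarrow> complex" and i
    assume "(\<Sum>i\<in>UNIV. c i *s g i) = 0"
    moreover have "(\<Sum>b\<in>B'. c (inv_into UNIV g b) *s b) = (\<Sum>i\<in>UNIV. c (inv_into UNIV g (g i)) *s g i)"
      by (rule sum.reindex_bij_betw[OF g, symmetric])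
    moreover have "inv_into UNIV g (g i) = i" for i using g by (simp add: bij_betw_def)
    ultimately have z: "(\<Sum>b\<in>B'. c (inv_into UNIV g b) *s b) = 0" by simp
    have "g i \<in> B'" using g by (auto simp: bij_betw_def)
    from vec.independentD[OF B'(2) fin(1) order_refl z this]
    show "c i = 0" using \<open>\<And>i. inv_into UNIV g (g i) = i\<close> by simp
  qed
  then obtain M :: "complex^'n^'n" where MN: "M ** N = mat 1" by blast
  then have NM: "N ** M = mat 1" by (simp only: matrix_left_right_inverse)
  have "L = {x. \<forall>k. k \<notin> J \<longrightarrow> (M *v x) $ k = 0}"
  proof
    have "vec.subspace {x. \<forall>k. k \<notin> J \<longrightarrow> (M *v x) $ k = 0}"
      by (rule vec.subspaceI) (auto simp: matrix_vector_right_distrib matrix_vector_mult_vector_scalar)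
    moreover have "B \<subseteq> {x. \<forall>k. k \<notin> J \<longrightarrow> (M *v x) $ k = 0}"
    proof
      fix b assume "b \<in> B"
      then obtain j where j: "j \<in> J" "b = g j" using gJ by (auto simp: bij_betw_def)
      have "N *v axis j 1 = b"
      proof -
        have "N *v axis j 1 = (\<Sum>k\<in>UNIV. if k = j then g j else 0)"
          unfolding Nx by (rule sum.cong) (auto simp: axis_def)
        then show ?thesis using j by simp
      qed
      then have "M *v b = axis j 1" using matrix_vector_mult_inverse[OF MN, of "axis j 1"] by simp
      then show "b \<in> {x. \<forall>k. k \<notin> J \<longrightarrow> (M *v x) $ k = 0}" using j(1) by (auto simp: axis_def)
    qed
    ultimately have "vec.span B \<subseteq> {x. \<forall>k. k \<notin> J \<longrightarrow> (M *v x) $ k = 0}" by (rule vec.span_minimal[rotated])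
    then show "L \<subseteq> {x. \<forall>k. k \<notin> J \<longrightarrow> (M *v x) $ k = 0}" using B(3) by blast
  next
    show "{x. \<forall>k. k \<notin> J \<longrightarrow> (M *v x) $ k = 0} \<subseteq> L"
    proof
      fix x assume x: "x \<in> {x. \<forall>k. k \<notin> J \<longrightarrow> (M *v x) $ k = 0}"
      have "(M *v x) $ k *s g k \<in> L" for k
      proof (cases "k \<in> J")
        case True
        then have "g k \<in> L" using gJ B(1) by (auto simp: bij_betw_def)
        then show ?thesis by (rule vec.subspace_scale[OF L])
      next
        case False
        then have "(M *v x) $ k = 0" using x by blast
        then show ?thesis using vec.subspace_0[OF L] by simp
      qed
      then have "(\<Sum>k\<in>UNIV. (M *v x) $ k *s g k) \<in> L" by (intro vec.subspace_sum[OF L])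
      then show "x \<in> L" using matrix_vector_mult_inverse[OF NM, of x] by (simp add: Nx)
    qed
  qed
  then show ?thesis using MN NM by blast
qed

section \<open>Holomorphic functions and analytic sets under linear maps\<close>

lemma holomorphic_fun_on_linear_compose:
  fixes A :: "complex^'m \<Rightarrow> complex^'n"
  assumes f: "holomorphic_fun_on f V" and A: "bounded_linear A" "\<And>c v. A (c *s v) = c *s A v"
    and "open W" "\<And>u. u \<in> W \<Longrightarrow> A u \<in> V"
  shows "holomorphic_fun_on (\<lambda>u. f (A u)) W"
  unfolding holomorphic_fun_on_def
proof (intro conjI ballI)
  fix u assume "u \<in> W"
  then obtain D where D: "(f has_derivative D) (at (A u))" "\<forall>c v. D (c *s v) = c * D v"
    using f assms(5) unfolding holomorphic_fun_on_def by blast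
  have "((\<lambda>u. f (A u)) has_derivative (\<lambda>h. D (A h))) (at u)"
    by (rule has_derivative_compose[OF bounded_linear_imp_has_derivative[OF A(1)] D(1)])
  then show "\<exists>D. ((\<lambda>u. f (A u)) has_derivative D) (at u) \<and> (\<forall>c v. D (c *s v) = c * D v)"
    using A(2) D(2) by (intro exI[of _ "\<lambda>h. D (A h)"]) simp
qed fact

lemma holomorphic_fun_on_nth: "open W \<Longrightarrow> holomorphic_fun_on (\<lambda>u. u $ k) W"
  unfolding holomorphic_fun_on_def
  by (auto intro!: exI[of _ "\<lambda>h. h $ k"] bounded_linear_imp_has_derivative bounded_linear_vec_nth)

lemma holomorphic_fun_on_linear_combination:
  fixes f :: "'j::finite \<Rightarrow> complex^'n \<Rightarrow> complex"
  assumes "open W" "\<And>j. holomorphic_fun_on (f j) W"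
  shows "holomorphic_fun_on (\<lambda>u. \<Sum>j\<in>UNIV. c j * f j u) W"
  unfolding holomorphic_fun_on_def
proof (intro conjI ballI)
  fix u assume u: "u \<in> W"
  have "\<forall>j. \<exists>D. (f j has_derivative D) (at u) \<and> (\<forall>c v. D (c *s v) = c * D v)"
    using assms(2) u unfolding holomorphic_fun_on_def by blast
  from choice[OF this] obtain D where D: "\<forall>j. (f j has_derivative D j) (at u) \<and> (\<forall>c v. D j (c *s v) = c * D j v)" by blast
  have "((\<lambda>u. \<Sum>j\<in>UNIV. c j * f j u) has_derivative (\<lambda>h. \<Sum>j\<in>UNIV. c j * D j h)) (at u)"
    using D by (intro has_derivative_sum has_derivative_mult_right) blast
  moreover have "(\<Sum>j\<in>UNIV. c j * D j (a *s v)) = a * (\<Sum>j\<in>UNIV. c j * D j v)" for a v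
    using D by (simp add: sum_distrib_left mult_ac)
  ultimately show "\<exists>D. ((\<lambda>u. \<Sum>j\<in>UNIV. c j * f j u) has_derivative D) (at u) \<and> (\<forall>c v. D (c *s v) = c * D v)"
    by blast
qed fact

text \<open>Continuity of the derivative is not part of the definition of holomorphy. It holds
  because directional derivatives are again holomorphic along lines, by Cauchy's formula, and in
  finite dimension continuity of a linear map may be tested on each vector.\<close>

lemma holomorphic_map_C1:
  fixes H :: "complex^'n \<Rightarrow> complex^'n"
  assumes H: "\<And>k. holomorphic_fun_on (\<lambda>u. H u $ k) W"
  shows "\<exists>H'. (\<forall>u\<in>W. (H has_derivative blinfun_apply (H' u)) (at u)) \<and> continuous_on W H'"
proof -
  have "\<forall>k. \<forall>u\<in>W. \<exists>D. ((\<lambda>u. H u $ k) has_derivative D) (at u) \<and> (\<forall>c v. D (c *s v) = c * D v)"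
    using H unfolding holomorphic_fun_on_def by blast
  then have "\<forall>k. \<exists>D. \<forall>u\<in>W. ((\<lambda>u. H u $ k) has_derivative D u) (at u) \<and> (\<forall>c v. D u (c *s v) = c * D u v)"
    using bchoice by meson
  from choice[OF this] obtain D where
    D: "\<forall>k. \<forall>u\<in>W. ((\<lambda>u. H u $ k) has_derivative D k u) (at u) \<and> (\<forall>c v. D k u (c *s v) = c * D k u v)" by blast
  have der: "(H has_derivative (\<lambda>h. \<chi> k. D k u h)) (at u)" if u: "u \<in> W" for u
  proof (subst has_derivative_componentwise_within, intro ballI)
    fix b :: "complex^'n" assume "b \<in> Basis"
    then obtain k c where b: "b = axis k c" "c \<in> Basis" by (auto simp: Basis_vec_def)
    have "((\<lambda>u. H u $ k) has_derivative D k u) (at u)" using D u by blast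
    from has_derivative_inner_left[OF this, of c]
    show "((\<lambda>x. H x \<bullet> b) has_derivative (\<lambda>x. (\<chi> k. D k u x) \<bullet> b)) (at u)"
      by (simp add: b inner_axis)
  qed
  define H' where "H' u = Blinfun (\<lambda>h. \<chi> k. D k u h)" for u
  have app: "blinfun_apply (H' u) = (\<lambda>h. \<chi> k. D k u h)" if "u \<in> W" for u
    unfolding H'_def by (rule bounded_linear_Blinfun_apply[OF has_derivative_bounded_linear[OF der[OF that]]])
  have "continuous_on W H'"
  proof (rule continuous_on_blinfun_componentwise)
    fix v :: "complex^'n"
    have "continuous_on W (\<lambda>u. \<chi> k. deriv (\<lambda>s. H (u + s *s v) $ k) 0)"
      by (intro continuous_on_vec_lambda
          line_holo_on_continuous[OF line_holo_on_deriv[OF holomorphic_fun_on_imp_line_holo_on[OF H]]])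
    then show "continuous_on W (\<lambda>u. blinfun_apply (H' u) v)"
    proof (rule continuous_on_eq)
      fix u assume u: "u \<in> W"
      have "deriv (\<lambda>s. H (u + s *s v) $ k) 0 = D k u v" for k
        by (rule DERIV_imp_deriv, rule holomorphic_fun_on_derivative_along_line) (use D u in blast)+
      then show "(\<chi> k. deriv (\<lambda>s. H (u + s *s v) $ k) 0) = blinfun_apply (H' u) v"
        by (simp add: app[OF u])
    qed
  qed
  moreover have "(H has_derivative blinfun_apply (H' u)) (at u)" if "u \<in> W" for u
    using der[OF that] by (simp add: app[OF that])
  ultimately show ?thesis by blast
qed

lemma complex_analytic_set_linear_image:
  fixes M N :: "complex^'n^'n"
  assumes X: "complex_analytic_set X" and MN: "M ** N = mat 1" "N ** M = mat 1"
  shows "complex_analytic_set ((*v) M ` X)"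
  unfolding complex_analytic_set_def
proof
  fix a
  obtain U F where U: "open U" "N *v a \<in> U" "finite F" "\<forall>f\<in>F. holomorphic_fun_on f U"
    "X \<inter> U = {z \<in> U. \<forall>f\<in>F. f z = 0}"
    using X unfolding complex_analytic_set_def by meson
  let ?U = "(*v) N -` U"
  let ?F = "(\<lambda>f y. f (N *v y)) ` F"
  have oU: "open ?U" by (rule open_vimage[OF U(1)]) (intro continuous_intros)
  have "holomorphic_fun_on f' ?U" if f': "f' \<in> ?F" for f'
  proof -
    obtain f where f: "f \<in> F" "f' = (\<lambda>y. f (N *v y))" using f' by blast
    have "holomorphic_fun_on (\<lambda>y. f (N *v y)) ?U"
      by (rule holomorphic_fun_on_linear_compose[of f U]) (use U(4) f(1) oU in \<open>auto simp: matrix_vector_mult_vector_scalar\<close>)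
    then show ?thesis using f(2) by simp
  qed
  moreover have "(*v) M ` X \<inter> ?U = {y \<in> ?U. \<forall>f'\<in>?F. f' y = 0}"
  proof -
    have "y \<in> (*v) M ` X \<longleftrightarrow> N *v y \<in> X" for y
      using matrix_vector_mult_inverse[OF MN(1)] matrix_vector_mult_inverse[OF MN(2)] by (metis image_iff)
    then have "(*v) M ` X \<inter> ?U = {y. N *v y \<in> X \<inter> U}" by auto
    also have "\<dots> = {y \<in> ?U. \<forall>f'\<in>?F. f' y = 0}" unfolding U(5) by auto
    finally show ?thesis .
  qed
  ultimately show "\<exists>U F. open U \<and> a \<in> U \<and> finite F \<and> (\<forall>f\<in>F. holomorphic_fun_on f U) \<and>
      (*v) M ` X \<inter> U = {z \<in> U. \<forall>f\<in>F. f z = 0}"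
    using oU U(2,3) by (intro exI[of _ ?U] exI[of _ ?F]) auto
qed

lemma algebraic_set_linear_image:
  fixes M N :: "complex^'n^'n"
  assumes "algebraic_set ((*v) M ` X)" and NM: "N ** M = mat 1"
  shows "algebraic_set X"
proof -
  obtain P where P: "(*v) M ` X = {z. \<forall>p\<in>P. eval_poly p z = 0}"
    using assms(1) unfolding algebraic_set_def by blast
  have "poly_fun (\<lambda>z. eval_poly p (M *v z))" for p
  proof (rule poly_fun_compose)
    show "poly_fun (eval_poly p)" unfolding poly_fun_def by blast
    show "poly_fun (\<lambda>z. (M *v z) $ k)" for k
    proof -
      have "poly_fun (\<lambda>z. \<Sum>j\<in>UNIV. M $ k $ j * z $ j)"
        by (rule poly_fun_sum, rule poly_fun_mult[OF poly_fun_const poly_fun_nth])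
      then show ?thesis by (simp add: matrix_vector_mult_def)
    qed
  qed
  then have "\<forall>p. \<exists>q. \<forall>z. eval_poly p (M *v z) = eval_poly q z" unfolding poly_fun_def by blast
  from choice[OF this] obtain Q where Q: "\<forall>p z. eval_poly p (M *v z) = eval_poly (Q p) z" by blast
  have "x \<in> X \<longleftrightarrow> M *v x \<in> (*v) M ` X" for x
  proof
    assume "M *v x \<in> (*v) M ` X"
    then obtain x' where x': "x' \<in> X" "M *v x = M *v x'" by blast
    have "x = N *v (M *v x)" by (simp only: matrix_vector_mult_inverse[OF NM])
    also have "\<dots> = x'" by (simp only: x'(2) matrix_vector_mult_inverse[OF NM])
    finally show "x \<in> X" using x'(1) by simp
  qed blast
  then have "X = {z. \<forall>q\<in>Q ` P. eval_poly q z = 0}" using Q unfolding P by auto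
  then show ?thesis unfolding algebraic_set_def by blast
qed

text \<open>If no constant works, there are points whose norm exceeds any multiple of 1 plus their
  base coordinates. Rescaled to norm 1 they accumulate at a unit vector with vanishing base
  coordinates, and \<open>N\<close> carries it to a nonzero vector of the tangent cone that
  \<open>none\<close> forbids.\<close>

lemma growth_of_no_asymptotic_direction:
  fixes M N :: "complex^'n^'n"
  assumes MN: "M ** N = mat 1" "N ** M = mat 1"
    and none: "\<And>v. v \<in> tangent_cone_at_infinity X \<Longrightarrow> (\<forall>j\<in>I. (M *v v) $ j = 0) \<Longrightarrow> v = 0"
  shows "\<exists>C. \<forall>x\<in>(*v) M ` X. \<forall>k. norm (x $ k) \<le> C * (1 + (\<Sum>j\<in>I. norm (x $ j)))"
proof (rule ccontr)
  assume neg: "\<not> ?thesis"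
  have "\<exists>x. x \<in> (*v) M ` X \<and> real (Suc n) * (1 + (\<Sum>j\<in>I. norm (x $ j))) < norm x" for n
  proof -
    obtain x k where x: "x \<in> (*v) M ` X" "\<not> norm (x $ k) \<le> real (Suc n) * (1 + (\<Sum>j\<in>I. norm (x $ j)))"
      using neg by blast
    then show ?thesis using Finite_Cartesian_Product.norm_nth_le[of x k] by (intro exI[of _ x]) auto
  qed
  then obtain x where x: "\<And>n. x n \<in> (*v) M ` X"
    "\<And>n. real (Suc n) * (1 + (\<Sum>j\<in>I. norm (x n $ j))) < norm (x n)" by metis
  define t where "t n = norm (x n)" for n
  have S0: "0 \<le> (\<Sum>j\<in>I. norm (x n $ j))" for n by (rule sum_nonneg) simp
  have t: "real (Suc n) < t n" for n
  proof -
    have "real (Suc n) * 1 \<le> real (Suc n) * (1 + (\<Sum>j\<in>I. norm (x n $ j)))"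
      by (rule mult_left_mono) (use S0 in auto)
    from le_less_trans[OF this x(2)[of n]] show ?thesis by (simp only: mult_1_right t_def)
  qed
  have tpos: "t n > 0" for n using t[of n] by simp
  define w where "w n = x n /\<^sub>R t n" for n
  have nw: "norm (w n) = 1" for n using tpos[of n] by (simp add: w_def t_def)
  have wI: "norm (w n $ j) \<le> 1 / real (Suc n)" if "j \<in> I" for n j
  proof -
    have "norm (x n $ j) \<le> (\<Sum>j\<in>I. norm (x n $ j))" by (rule member_le_sum[OF that]) auto
    then have "real (Suc n) * norm (x n $ j) \<le> real (Suc n) * (1 + (\<Sum>j\<in>I. norm (x n $ j)))"
      by (intro mult_left_mono) auto
    from less_imp_le[OF le_less_trans[OF this x(2)[of n]]]
    have "norm (x n $ j) * real (Suc n) \<le> t n" by (simp only: t_def mult.commute)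
    then have "norm (x n $ j) / t n \<le> 1 / real (Suc n)" using tpos[of n] by (simp add: field_simps)
    then show ?thesis using tpos[of n] by (simp add: w_def divide_inverse mult.commute)
  qed
  have "w n \<in> sphere 0 1" for n using nw by simp
  then obtain l \<sigma> where l: "l \<in> sphere 0 1" "strict_mono (\<sigma> :: nat \<Rightarrow> nat)" "(w \<circ> \<sigma>) \<longlonglongrightarrow> l"
    using compact_sphere[of "0 :: complex^'n" 1] unfolding compact_def by meson
  have lI: "l $ j = 0" if "j \<in> I" for j
  proof (rule LIMSEQ_unique)
    show "(\<lambda>n. (w \<circ> \<sigma>) n $ j) \<longlonglongrightarrow> l $ j" by (rule tendsto_vec_nth[OF l(3)])
    show "(\<lambda>n. (w \<circ> \<sigma>) n $ j) \<longlonglongrightarrow> 0"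
    proof (rule Lim_null_comparison)
      have "(\<lambda>n. 1 / real (Suc n)) \<longlonglongrightarrow> 0" using LIMSEQ_inverse_real_of_nat by (simp add: inverse_eq_divide)
      from LIMSEQ_subseq_LIMSEQ[OF this l(2)] show "((\<lambda>n. 1 / real (Suc n)) \<circ> \<sigma>) \<longlonglongrightarrow> 0" .
      show "\<forall>\<^sub>F n in sequentially. norm ((w \<circ> \<sigma>) n $ j) \<le> ((\<lambda>n. 1 / real (Suc n)) \<circ> \<sigma>) n"
        using wI[OF that] by simp
    qed
  qed
  define v where "v = N *v l"
  have Mv: "M *v v = l" unfolding v_def by (rule matrix_vector_mult_inverse[OF MN(1)])
  have "v \<noteq> 0" using Mv l(1) by auto
  define y where "y n = N *v x (\<sigma> n)" for n
  have yX: "y n \<in> X" for n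
  proof -
    obtain z where z: "z \<in> X" "x (\<sigma> n) = M *v z" using x(1)[of "\<sigma> n"] by blast
    then show ?thesis using matrix_vector_mult_inverse[OF MN(2), of z] by (simp add: y_def)
  qed
  have bl: "bounded_linear ((*v) N)" by simp
  have yt: "y n /\<^sub>R t (\<sigma> n) = N *v (w \<circ> \<sigma>) n" for n
    using linear_scale[OF bounded_linear.linear[OF bl], of "inverse (t (\<sigma> n))" "x (\<sigma> n)"] by (simp add: y_def w_def)
  have lim: "(\<lambda>n. y n /\<^sub>R t (\<sigma> n)) \<longlonglongrightarrow> v"
    unfolding yt v_def by (rule bounded_linear.tendsto[OF bl l(3)])
  have "filterlim t at_top sequentially"
  proof (rule filterlim_at_top_mono[OF filterlim_real_sequentially])
    show "\<forall>\<^sub>F n in sequentially. real n \<le> t n" using t by (auto intro!: always_eventually less_imp_le order.strict_trans[OF _ t])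
  qed
  then have tlim: "filterlim (\<lambda>n. t (\<sigma> n)) at_top sequentially"
    by (rule filterlim_compose[OF _ filterlim_subseq[OF l(2)]])
  \<comment> \<open>The rescaled points tend to a nonzero vector and the scaling tends to infinity,
    so the points themselves are unbounded as the tangent cone requires.\<close>
  have "filterlim (\<lambda>n. norm (y n /\<^sub>R t (\<sigma> n)) * t (\<sigma> n)) at_top sequentially"
    by (rule filterlim_tendsto_pos_mult_at_top[OF tendsto_norm[OF lim] _ tlim]) (use \<open>v \<noteq> 0\<close> in simp)
  moreover have "norm (y n /\<^sub>R t (\<sigma> n)) * t (\<sigma> n) = norm (y n)" for n
    using tpos[of "\<sigma> n"] by simp
  ultimately have "filterlim (\<lambda>n. norm (y n)) at_top sequentially" by (simp only:)
  then have "v \<in> tangent_cone_at_infinity X"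
    unfolding tangent_cone_at_infinity_def using yX tpos tlim lim
    by (intro CollectI exI[of _ y] exI[of _ "\<lambda>n. t (\<sigma> n)"]) auto
  then show False using none[of v] Mv lI \<open>v \<noteq> 0\<close> by simp
qed

text \<open>There are regular points of dimension \<open>d\<close> near every point of
  \<open>X\<close>. In a chart there, the projection to the \<open>d\<close> coordinates in
  \<open>I\<close> is a holomorphic map with finite fibres between spaces of equal dimension, so its
  image has interior.\<close>

lemma pure_dimension_thick:
  fixes M N :: "complex^'n^'n"
  assumes MN: "M ** N = mat 1" "N ** M = mat 1"
    and X: "closed_pure_analytic_set d X" and d: "card I = d"
    and pp: "proper_projection ((*v) M ` X) I C"
    and V: "open V" "(*v) M ` X \<inter> V \<noteq> {}"
  shows "interior (sat I ((*v) M ` X \<inter> V)) \<noteq> {}"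
proof -
  obtain x where x: "x \<in> X" "M *v x \<in> V" using V(2) by blast
  define U1 where "U1 = (*v) M -` V"
  have oU1: "open U1" unfolding U1_def by (rule open_vimage[OF V(1)]) (intro continuous_intros)
  have "x \<in> closure (regular_points d X)"
    using X x(1) unfolding closed_pure_analytic_set_def has_dimension_at_def by blast
  moreover have "x \<in> U1" using x(2) by (simp add: U1_def)
  ultimately obtain z where z: "z \<in> U1" "z \<in> regular_points d X"
    using oU1 by (metis IntE disjoint_iff open_Int_closure_eq_empty)
  then obtain U0 V0 \<phi> L where L: "z \<in> X" "L \<in> complex_Grassmannian d" "z \<in> U0"
    "biholomorphic_between \<phi> U0 V0" "\<phi> ` (X \<inter> U0) = L \<inter> V0"
    unfolding regular_points_def by blast
  obtain \<psi> where \<psi>: "\<phi> ` U0 = V0" "holomorphic_map_on \<psi> V0" "\<forall>z\<in>U0. \<psi> (\<phi> z) = z"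
    using L(4) unfolding biholomorphic_between_def by blast
  have \<psi>h: "holomorphic_fun_on (\<lambda>y. \<psi> y $ k) V0" for k using \<psi>(2) by (simp add: holomorphic_map_on_def)
  have oV0: "open V0" using \<psi>h unfolding holomorphic_fun_on_def by blast
  have \<psi>c: "continuous_on V0 \<psi>"
    by (rule continuous_on_vec_components)
      (rule line_holo_on_continuous[OF holomorphic_fun_on_imp_line_holo_on[OF \<psi>h]])
  have \<phi>\<psi>: "\<phi> (\<psi> y) = y" if "y \<in> V0" for y using that \<psi>(1,3) by auto
  have "vec.subspace L" "vec.dim L = card I" using L(2) d by (auto simp: complex_Grassmannian_def)
  from subspace_as_coordinate_subspace[OF this] obtain M2 N2 :: "complex^'n^'n" where
    MN2: "M2 ** N2 = mat 1" "N2 ** M2 = mat 1" and Leq: "L = {x. \<forall>k. k \<notin> I \<longrightarrow> (M2 *v x) $ k = 0}" by blast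
  \<comment> \<open>As \<open>card I = d\<close>, the linear space \<open>L\<close> of the chart is
    parametrised by the coordinates in \<open>I\<close>; the others are set to 0.\<close>
  define A where "A u = N2 *v mix I u 0" for u
  have mixlin: "linear (\<lambda>u. mix I u 0)" by (rule linearI) (auto simp: vec_eq_iff)
  have blA: "bounded_linear A"
    unfolding A_def[abs_def]
    by (rule bounded_linear_compose[OF matrix_vector_mul_bounded_linear]) (use mixlin in \<open>simp add: linear_conv_bounded_linear\<close>)
  have As: "A (c *s v) = c *s A v" for c v
  proof -
    have "mix I (c *s v) 0 = c *s mix I v 0" by (simp add: vec_eq_iff)
    then show ?thesis by (simp add: A_def matrix_vector_mult_vector_scalar)
  qed
  have M2A: "M2 *v A u = mix I u 0" for u unfolding A_def by (rule matrix_vector_mult_inverse[OF MN2(1)])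
  have AL: "A u \<in> L" for u unfolding Leq by (simp add: M2A)
  define V1 where "V1 = V0 \<inter> \<psi> -` U1"
  have oV1: "open V1" unfolding V1_def by (rule continuous_open_preimage[OF \<psi>c oV0 oU1])
  define W where "W = A -` V1"
  have cA: "continuous_on UNIV A" by (rule linear_continuous_on[OF blA])
  have oW: "open W" unfolding W_def by (rule open_vimage[OF oV1 cA])
  have "M2 *v \<phi> z \<in> W"
  proof -
    have zL: "\<phi> z \<in> L \<inter> V0" using L(1,3,5) by blast
    then have "mix I (M2 *v \<phi> z) 0 = M2 *v \<phi> z" unfolding Leq by (auto simp: vec_eq_iff)
    then have "A (M2 *v \<phi> z) = \<phi> z" unfolding A_def by (simp add: matrix_vector_mult_inverse[OF MN2(2)])
    then show ?thesis using zL \<psi>(3) L(3) z(1) by (simp add: W_def V1_def)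
  qed
  then have neW: "W \<noteq> {}" by blast
  define g where "g u = M *v \<psi> (A u)" for u
  have gX: "g u \<in> (*v) M ` X \<inter> V" if u: "u \<in> W" for u
  proof -
    have Au: "A u \<in> V0" "\<psi> (A u) \<in> U1" using u by (auto simp: W_def V1_def)
    then have "A u \<in> \<phi> ` (X \<inter> U0)" using AL L(5) by blast
    then obtain p where p: "p \<in> X \<inter> U0" "A u = \<phi> p" by blast
    then have "\<psi> (A u) = p" using \<psi>(3) by simp
    then have "\<psi> (A u) \<in> X" using p(1) by simp
    then show ?thesis using Au(2) by (simp add: g_def U1_def)
  qed
  \<comment> \<open>Padding by the identity in the coordinates outside \<open>I\<close> turns the
    projection into a self-map of the full space, with image in the cylinder.\<close>
  define H where "H u = mix I (g u) u" for u
  have "holomorphic_fun_on (\<lambda>u. H u $ k) W" for k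
  proof (cases "k \<in> I")
    case True
    have "holomorphic_fun_on (\<lambda>u. \<psi> (A u) $ j) W" for j
      by (rule holomorphic_fun_on_linear_compose[OF \<psi>h blA As oW]) (simp add: W_def V1_def)
    then have "holomorphic_fun_on (\<lambda>u. \<Sum>j\<in>UNIV. M $ k $ j * \<psi> (A u) $ j) W"
      by (rule holomorphic_fun_on_linear_combination[OF oW])
    then show ?thesis using True by (simp add: H_def g_def matrix_vector_mult_def)
  next
    case False
    then show ?thesis by (simp add: H_def holomorphic_fun_on_nth[OF oW])
  qed
  from holomorphic_map_C1[of H W, OF this] obtain H' where
    H': "\<And>u. u \<in> W \<Longrightarrow> (H has_derivative blinfun_apply (H' u)) (at u)" "continuous_on W H'" by blast
  have "interior (H ` W) \<noteq> {}"
  proof (rule finite_fibres_imp_interior_image[OF oW neW H'])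
    fix c
    \<comment> \<open>Through the chart \<open>g u\<close> determines the coordinates of
      \<open>u\<close> in \<open>I\<close>, and \<open>H u\<close> determines the others; so a fibre
      of \<open>H\<close> injects into a fibre of the image of \<open>X\<close>.\<close>
    have "inj_on g {u \<in> W. H u = c}"
    proof (rule inj_onI)
      fix u u' assume u: "u \<in> {u \<in> W. H u = c}" "u' \<in> {u \<in> W. H u = c}" and eq: "g u = g u'"
      have V0: "A u \<in> V0" "A u' \<in> V0" using u by (auto simp: W_def V1_def)
      from eq have "N *v (M *v \<psi> (A u)) = N *v (M *v \<psi> (A u'))" unfolding g_def by (rule arg_cong)
      then have "\<psi> (A u) = \<psi> (A u')" by (simp only: matrix_vector_mult_inverse[OF MN(2)])
      then have "\<phi> (\<psi> (A u)) = \<phi> (\<psi> (A u'))" by (rule arg_cong)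
      then have "A u = A u'" by (simp only: \<phi>\<psi>[OF V0(1)] \<phi>\<psi>[OF V0(2)])
      then have "M2 *v A u = M2 *v A u'" by (rule arg_cong)
      then have mixeq: "mix I u 0 = mix I u' 0" by (simp only: M2A)
      have "H u = H u'" using u by simp
      show "u = u'"
      proof (rule vec_eq_iff[THEN iffD2], rule allI)
        fix k
        show "u $ k = u' $ k"
        proof (cases "k \<in> I")
          case True
          then show ?thesis using arg_cong[OF mixeq, of "\<lambda>v. v $ k"] by simp
        next
          case False
          then show ?thesis using arg_cong[OF \<open>H u = H u'\<close>, of "\<lambda>v. v $ k"] by (simp add: H_def)
        qed
      qed
    qed
    moreover have "g ` {u \<in> W. H u = c} \<subseteq> fibre I ((*v) M ` X) c"
    proof (rule image_subsetI)
      fix u assume u: "u \<in> {u \<in> W. H u = c}"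
      have "g u $ k = c $ k" if "k \<in> I" for k using u that by (auto simp: H_def)
      then show "g u \<in> fibre I ((*v) M ` X) c" using gX[of u] u by (simp add: fibre_def)
    qed
    ultimately show "finite {u \<in> W. H u = c}"
      using proper_projection.finite_fibre[OF pp] by (rule inj_on_finite)
  qed
  moreover have "H ` W \<subseteq> sat I ((*v) M ` X \<inter> V)"
  proof (rule image_subsetI)
    fix u assume "u \<in> W"
    then have "g u \<in> (*v) M ` X \<inter> V" by (rule gX)
    moreover have "\<forall>k\<in>I. g u $ k = H u $ k" by (simp add: H_def)
    ultimately show "H u \<in> sat I ((*v) M ` X \<inter> V)" unfolding sat_def by blast
  qed
  ultimately show ?thesis using interior_mono by blast
qed

lemma complex_line_in_projectivization:
  fixes v :: "complex^'n"
  assumes "vec.subspace L" "v \<in> L" "v \<noteq> 0" shows "complex_line v \<in> projectivization L"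
proof -
  have eq: "complex_line v = vec.span {v}" by (auto simp: complex_line_def vec.span_singleton)
  have "vec.dim (vec.span {v}) = 1"
    using assms(3) by (subst vec.dim_span_eq_card_independent) simp_all
  then have "complex_line v \<in> complex_Grassmannian 1"
    unfolding eq complex_Grassmannian_def by simp
  moreover have "complex_line v \<subseteq> L"
    unfolding eq by (rule vec.span_minimal) (use assms in auto)
  ultimately show ?thesis by (simp add: projectivization_def)
qed

theorem corollary3p3:
  fixes X :: "(complex^'n) set" and d :: nat
  assumes "0 < d" and "d < CARD('n)"
    and "closed_pure_analytic_set d X"
    and "\<not> algebraic_set X"
  shows "\<forall>L \<in> complex_Grassmannian (CARD('n) - d).
           projectivization L \<inter> asymptotic_directions X \<noteq> {}"
proof (rule ballI, rule notI)
  fix L :: "(complex^'n) set"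
  assume L: "L \<in> complex_Grassmannian (CARD('n) - d)"
    and none: "projectivization L \<inter> asymptotic_directions X = {}"
  \<comment> \<open>Any index set of size \<open>d\<close> will do: the linear change of coordinates
    is chosen afterwards so that these coordinates cut out \<open>L\<close>.\<close>
  obtain I :: "'n set" where I: "card I = d"
    using obtain_subset_with_card_n[of d "UNIV :: 'n set"] assms(2) by auto
  have sub: "vec.subspace L" and "vec.dim L = card (- I)"
    using L I by (auto simp: complex_Grassmannian_def card_Diff_subset Compl_eq_Diff_UNIV)
  from subspace_as_coordinate_subspace[OF this] obtain M N :: "complex^'n^'n" where
    MN: "M ** N = mat 1" "N ** M = mat 1" and Leq: "L = {x. \<forall>k. k \<notin> - I \<longrightarrow> (M *v x) $ k = 0}" by blast
  have "v = 0" if "v \<in> tangent_cone_at_infinity X" "\<forall>j\<in>I. (M *v v) $ j = 0" for v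
  proof (rule ccontr)
    assume "v \<noteq> 0"
    then have "complex_line v \<in> asymptotic_directions X"
      using that(1) by (simp add: asymptotic_directions_def)
    moreover have "v \<in> L" using that(2) by (simp add: Leq)
    then have "complex_line v \<in> projectivization L"
      using complex_line_in_projectivization[OF sub _ \<open>v \<noteq> 0\<close>] by blast
    ultimately show False using none by blast
  qed
  from growth_of_no_asymptotic_direction[OF MN this] obtain C where
    C: "\<forall>x\<in>(*v) M ` X. \<forall>k. norm (x $ k) \<le> C * (1 + (\<Sum>j\<in>I. norm (x $ j)))" by blast
  have "complex_analytic_set X" using assms(3) by (simp add: closed_pure_analytic_set_def)
  then have pp: "proper_projection ((*v) M ` X) I C"
    using complex_analytic_set_linear_image[OF _ MN] C by unfold_locales auto
  interpret proper_projection "(*v) M ` X" I C by (rule pp)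
  interpret branched_cover "(*v) M ` X" I C
    by unfold_locales (rule pure_dimension_thick[OF MN assms(3) I pp])
  show False using algebraic_set_linear_image[OF algebraic MN(2)] assms(4) by blast
qed

end
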